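(* Let $E\subset\mathbb{C}$ be a closed set and let $w$ be an admissible weight on $E$. Let $\nu_1,\dots,\nu_m$ be positive compactly supported Borel measures on $\mathbb{C}$ with potentials $p_j(z)=\int\log|z-t|\,d\nu_j(t)$, such that $\nu_j(\mathbb{C})=\alpha_j$ and $\sum_{j=1}^m\alpha_j=1$. Then \[ \sum_{j=1}^m\sup_E(\alpha_j\log w+p_j) \le C_E^w(m)+\sup_E\left(\log w+\sum_{j=1}^m p_j\right) \le C_E^w+\sup_E\left(\log w+\sum_{j=1}^m p_j\right), \] where \[ C_E^w(m):=\sup_{c_1,\dots,c_m\in E}\int\log\max_{1\le k\le m} w(c_k)|z-c_k|\,d\mu_w(z)+F_w, \qquad C_E^w:=\int\log d_E^w(z)\,d\mu_w(z)+F_w . \] For each fixed $m\ge 2$, $C_E^w(m)$ cannot be replaced by a smaller value, and $C_E^w$ cannot be replaced by a smaller value independent of $m$.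
   Context: A weight $w:E\to[0,\infty)$ is admissible if $w$ is upper semicontinuous on $E$, the set $\{z\in E: w(z)>0\}$ has positive logarithmic capacity, and, if $E$ is unbounded, $|z|w(z)\to 0$ as $|z|\to\infty$, $z\in E$. The weighted equilibrium measure $\mu_w$ is the (unique) positive unit Borel measure with compact support $S_w\subset E$, and $F_w$ the (unique) constant, such that $\int\log|z-t|\,d\mu_w(t)+\log w(z)+F_w\ge 0$ for $z\in S_w$ and $\int\log|z-t|\,d\mu_w(t)+\log w(z)+F_w\le 0$ for quasi every $z\in E$ (except on a set of zero logarithmic capacity). The weighted farthest-point distance function is $d_E^w(z):=\sup_{t\in E}w(t)|z-t|$, $z\in\mathbb{C}$. Here $\log 0=-\infty$. *)

theory Defs
  imports "HOL-Analysis.Analysis"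
begin

definition elog :: "real \<Rightarrow> ereal" where
  "elog x = (if x \<le> 0 then - \<infinity> else ereal (ln x))"

definition eint :: "'a measure \<Rightarrow> ('a \<Rightarrow> ereal) \<Rightarrow> ereal" where
  "eint M f = enn2ereal (\<integral>\<^sup>+ x. e2ennreal (f x) \<partial>M) - enn2ereal (\<integral>\<^sup>+ x. e2ennreal (- f x) \<partial>M)"

definition logpot :: "complex measure \<Rightarrow> complex \<Rightarrow> ereal" where
  "logpot \<nu> z = eint \<nu> (\<lambda>t. elog (cmod (z - t)))"

definition cs_borel_measure :: "complex measure \<Rightarrow> bool" where
  "cs_borel_measure \<nu> \<longleftrightarrow> sets \<nu> = sets borel \<and> emeasure \<nu> UNIV < \<infinity> \<and>
     (\<exists>K. compact K \<and> emeasure \<nu> (UNIV - K) = 0)"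

definition msupp :: "complex measure \<Rightarrow> complex set" where
  "msupp \<mu> = {z. \<forall>e>0. emeasure \<mu> (ball z e) > 0}"

text \<open>Zero logarithmic capacity (inner capacity): every compactly supported
  Borel probability measure carried by a compact subset has infinite energy,
  i.e. \<integral>\<integral> log|z-t| d\<mu> d\<mu> = -\<infinity>.\<close>
definition zero_cap :: "complex set \<Rightarrow> bool" where
  "zero_cap A \<longleftrightarrow> (\<forall>K \<mu>. compact K \<and> K \<subseteq> A \<and> sets \<mu> = sets borel \<and>
      emeasure \<mu> UNIV = 1 \<and> emeasure \<mu> (UNIV - K) = 0 \<longrightarrow>
      eint \<mu> (\<lambda>z. logpot \<mu> z) = - \<infinity>)"

definition admissible_weight :: "complex set \<Rightarrow> (complex \<Rightarrow> real) \<Rightarrow> bool" where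
  "admissible_weight E w \<longleftrightarrow>
     (\<forall>z\<in>E. w z \<ge> 0) \<and>
     (\<forall>z\<in>E. \<forall>c. w z < c \<longrightarrow> (\<exists>e>0. \<forall>y\<in>E. dist y z < e \<longrightarrow> w y < c)) \<and>
     \<not> zero_cap {z\<in>E. w z > 0} \<and>
     (\<not> bounded E \<longrightarrow> (\<forall>e>0. \<exists>R. \<forall>z\<in>E. cmod z > R \<longrightarrow> cmod z * w z < e))"

definition weighted_equilibrium :: "complex set \<Rightarrow> (complex \<Rightarrow> real) \<Rightarrow> complex measure \<Rightarrow> real \<Rightarrow> bool" where
  "weighted_equilibrium E w \<mu> F \<longleftrightarrow>
     sets \<mu> = sets borel \<and> emeasure \<mu> UNIV = 1 \<and>
     compact (msupp \<mu>) \<and> msupp \<mu> \<subseteq> E \<and>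
     (\<forall>z\<in>msupp \<mu>. logpot \<mu> z + elog (w z) + ereal F \<ge> 0) \<and>
     zero_cap {z\<in>E. logpot \<mu> z + elog (w z) + ereal F > 0}"

definition farthest_dist :: "complex set \<Rightarrow> (complex \<Rightarrow> real) \<Rightarrow> complex \<Rightarrow> real" where
  "farthest_dist E w z = (SUP t\<in>E. w t * cmod (z - t))"

definition C_m :: "complex set \<Rightarrow> (complex \<Rightarrow> real) \<Rightarrow> complex measure \<Rightarrow> real \<Rightarrow> nat \<Rightarrow> ereal" where
  "C_m E w \<mu> F m = (SUP c\<in>{c :: nat \<Rightarrow> complex. \<forall>k<m. c k \<in> E}.
       eint \<mu> (\<lambda>z. elog (Max ((\<lambda>k. w (c k) * cmod (z - c k)) ` {..<m})))) + ereal F"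

definition C_const :: "complex set \<Rightarrow> (complex \<Rightarrow> real) \<Rightarrow> complex measure \<Rightarrow> real \<Rightarrow> ereal" where
  "C_const E w \<mu> F = eint \<mu> (\<lambda>z. elog (farthest_dist E w z)) + ereal F"

definition measure_family :: "nat \<Rightarrow> (nat \<Rightarrow> complex measure) \<Rightarrow> bool" where
  "measure_family m \<nu> \<longleftrightarrow> (\<forall>j<m. cs_borel_measure (\<nu> j)) \<and>
     (\<Sum>j<m. measure (\<nu> j) UNIV) = 1"

definition lhs_sum :: "complex set \<Rightarrow> (complex \<Rightarrow> real) \<Rightarrow> nat \<Rightarrow> (nat \<Rightarrow> complex measure) \<Rightarrow> ereal" where
  "lhs_sum E w m \<nu> = (\<Sum>j<m. SUP z\<in>E. ereal (measure (\<nu> j) UNIV) * elog (w z) + logpot (\<nu> j) z)"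

definition sup_total :: "complex set \<Rightarrow> (complex \<Rightarrow> real) \<Rightarrow> nat \<Rightarrow> (nat \<Rightarrow> complex measure) \<Rightarrow> ereal" where
  "sup_total E w m \<nu> = (SUP z\<in>E. elog (w z) + (\<Sum>j<m. logpot (\<nu> j) z))"

end

theory Submission
  imports
    Defs
    "HOL-Complex_Analysis.Complex_Analysis"
    "HOL-Probability.Probability"
    "HOL-Real_Asymp.Real_Asymp"
    "HOL-Computational_Algebra.Fundamental_Theorem_Algebra"
begin

text \<open>
  Upper bound: for points \<open>c\<^sub>j\<close> of \<open>E\<close>, the sum of the values at \<open>c\<^sub>j\<close> is at most the integral of
  \<open>f = log max\<^sub>k w(c\<^sub>k) |z - c\<^sub>k|\<close> against the sum \<open>\<nu>\<close> of the measures. On the support of \<open>\<mu>\<close> the potential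
  of \<open>\<nu>\<close> is at most that of \<open>\<mu>\<close> plus \<open>F + sup (log w + p)\<close>, hence everywhere by the principle of
  domination. The subharmonic function \<open>f\<close> is approximated by \<open>1/n\<close> times logarithms of polynomials of
  degree \<open>n\<close>, so the inequality between the potentials, summed over the zeros, carries over to the
  integrals of \<open>f\<close>.

  Sharpness: restrict \<open>\<mu>\<close> to the sets where \<open>w(c\<^sub>k) |z - c\<^sub>k|\<close> is the largest, and mix in a small multiple of a
  measure whose potential is very negative on the exceptional set of zero capacity; such a measure is
  the normalised counting measure of finitely many Leja points.

  All potentials are truncated, with \<open>ln (max r |z - t|)\<close> in place of \<open>log |z - t|\<close>, so that they are real
  and continuous.
\<close>

section \<open>Compactly carried measures\<close>

text \<open>The function \<open>f\<close> is, by the Riesz decomposition, a constant plus the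
  potential of a probability measure, so a bound between the potentials of \<nu> and \<mu>
  integrates to the same bound between the integrals of \<open>f\<close>. The zeros of the
  polynomials stand in for that measure. Averaging over coefficients prevents cancellation at a cost
  independent of n, which disappears after division by n.

  Domination has one obstacle: the potential of \<mu> is only semicontinuous, so an inequality on
  the support does not spread to a neighbourhood. Restricting \<mu> to a compact set of nearly full
  mass, where the truncated potentials converge uniformly, repairs this. Since \<nu> and the
  normalised restriction both have mass 1, the difference of their potentials vanishes at infinity
  and the maximum principle applies in the whole plane.

  In the sharpness part, zero capacity is available only as infinite energy of every measure. It
  becomes one strongly negative potential through Leja points and a weak limit of their counting
  measures. That limit is taken on [0,1], from which a space-filling curve covers the compact
  set.\<close>

lemma continuous_on_section:
  assumes "continuous_on UNIV (\<lambda>(x, t). h x t)"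
  shows "continuous_on UNIV (h x)"
  using continuous_on_compose2[OF assms, of UNIV "\<lambda>t. (x, t)"] by (simp add: continuous_on_Pair)

text \<open>\<open>C\<close> is any compact set of full measure. It can thus be shrunk for
  restrictions and enlarged for mixtures, and every continuous function is integrable.\<close>

locale compact_carried = finite_measure M for M :: "complex measure" +
  fixes C :: "complex set"
  assumes sets_eq [measurable_cong]: "sets M = sets borel"
    and compact_C: "compact C"
    and null_C: "emeasure M (UNIV - C) = 0"
begin

lemma space_eq: "space M = UNIV"
  using sets_eq_imp_space_eq[OF sets_eq] by simp

lemma C_borel [measurable]: "C \<in> sets M"
  using compact_C by (simp add: sets_eq borel_compact)

lemma AE_C: "AE x in M. x \<in> C"
proof -
  have "UNIV - C \<in> null_sets M"
    using null_C compact_C by (auto simp: null_sets_def sets_eq borel_compact)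
  then show ?thesis
    by (rule AE_I') (auto simp: space_eq)
qed

lemma integrable_cont:
  fixes g :: "complex \<Rightarrow> real"
  assumes "continuous_on UNIV g"
  shows "integrable M g"
proof -
  have "compact (g ` C)"
    by (rule compact_continuous_image[OF continuous_on_subset[OF assms] compact_C]) auto
  then obtain B where B: "\<And>x. x \<in> C \<Longrightarrow> \<bar>g x\<bar> \<le> B"
    using compact_imp_bounded bounded_iff by (metis imageI real_norm_def)
  show ?thesis
  proof (rule integrable_const_bound[where B = B])
    show "AE x in M. norm (g x) \<le> B" using AE_C by eventually_elim (use B in auto)
    show "g \<in> borel_measurable M"
      using borel_measurable_continuous_onI[OF assms] by simp
  qed
qed

lemma integral_mono_C:
  fixes f g :: "complex \<Rightarrow> real"
  assumes "continuous_on UNIV f" "continuous_on UNIV g" "\<And>t. t \<in> C \<Longrightarrow> f t \<le> g t"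
  shows "integral\<^sup>L M f \<le> integral\<^sup>L M g"
  by (rule integral_mono_AE[OF integrable_cont[OF assms(1)] integrable_cont[OF assms(2)]])
     (use AE_C in \<open>eventually_elim, use assms(3) in auto\<close>)

lemma integral_cong_C:
  fixes f g :: "complex \<Rightarrow> real"
  assumes "continuous_on UNIV f" "continuous_on UNIV g" "\<And>t. t \<in> C \<Longrightarrow> f t = g t"
  shows "integral\<^sup>L M f = integral\<^sup>L M g"
  by (intro antisym integral_mono_C) (use assms in auto)

text \<open>A convergent sequence together with its limit is compact, so \<open>h\<close> is bounded
  on its product with \<open>C\<close> and dominated convergence applies.\<close>

lemma continuous_on_integral:
  fixes h :: "'a::heine_borel \<Rightarrow> complex \<Rightarrow> real"
  assumes h: "continuous_on UNIV (\<lambda>(x, t). h x t)"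
  shows "continuous_on UNIV (\<lambda>x. \<integral>t. h x t \<partial>M)"
proof (rule continuous_on_sequentiallyI)
  fix u :: "nat \<Rightarrow> 'a" and a
  assume u: "u \<longlonglongrightarrow> a"
  have hx: "continuous_on UNIV (h x)" for x
    by (rule continuous_on_section[OF h])
  have "compact (insert a (range u))"
    by (rule compact_sequence_with_limit[OF u])
  then have "compact (insert a (range u) \<times> C)"
    using compact_C by (rule compact_Times)
  then have "compact ((\<lambda>(x, t). h x t) ` (insert a (range u) \<times> C))"
    by (intro compact_continuous_image continuous_on_subset[OF h]) auto
  then obtain B where B: "\<forall>y \<in> (\<lambda>(x, t). h x t) ` (insert a (range u) \<times> C). norm y \<le> B"
    using compact_imp_bounded bounded_iff by metis
  show "(\<lambda>n. \<integral>t. h (u n) t \<partial>M) \<longlonglongrightarrow> (\<integral>t. h a t \<partial>M)"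
  proof (rule integral_dominated_convergence[where w = "\<lambda>_. B"])
    show "h a \<in> borel_measurable M" "\<And>n. h (u n) \<in> borel_measurable M"
      using borel_measurable_continuous_onI[OF hx] by simp_all
    show "integrable M (\<lambda>_. B)" by simp
    have "(\<lambda>n. h (u n) x) \<longlonglongrightarrow> h a x" for x
    proof -
      have "(\<lambda>n. (u n, x)) \<longlonglongrightarrow> (a, x)"
        using u by (auto intro!: tendsto_intros)
      from continuous_on_tendsto_compose[OF h this] show ?thesis by simp
    qed
    then show "AE x in M. (\<lambda>n. h (u n) x) \<longlonglongrightarrow> h a x" by simp
    show "AE x in M. norm (h (u n) x) \<le> B" for n
      using AE_C by eventually_elim (use B in auto)
  qed
qed

lemma integral_swap:
  fixes h :: "real \<Rightarrow> complex \<Rightarrow> real"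
  assumes h: "continuous_on UNIV (\<lambda>(x, t). h x t)"
  shows "integral {a..b} (\<lambda>x. \<integral>t. h x t \<partial>M) = (\<integral>t. integral {a..b} (\<lambda>x. h x t) \<partial>M)"
proof -
  interpret pair_sigma_finite lborel M ..
  \<comment> \<open>The cut-off makes \<open>h\<close> bounded and supported on a set of finite
    product measure. Since \<open>M\<close> is carried by \<open>C\<close>, the iterated integrals
    keep their values.\<close>
  define g where "g x t = indicator {a..b} x * (indicator C t * h x t)" for x t
  have hx: "continuous_on UNIV (h x)" for x
    by (rule continuous_on_section[OF h])
  have ht: "continuous_on A (\<lambda>x. h x t)" for t A
    using continuous_on_compose2[OF h, of A "\<lambda>x. (x, t)"] by (simp add: continuous_on_Pair)
  have hm: "(\<lambda>(x, t). h x t) \<in> borel_measurable (lborel \<Otimes>\<^sub>M M)"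
    using borel_measurable_continuous_onI[OF h]
    by (simp add: borel_prod[symmetric] cong: measurable_cong_sets sets_pair_measure_cong[OF refl sets_eq])
  have "compact ((\<lambda>(x, t). h x t) ` ({a..b} \<times> C))"
    by (intro compact_continuous_image continuous_on_subset[OF h] compact_Times compact_C) auto
  then obtain B where B: "\<forall>y \<in> (\<lambda>(x, t). h x t) ` ({a..b} \<times> C). norm y \<le> B"
    using compact_imp_bounded bounded_iff by metis
  have gi: "integrable (lborel \<Otimes>\<^sub>M M) (\<lambda>(x, t). g x t)"
  proof (rule integrableI_bounded_set[where A = "{a..b} \<times> C" and B = B])
    show "{a..b} \<times> C \<in> sets (lborel \<Otimes>\<^sub>M M)" by simp
    show "(\<lambda>(x, t). g x t) \<in> borel_measurable (lborel \<Otimes>\<^sub>M M)"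
      unfolding g_def using hm by (simp add: split_beta')
    have "emeasure (lborel \<Otimes>\<^sub>M M) ({a..b} \<times> C) = emeasure lborel {a..b} * emeasure M C"
      by (rule sigma_finite_measure.emeasure_pair_measure_Times) (unfold_locales, auto)
    also have "\<dots> < \<infinity>" by (simp add: ennreal_mult_less_top emeasure_lborel_Icc_eq emeasure_eq_measure)
    finally show "emeasure (lborel \<Otimes>\<^sub>M M) ({a..b} \<times> C) < \<infinity>" .
    show "AE x in lborel \<Otimes>\<^sub>M M. x \<in> {a..b} \<times> C \<longrightarrow> norm (case x of (x, t) \<Rightarrow> g x t) \<le> B"
      using B by (auto simp: g_def)
    show "AE x in lborel \<Otimes>\<^sub>M M. x \<notin> {a..b} \<times> C \<longrightarrow> (case x of (x, t) \<Rightarrow> g x t) = 0"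
      by (auto simp: g_def indicator_def split: if_splits)
  qed
  have c1: "(\<integral>t. g x t \<partial>M) = indicator {a..b} x * (\<integral>t. h x t \<partial>M)" for x
    unfolding g_def
    by (subst integral_mult_right_zero, rule arg_cong[where f = "\<lambda>y. _ * y"], rule integral_cong_AE)
       (use AE_C borel_measurable_continuous_onI[OF hx] in \<open>auto\<close>)
  have c2: "(\<integral>x. g x t \<partial>lborel) = indicator C t * integral {a..b} (\<lambda>x. h x t)" for t
  proof -
    have "(\<integral>x. g x t \<partial>lborel) = indicator C t * (\<integral>x\<in>{a..b}. h x t \<partial>lborel)"
      unfolding g_def set_lebesgue_integral_def
      by (subst integral_mult_right_zero[symmetric]) (simp add: mult_ac)
    also have "(\<integral>x\<in>{a..b}. h x t \<partial>lborel) = integral {a..b} (\<lambda>x. h x t)"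
      by (rule set_borel_integral_eq_integral(2)) (rule borel_integrable_atLeastAtMost', rule ht)
    finally show ?thesis .
  qed
  have "integral {a..b} (\<lambda>x. \<integral>t. h x t \<partial>M) = (\<integral>x\<in>{a..b}. (\<integral>t. h x t \<partial>M) \<partial>lborel)"
    by (rule set_borel_integral_eq_integral(2)[symmetric])
       (rule borel_integrable_atLeastAtMost', rule continuous_on_subset[OF continuous_on_integral[OF h]], simp)
  also have "\<dots> = (\<integral>x. (\<integral>t. g x t \<partial>M) \<partial>lborel)"
    by (simp add: c1 set_lebesgue_integral_def)
  also have "\<dots> = (\<integral>t. (\<integral>x. g x t \<partial>lborel) \<partial>M)"
    using Fubini_integral[OF gi] by simp
  also have "\<dots> = (\<integral>t. indicator C t * integral {a..b} (\<lambda>x. h x t) \<partial>M)"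
    by (simp add: c2)
  also have "\<dots> = (\<integral>t. integral {a..b} (\<lambda>x. h x t) \<partial>M)"
  proof (rule integral_cong_AE)
    have "continuous_on UNIV (\<lambda>t. integral (cbox a b) (\<lambda>x. h x t))"
      by (rule integral_continuous_on_param)
         (use continuous_on_compose2[OF h, of "UNIV \<times> cbox a b" "\<lambda>(t, x). (x, t)"] in
          \<open>simp add: split_beta' continuous_on_Pair continuous_on_fst continuous_on_snd continuous_on_id\<close>)
    then have m: "(\<lambda>t. integral {a..b} (\<lambda>x. h x t)) \<in> borel_measurable M"
      using borel_measurable_continuous_onI by (simp add: cbox_interval measurable_cong_sets[OF sets_eq refl])
    then show "(\<lambda>t. integral {a..b} (\<lambda>x. h x t)) \<in> borel_measurable M"
      "(\<lambda>t. indicator C t * integral {a..b} (\<lambda>x. h x t)) \<in> borel_measurable M" by auto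
    show "AE t in M. indicator C t * integral {a..b} (\<lambda>x. h x t) = integral {a..b} (\<lambda>x. h x t)"
      using AE_C by eventually_elim auto
  qed
  finally show ?thesis .
qed

end

text \<open>The circle does not meet the origin or wind around it: Ln(1 + u q / a) is holomorphic on
  the closed unit disc and vanishes at u = 0. The real part of Cauchy's formula at the centre is the
  claim.\<close>

lemma log_circle_mean:
  fixes a q :: complex
  assumes "cmod q < cmod a"
  shows "integral {0..1} (\<lambda>\<theta>. ln (cmod (a + q * cis (2 * pi * \<theta>)))) = ln (cmod a)"
proof -
  define f where "f u = Ln (1 + u * q / a)" for u
  have a0: "a \<noteq> 0" using assms by auto
  have re: "Re (1 + u * q / a) > 0" if "cmod u \<le> 1" for u
  proof -
    have "cmod (u * q) \<le> 1 * cmod q"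
      unfolding norm_mult by (rule mult_right_mono[OF that]) simp
    then have "cmod (u * q / a) < 1"
      using assms a0 by (simp add: norm_divide divide_less_eq)
    moreover have "\<bar>Re (u * q / a)\<bar> \<le> cmod (u * q / a)" by (rule abs_Re_le_cmod)
    ultimately show ?thesis by simp
  qed
  have hol: "f holomorphic_on cball 0 1"
    unfolding f_def
    by (intro holomorphic_intros a0) (use re in \<open>auto simp: complex_nonpos_Reals_iff dest!: re\<close>)
  have "((\<lambda>u. f u / (u - 0)) has_contour_integral (2 * of_real pi * \<i> * f 0)) (circlepath 0 1)"
    by (rule Cauchy_integral_circlepath_simple[OF hol]) simp
  then have "((\<lambda>u. f u / u) has_contour_integral 0) (circlepath 0 1)"
    by (simp add: f_def)
  then have "((\<lambda>x. f (circlepath 0 1 x) / circlepath 0 1 x * vector_derivative (circlepath 0 1) (at x)) has_integral 0) {0..1}"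
    by (simp add: has_contour_integral)
  then have "((\<lambda>x. 2 * of_real pi * \<i> * f (cis (2 * pi * x))) has_integral 0) {0..1}"
    by (rule has_integral_eq[rotated])
       (simp add: vector_derivative_circlepath, simp add: circlepath cis_conv_exp field_simps)
  \<comment> \<open>The factor 2 pi i of the contour integral turns the real part of
    \<open>f\<close> into an imaginary part.\<close>
  from has_integral_Im[OF this]
  have "((\<lambda>x. 2 * pi * Re (f (cis (2 * pi * x)))) has_integral 0) {0..1}"
    by simp
  from has_integral_mult_right[OF this, of "1/(2*pi)"]
  have z: "((\<lambda>x. Re (f (cis (2 * pi * x)))) has_integral 0) {0..1}"
    by simp
  have eq: "ln (cmod (a + q * cis (2 * pi * \<theta>))) = ln (cmod a) + Re (f (cis (2 * pi * \<theta>)))" for \<theta>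
  proof -
    let ?u = "cis (2 * pi * \<theta>)"
    have r: "Re (1 + ?u * q / a) > 0" by (rule re) simp
    then have n0: "1 + ?u * q / a \<noteq> 0" by (metis less_irrefl zero_complex.sel(1))
    have "a + q * ?u = a * (1 + ?u * q / a)" using a0 by (simp add: field_simps)
    then have "cmod (a + q * ?u) = cmod a * cmod (1 + ?u * q / a)" by (metis norm_mult)
    then show ?thesis using n0 a0 by (simp add: ln_mult f_def)
  qed
  have "((\<lambda>x. ln (cmod a) + Re (f (cis (2 * pi * x)))) has_integral (ln (cmod a) + 0)) {0..1}"
    using has_integral_const_real[of "ln (cmod a)" 0 1] by (intro has_integral_add z) simp
  then show ?thesis unfolding eq by (simp add: integral_unique)
qed

section \<open>Truncated logarithmic potentials and the maximum principle\<close>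

text \<open>This is the potential of \<open>M\<close> after each point mass has been spread
  uniformly over the circle of radius \<open>r\<close>. It is continuous, still subharmonic, and
  decreases to the logarithmic potential as \<open>r\<close> tends to 0.\<close>

definition rpot :: "real \<Rightarrow> complex measure \<Rightarrow> complex \<Rightarrow> real" where
  "rpot r M z = (\<integral>t. ln (max r (cmod (z - t))) \<partial>M)"

lemma continuous_on_trunc_log:
  assumes "continuous_on A f" "0 < r"
  shows "continuous_on A (\<lambda>x. ln (max r (cmod (f x))))"
  using assms by (intro continuous_intros) (auto simp: max_def)

lemma continuous_on_log_kernel:
  assumes "0 < r"
  shows "continuous_on UNIV (\<lambda>(z, t). ln (max r (cmod (z - t))))"
  unfolding split_beta' by (intro continuous_on_trunc_log continuous_intros assms)

lemma ln_max_mono: "0 < r \<Longrightarrow> r \<le> r' \<Longrightarrow> x \<le> y \<Longrightarrow> ln (max r x) \<le> ln (max r' (y::real))"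
  by (subst ln_le_cancel_iff) auto

context compact_carried begin

abbreviation mass :: real where "mass \<equiv> measure M UNIV"

lemma kernel_integrable:
  assumes "0 < r"
  shows "integrable M (\<lambda>t. ln (max r (cmod (z - t))))"
  by (intro integrable_cont continuous_on_trunc_log continuous_intros assms)

lemma rpot_cont:
  assumes "0 < r"
  shows "continuous_on UNIV (rpot r M)"
  unfolding rpot_def[abs_def]
  by (rule continuous_on_integral[OF continuous_on_log_kernel[OF assms]])

lemma rpot_mono:
  assumes "0 < r" "r \<le> r'"
  shows "rpot r M z \<le> rpot r' M z"
  unfolding rpot_def
  by (intro integral_mono kernel_integrable ln_max_mono) (use assms in auto)

lemma rpot_upper:
  assumes "0 < r" "r \<le> D" "\<And>t. t \<in> C \<Longrightarrow> cmod (z - t) \<le> D"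
  shows "rpot r M z \<le> mass * ln D"
proof -
  have "rpot r M z \<le> (\<integral>t. ln D \<partial>M)"
    unfolding rpot_def
    by (intro integral_mono_C continuous_on_trunc_log continuous_intros)
       (use assms in \<open>auto simp: ln_le_cancel_iff\<close>)
  then show ?thesis by (simp add: space_eq)
qed

lemma rpot_lower:
  assumes "0 < r" "0 < D" "\<And>t. t \<in> C \<Longrightarrow> D \<le> cmod (z - t)"
  shows "mass * ln D \<le> rpot r M z"
proof -
  have "(\<integral>t. ln D \<partial>M) \<le> rpot r M z"
    unfolding rpot_def
    by (intro integral_mono_C continuous_on_trunc_log continuous_intros)
       (use assms in \<open>auto simp: ln_le_cancel_iff le_max_iff_disj\<close>)
  then show ?thesis by (simp add: space_eq)
qed

lemma C_ball:
  obtains R where "0 < R" "C \<subseteq> ball 0 R"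
proof -
  from compact_imp_bounded[OF compact_C] obtain R where "\<forall>x\<in>C. norm x \<le> R"
    unfolding bounded_iff by auto
  then show ?thesis by (intro that[of "\<bar>R\<bar> + 1"]) (auto simp: subset_iff intro: order_le_less_trans[of _ R])
qed

text \<open>Consequently the difference of two potentials of equal mass tends to 0 at infinity, the
  normalisation used in the maximum principle.\<close>

lemma rpot_at_infinity:
  assumes r: "0 < r"
  shows "((\<lambda>z. rpot r M z - mass * ln (cmod z)) \<longlongrightarrow> 0) at_infinity"
proof -
  obtain R where R: "0 < R" "C \<subseteq> ball 0 R" by (rule C_ball)
  have d: "cmod z - R \<le> cmod (z - t)" "cmod (z - t) \<le> cmod z + R" if "t \<in> C" for z t
  proof -
    have "cmod t < R" using that R by auto
    then show "cmod z - R \<le> cmod (z - t)" "cmod (z - t) \<le> cmod z + R"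
      using norm_triangle_ineq2[of z t] norm_triangle_ineq4[of z t] by linarith+
  qed
  have n: "filterlim (norm :: complex \<Rightarrow> real) at_top at_infinity"
    by (rule filterlim_norm_at_top)
  have ev: "\<forall>\<^sub>F z :: complex in at_infinity. norm z > R + r"
    using filterlim_at_top_dense[THEN iffD1, OF n] by blast
  show ?thesis
  proof (rule tendsto_sandwich)
    show "\<forall>\<^sub>F z in at_infinity. mass * (ln (norm z - R) - ln (norm z)) \<le> rpot r M z - mass * ln (cmod z)"
      using ev
    proof eventually_elim
      case (elim z)
      have "mass * ln (cmod z - R) \<le> rpot r M z"
        by (rule rpot_lower) (use r elim d in auto)
      then show ?case by (simp add: algebra_simps)
    qed
    show "\<forall>\<^sub>F z in at_infinity. rpot r M z - mass * ln (cmod z) \<le> mass * (ln (norm z + R) - ln (norm z))"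
      using ev
    proof eventually_elim
      case (elim z)
      have "rpot r M z \<le> mass * ln (cmod z + R)"
        by (rule rpot_upper) (use r elim d R in auto)
      then show ?case by (simp add: algebra_simps)
    qed
    have "((\<lambda>x. mass * (ln (x - R) - ln x)) \<longlongrightarrow> 0) at_top" by real_asymp
    from filterlim_compose[OF this n]
    show "((\<lambda>z::complex. mass * (ln (norm z - R) - ln (norm z))) \<longlongrightarrow> 0) at_infinity" .
    have "((\<lambda>x. mass * (ln (x + R) - ln x)) \<longlongrightarrow> 0) at_top" by real_asymp
    from filterlim_compose[OF this n]
    show "((\<lambda>z::complex. mass * (ln (norm z + R) - ln (norm z))) \<longlongrightarrow> 0) at_infinity" .
  qed
qed

lemma rpot_circle_integral:
  assumes "0 < r"
  shows "integral {0..1} (\<lambda>\<theta>. rpot r M (z + q * cis (2 * pi * \<theta>)))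
    = (\<integral>t. integral {0..1} (\<lambda>\<theta>. ln (max r (cmod (z + q * cis (2 * pi * \<theta>) - t)))) \<partial>M)"
  unfolding rpot_def
  by (rule integral_swap, unfold split_beta', intro continuous_on_trunc_log continuous_intros assms)

lemma continuous_on_circle_kernel:
  assumes "0 < r"
  shows "continuous_on UNIV (\<lambda>t. integral {0..1} (\<lambda>\<theta>. ln (max r (cmod (z + q * cis (2 * pi * \<theta>) - t)))))"
  unfolding cbox_interval[symmetric]
  by (rule integral_continuous_on_param, unfold split_beta', intro continuous_on_trunc_log continuous_intros assms)

text \<open>Conjugation and a rotation give |T e - t| = |T - cnj t * e| for |e| = 1. This is a
  circle of radius |t| < T around T, to which the mean value formula applies. The exact value makes
  the circle means of a difference of equal-mass potentials vanish.\<close>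

lemma rpot_large_circle:
  assumes "0 < r" "C \<subseteq> ball 0 R" "r + R < T"
  shows "integral {0..1} (\<lambda>\<theta>. rpot r M (of_real T * cis (2 * pi * \<theta>))) = mass * ln T"
proof -
  have T: "integral {0..1} (\<lambda>\<theta>. ln (max r (cmod (of_real T * cis (2 * pi * \<theta>) - t)))) = ln T" if "t \<in> C" for t
  proof -
    have t: "cmod t < R" using that assms by auto
    then have T0: "T > 0" using assms norm_ge_zero[of t] by linarith
    have "max r (cmod (of_real T * cis (2 * pi * \<theta>) - t)) = cmod (of_real T + (- cnj t) * cis (2 * pi * \<theta>))" for \<theta>
    proof -
      have "cmod (of_real T * cis (2 * pi * \<theta>)) = T" using T0 by (simp add: norm_mult)
      then have "T - cmod t \<le> cmod (of_real T * cis (2 * pi * \<theta>) - t)"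
        using norm_triangle_ineq2 by metis
      then have "max r (cmod (of_real T * cis (2 * pi * \<theta>) - t)) = cmod (of_real T * cis (2 * pi * \<theta>) - t)"
        using t assms by simp
      also have "\<dots> = cmod (cnj (of_real T * cis (2 * pi * \<theta>) - t))" by (simp only: complex_mod_cnj)
      also have "\<dots> = cmod (cnj (of_real T * cis (2 * pi * \<theta>) - t) * cis (2 * pi * \<theta>))" by (simp add: norm_mult)
      also have "cnj (of_real T * cis (2 * pi * \<theta>) - t) * cis (2 * pi * \<theta>) = of_real T + (- cnj t) * cis (2 * pi * \<theta>)"
        by (simp add: algebra_simps cis_cnj flip: cis_divide) (simp add: cis_mult)
      finally show ?thesis .
    qed
    then show ?thesis
      using log_circle_mean[of "- cnj t" "of_real T"] t T0 assms by simp
  qed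
  have "integral {0..1} (\<lambda>\<theta>. rpot r M (0 + of_real T * cis (2 * pi * \<theta>))) = (\<integral>t. ln T \<partial>M)"
    unfolding rpot_circle_integral[OF assms(1)]
    by (rule integral_cong_C[OF continuous_on_circle_kernel[OF assms(1)]]) (use T in auto)
  then show ?thesis by (simp add: space_eq)
qed

text \<open>For |z - t| \<le> r the kernel already has its least value \<open>ln r\<close> at
  \<open>z\<close>. Otherwise s < r keeps the circle away from \<open>t\<close>, where the
  untruncated logarithm has the mean value property and lies below the kernel.\<close>

lemma rpot_submean:
  assumes "0 < s" "s < r"
  shows "rpot r M z \<le> integral {0..1} (\<lambda>\<theta>. rpot r M (z + of_real s * cis (2 * pi * \<theta>)))"
proof -
  have r: "0 < r" using assms by simp
  have "ln (max r (cmod (z - t))) \<le> integral {0..1} (\<lambda>\<theta>. ln (max r (cmod (z + of_real s * cis (2 * pi * \<theta>) - t))))" for t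
  proof -
    have c: "continuous_on {0..1} (\<lambda>\<theta>. ln (max r (cmod (z + of_real s * cis (2 * pi * \<theta>) - t))))"
      by (intro continuous_on_trunc_log continuous_intros r)
    show ?thesis
    proof (cases "cmod (z - t) \<le> r")
      case True
      have "integral {0..1} (\<lambda>\<theta>::real. ln r) \<le> integral {0..1} (\<lambda>\<theta>. ln (max r (cmod (z + of_real s * cis (2 * pi * \<theta>) - t))))"
        by (rule integral_le) (use r in \<open>auto intro!: integrable_continuous_interval c\<close>)
      then show ?thesis using True by simp
    next
      case False
      have pos: "cmod (z - t + of_real s * cis (2 * pi * \<theta>)) > 0" for \<theta>
      proof -
        have "cmod (of_real s * cis (2 * pi * \<theta>)) = s" using assms by (simp add: norm_mult)
        then show ?thesis
          using False assms norm_diff_ineq[of "z - t" "of_real s * cis (2 * pi * \<theta>)"] by linarith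
      qed
      have "integral {0..1} (\<lambda>\<theta>. ln (cmod (z - t + of_real s * cis (2 * pi * \<theta>)))) \<le> integral {0..1} (\<lambda>\<theta>. ln (max r (cmod (z + of_real s * cis (2 * pi * \<theta>) - t))))"
      proof (rule integral_le)
        show "(\<lambda>\<theta>. ln (cmod (z - t + of_real s * cis (2 * pi * \<theta>)))) integrable_on {0..1}"
          by (intro integrable_continuous_interval continuous_intros) (use pos in auto)
        show "(\<lambda>\<theta>. ln (max r (cmod (z + of_real s * cis (2 * pi * \<theta>) - t)))) integrable_on {0..1}"
          by (rule integrable_continuous_interval[OF c])
        show "ln (cmod (z - t + of_real s * cis (2 * pi * x))) \<le> ln (max r (cmod (z + of_real s * cis (2 * pi * x) - t)))" for x
          using pos[of x] by (subst ln_le_cancel_iff) (auto simp: algebra_simps less_max_iff_disj)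
      qed
      then show ?thesis
        using log_circle_mean[of "of_real s" "z - t"] False assms by simp
    qed
  qed
  then have "rpot r M z \<le> (\<integral>t. integral {0..1} (\<lambda>\<theta>. ln (max r (cmod (z + of_real s * cis (2 * pi * \<theta>) - t)))) \<partial>M)"
    unfolding rpot_def
    by (intro integral_mono kernel_integrable r integrable_cont continuous_on_circle_kernel)
  then show ?thesis by (simp add: rpot_circle_integral[OF r])
qed

text \<open>The whole circle stays at distance at least \<open>r\<close> from every point of
  \<open>C\<close>, so the truncation is inactive on it and the kernel is harmonic there.\<close>

lemma rpot_mean_eq:
  assumes "0 < r" "0 < s" "\<And>t. t \<in> C \<Longrightarrow> r + s \<le> cmod (z - t)"
  shows "integral {0..1} (\<lambda>\<theta>. rpot r M (z + of_real s * cis (2 * pi * \<theta>))) = rpot r M z"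
proof -
  have "integral {0..1} (\<lambda>\<theta>. ln (max r (cmod (z + of_real s * cis (2 * pi * \<theta>) - t)))) = ln (max r (cmod (z - t)))"
    if t: "t \<in> C" for t
  proof -
    have "max r (cmod (z + of_real s * cis (2 * pi * \<theta>) - t)) = cmod (z - t + of_real s * cis (2 * pi * \<theta>))" for \<theta>
    proof -
      have "cmod (of_real s * cis (2 * pi * \<theta>)) = s" using assms by (simp add: norm_mult)
      then have "r \<le> cmod (z - t + of_real s * cis (2 * pi * \<theta>))"
        using assms(3)[OF t] norm_diff_ineq[of "z - t" "of_real s * cis (2 * pi * \<theta>)"] by linarith
      then show ?thesis by (simp add: algebra_simps)
    qed
    then show ?thesis
      using log_circle_mean[of "of_real s" "z - t"] assms(1,2) assms(3)[OF t] by simp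
  qed
  then have "(\<integral>t. integral {0..1} (\<lambda>\<theta>. ln (max r (cmod (z + of_real s * cis (2 * pi * \<theta>) - t)))) \<partial>M) = rpot r M z"
    unfolding rpot_def
    by (intro integral_cong_C continuous_on_circle_kernel continuous_on_trunc_log continuous_intros assms) auto
  then show ?thesis by (simp add: rpot_circle_integral[OF assms(1)])
qed

end

section \<open>The maximum principle for functions vanishing at infinity\<close>

lemma continuous_mean_attains:
  fixes g :: "real \<Rightarrow> real"
  assumes c: "continuous_on {0..1} g" and le: "\<And>x. x \<in> {0..1} \<Longrightarrow> g x \<le> S"
    and m: "S \<le> integral {0..1} g" and x: "x \<in> {0..1}"
  shows "g x = S"
proof -
  have "((\<lambda>x. S - g x) has_integral (S - integral {0..1} g)) {0..1}"
    using has_integral_const_real[of S 0 1]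
    by (intro has_integral_diff) (auto intro!: integrable_integral integrable_continuous_interval c)
  moreover from this have "S - integral {0..1} g \<ge> 0"
    by (rule has_integral_nonneg) (use le in auto)
  ultimately have "((\<lambda>x. S - g x) has_integral 0) (cbox 0 1)" using m by (simp add: cbox_interval)
  from has_integral_0_cbox_imp_0[OF _ _ this, of x]
  have "S - g x = 0" using continuous_on_diff[OF continuous_on_const c, of S] le x by (auto simp: cbox_interval)
  then show ?thesis by simp
qed

text \<open>The set where the supremum is attained is closed; at its point nearest to \<open>K\<close> the submean
  inequality would force the supremum to be attained still nearer. If the supremum is not attained,
  then it is the limit \<open>0\<close> at infinity, and the large circle attains it.\<close>

lemma maximum_principle_at_infinity:
  fixes u :: "complex \<Rightarrow> real"
  assumes cont: "continuous_on UNIV u"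
    and K: "K \<noteq> {}"
    and submean: "\<And>z. z \<notin> K \<Longrightarrow> \<exists>s0>0. \<forall>s. 0 < s \<and> s < s0 \<longrightarrow>
       u z \<le> integral {0..1} (\<lambda>\<theta>. u (z + of_real s * cis (2 * pi * \<theta>)))"
    and inf: "(u \<longlongrightarrow> 0) at_infinity"
    and circle: "0 \<le> integral {0..1} (\<lambda>\<theta>. u (of_real T * cis (2 * pi * \<theta>)))"
    and le: "\<And>z. z \<in> K \<Longrightarrow> u z \<le> A"
  shows "u z \<le> A"
proof (rule ccontr)
  assume "\<not> u z \<le> A"
  then have z: "u z > A" by simp
  have contc: "continuous_on {0..1} (\<lambda>\<theta>. u (a + of_real s * cis (2 * pi * \<theta>)))" for a s
    by (rule continuous_on_compose2[OF cont]) (auto intro!: continuous_intros)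
  have no_attain: False if S: "\<And>y. u y \<le> S" and z0: "u z0 = S" and SA: "S > A" for S z0
  proof -
    obtain k where k: "k \<in> K" using K by auto
    have "closed {y. u y = S}"
      using continuous_closed_preimage_constant[OF cont, of S] by simp
    moreover have "{y. u y = S} \<noteq> {}" using z0 by auto
    ultimately obtain y where y: "u y = S" "\<And>x. u x = S \<Longrightarrow> dist k y \<le> dist k x"
      using distance_attains_inf[of "{y. u y = S}" k] by auto
    have yk: "y \<noteq> k" using y k le SA by fastforce
    have "y \<notin> K" using y le SA by fastforce
    then obtain s0 where s0: "s0 > 0" "\<And>s. 0 < s \<Longrightarrow> s < s0 \<Longrightarrow>
       u y \<le> integral {0..1} (\<lambda>\<theta>. u (y + of_real s * cis (2 * pi * \<theta>)))"
      using submean by metis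
    \<comment> \<open>The radius is admissible for the submean inequality and smaller than the
      distance to \<open>k\<close>. The angle \<theta> points from \<open>y\<close> to
      \<open>k\<close>, so the circle contains a point strictly nearer to \<open>k\<close>, where
      the supremum is attained as well.\<close>
    define s where "s = min (s0 / 2) (dist y k / 2)"
    have s: "0 < s" "s < s0" "s < dist y k" using s0(1) yk by (auto simp: s_def min_less_iff_disj)
    define \<theta> where "\<theta> = Arg2pi (k - y) / (2 * pi)"
    have \<theta>: "\<theta> \<in> {0..1}" using Arg2pi[of "k - y"] by (auto simp: \<theta>_def divide_simps)
    have "u (y + of_real s * cis (2 * pi * \<theta>)) = S"
      by (rule continuous_mean_attains[OF contc _ _ \<theta>]) (use S s0(2)[OF s(1,2)] y(1) in auto)
    from y(2)[OF this] have "dist k y \<le> dist k (y + of_real s * cis (2 * pi * \<theta>))" .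
    also have "k - y = of_real (dist y k) * cis (2 * pi * \<theta>)"
      using Arg2pi_eq[of "k - y"] by (simp add: \<theta>_def cis_conv_exp dist_norm norm_minus_commute)
    then have "k - (y + of_real s * cis (2 * pi * \<theta>)) = of_real (dist y k - s) * cis (2 * pi * \<theta>)"
      by (simp add: algebra_simps)
    then have "dist k (y + of_real s * cis (2 * pi * \<theta>)) = dist y k - s"
      using s by (simp add: dist_norm norm_mult del: of_real_diff)
    finally show False using s by (simp add: dist_commute)
  qed
  show False
  proof (cases "\<exists>y. u y > max A 0")
    case True
    then obtain y where y: "u y > max A 0" by blast
    have "\<forall>\<^sub>F x in at_infinity. u x < u y"
      using order_tendstoD(2)[OF inf, of "u y"] y by simp
    then obtain b where b: "\<And>x. norm x \<ge> b \<Longrightarrow> u x < u y"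
      by (auto simp: eventually_at_infinity)
    have "y \<in> cball 0 b" using b[of y] by (cases "b \<le> norm y") auto
    then obtain x where x: "x \<in> cball 0 b" "\<And>v. v \<in> cball 0 b \<Longrightarrow> u v \<le> u x"
      using continuous_attains_sup[of "cball 0 b" u] continuous_on_subset[OF cont] by (metis compact_cball empty_iff subset_UNIV)
    have "u v \<le> u x" for v
      using x(2)[of v] x(2)[OF \<open>y \<in> _\<close>] b[of v] by (cases "v \<in> cball 0 b") auto
    moreover have "u x > A" using x(2)[OF \<open>y \<in> _\<close>] y by simp
    ultimately show False using no_attain by blast
  next
    case False
    then have le': "u y \<le> max A 0" for y using leI by blast
    then have A0: "A < 0" using z by (metis max.absorb1 not_le order_less_le_trans less_irrefl max_def)
    then have "u y \<le> 0" for y using le'[of y] by simp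
    then have "u (0 + of_real T * cis (2 * pi * 0)) = 0"
      by (intro continuous_mean_attains[OF contc]) (use circle in auto)
    then show False using no_attain[of 0] \<open>\<And>y. u y \<le> 0\<close> A0 by blast
  qed
qed

section \<open>Domination of potentials\<close>

context compact_carried begin

lemma compact_carried_density:
  fixes g :: "complex \<Rightarrow> real"
  assumes g [measurable]: "g \<in> borel_measurable borel" and g01: "\<And>x. 0 \<le> g x" "\<And>x. g x \<le> 1"
    and K: "compact K" "\<And>x. x \<in> C \<Longrightarrow> x \<notin> K \<Longrightarrow> g x = 0"
  shows "compact_carried (density M g) K"
proof (intro compact_carried.intro compact_carried_axioms.intro finite_measureI)
  have "emeasure (density M g) UNIV = (\<integral>\<^sup>+x. ennreal (g x) * indicator UNIV x \<partial>M)"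
    by (rule emeasure_density) (auto simp: sets_eq)
  also have "\<dots> \<le> (\<integral>\<^sup>+x. 1 \<partial>M)"
    by (rule nn_integral_mono) (auto simp: g01 ennreal_le_1)
  also have "\<dots> < \<infinity>" by (simp add: emeasure_eq_measure)
  finally show "emeasure (density M g) (space (density M g)) \<noteq> \<infinity>" by (simp add: space_eq)
  show "sets (density M g) = sets borel" by (simp add: sets_eq)
  show "compact K" by fact
  have Kb: "UNIV - K \<in> sets M" using borel_compact[OF K(1)] by (auto simp: sets_eq)
  have "emeasure (density M g) (UNIV - K) = (\<integral>\<^sup>+x. ennreal (g x) * indicator (UNIV - K) x \<partial>M)"
    by (rule emeasure_density) (use Kb in auto)
  also have "\<dots> = (\<integral>\<^sup>+x. 0 \<partial>M)"
    by (rule nn_integral_cong_AE) (use AE_C in \<open>eventually_elim, use K(2) in \<open>auto simp: indicator_def\<close>\<close>)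
  finally show "emeasure (density M g) (UNIV - K) = 0" by simp
qed

lemma integral_density_real:
  fixes g f :: "complex \<Rightarrow> real"
  assumes g [measurable]: "g \<in> borel_measurable borel" and g0: "\<And>x. 0 \<le> g x"
    and f [measurable]: "f \<in> borel_measurable borel"
  shows "integral\<^sup>L (density M g) f = (\<integral>x. g x * f x \<partial>M)"
  by (subst integral_density) (auto simp: g0)

lemma integrable_mult_bounded:
  fixes g f :: "complex \<Rightarrow> real"
  assumes g [measurable]: "g \<in> borel_measurable borel" and g01: "\<And>x. 0 \<le> g x" "\<And>x. g x \<le> 1"
    and f: "integrable M f"
  shows "integrable M (\<lambda>x. g x * f x)"
proof (rule Bochner_Integration.integrable_bound[OF f])
  show "(\<lambda>x. g x * f x) \<in> borel_measurable M" using f by measurable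
  have "\<bar>g x * f x\<bar> \<le> \<bar>f x\<bar>" for x
    using mult_right_mono[OF g01(2)[of x], of "\<bar>f x\<bar>"] g01(1)[of x] by (simp add: abs_mult)
  then show "AE x in M. norm (g x * f x) \<le> norm (f x)" by simp
qed

text \<open>The exceptional sets are open, so no appeal to inner regularity is needed to make \<open>K\<close> compact.\<close>

lemma rpot_uniformly_Cauchy_on_large_compact:
  assumes B: "\<And>z r. z \<in> C \<Longrightarrow> 0 < r \<Longrightarrow> -B \<le> rpot r M z" and e: "0 < e"
  obtains K where "compact K" "K \<subseteq> C" "mass - e \<le> measure M K"
    "\<And>\<eta>. 0 < \<eta> \<Longrightarrow> \<exists>n. \<forall>k\<ge>n. \<forall>z\<in>K. rpot (1 / Suc n) M z - rpot (1 / Suc k) M z \<le> \<eta>"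
proof -
  define Q where "Q n = rpot (1 / Suc n) M" for n
  \<comment> \<open>Egorov's argument: \<open>O' j n\<close> holds the points where the truncations
    still drop by more than 1/(j+1) after index \<open>n\<close>. Boundedness from below makes these
    sets decrease to the empty set on \<open>C\<close>.\<close>
  define O' where "O' j n = {z. \<exists>k\<ge>n. 1 / Suc j < Q n z - Q k z}" for j n :: nat
  have Qc: "continuous_on UNIV (Q n)" for n unfolding Q_def by (rule rpot_cont) simp
  have Qmono: "Q k z \<le> Q n z" if "n \<le> k" for k n z
    unfolding Q_def by (rule rpot_mono) (use that in \<open>auto simp: field_simps\<close>)
  have O_open: "open (O' j n)" for j n
  proof -
    have "O' j n = (\<Union>k\<in>{n..}. {z. 1 / Suc j < Q n z - Q k z})" by (auto simp: O'_def)
    also have "open \<dots>"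
      by (intro open_UN ballI open_Collect_less continuous_intros Qc)
    finally show ?thesis .
  qed
  have O_dec: "decseq (\<lambda>n. C \<inter> O' j n)" for j
  proof (rule decseq_SucI, rule Int_mono)
    fix n show "O' j (Suc n) \<subseteq> O' j n"
    proof
      fix z assume "z \<in> O' j (Suc n)"
      then obtain k where k: "k \<ge> Suc n" "1 / Suc j < Q (Suc n) z - Q k z" by (auto simp: O'_def)
      then have "1 / Suc j < Q n z - Q k z" using Qmono[of n "Suc n" z] by simp
      then show "z \<in> O' j n" using k unfolding O'_def by (intro CollectI exI[of _ k]) auto
    qed
  qed simp
  have O_empty: "(\<Inter>n. C \<inter> O' j n) = {}" for j
  proof (rule ccontr)
    assume "(\<Inter>n. C \<inter> O' j n) \<noteq> {}"
    then obtain z where z: "z \<in> C" "\<And>n. z \<in> O' j n" by auto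
    have "decseq (\<lambda>n. Q n z)" using Qmono by (auto simp: decseq_def)
    moreover have "-B \<le> Q n z" for n unfolding Q_def by (rule B) (use z in auto)
    ultimately have "convergent (\<lambda>n. Q n z)"
      using decseq_convergent[of "\<lambda>n. Q n z" "-B"] by (metis convergentI)
    then have "Cauchy (\<lambda>n. Q n z)" by (rule convergent_Cauchy)
    then obtain N where N: "\<And>m n. m \<ge> N \<Longrightarrow> n \<ge> N \<Longrightarrow> dist (Q m z) (Q n z) < 1 / Suc j"
      by (meson CauchyD divide_pos_pos metric_CauchyD of_nat_0_less_iff zero_less_Suc zero_less_one)
    from z(2)[of N] obtain k where "k \<ge> N" "1 / Suc j < Q N z - Q k z" by (auto simp: O'_def)
    with N[of N k] show False by (auto simp: dist_real_def)
  qed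
  have "\<exists>n. measure M (C \<inter> O' j n) < e * (1/2) ^ Suc j" for j
  proof -
    have "(\<lambda>n. measure M (C \<inter> O' j n)) \<longlonglongrightarrow> measure M (\<Inter>n. C \<inter> O' j n)"
      by (rule finite_Lim_measure_decseq[OF _ O_dec]) (use C_borel O_open in \<open>auto simp: sets_eq\<close>)
    then have "(\<lambda>n. measure M (C \<inter> O' j n)) \<longlonglongrightarrow> 0" unfolding O_empty by simp
    from order_tendstoD(2)[OF this, of "e * (1/2) ^ Suc j"] e
    show ?thesis by (auto simp: eventually_sequentially)
  qed
  then obtain N where N: "\<And>j. measure M (C \<inter> O' j (N j)) < e * (1/2) ^ Suc j" by metis
  define K where "K = C - (\<Union>j. O' j (N j))"
  have opU: "open (\<Union>j. O' j (N j))" using O_open by auto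
  have sm: "(\<lambda>j. e * (1/2::real) ^ Suc j) sums e"
    using sums_mult[OF power_half_series, of e] by simp
  have ms: "range (\<lambda>j. C \<inter> O' j (N j)) \<subseteq> sets M" using C_borel O_open by (auto simp: sets_eq)
  have su: "summable (\<lambda>j. measure M (C \<inter> O' j (N j)))"
    by (rule summable_comparison_test[OF _ sums_summable[OF sm]])
       (use N in \<open>auto intro!: exI[of _ 0] less_imp_le\<close>)
  have "measure M (\<Union>j. C \<inter> O' j (N j)) \<le> (\<Sum>j. measure M (C \<inter> O' j (N j)))"
    by (rule finite_measure_subadditive_countably[OF ms su])
  also have "\<dots> \<le> (\<Sum>j. e * (1/2::real) ^ Suc j)"
    by (rule suminf_le[OF _ su sums_summable[OF sm]]) (use N in \<open>auto intro: less_imp_le\<close>)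
  also have "\<dots> = e" using sm by (rule sums_unique[symmetric])
  finally have Ue: "measure M (\<Union>j. C \<inter> O' j (N j)) \<le> e" .
  show ?thesis
  proof
    show "compact K" unfolding K_def using compact_C opU by (rule compact_diff)
    show "K \<subseteq> C" by (auto simp: K_def)
    have "mass = measure M C"
      by (rule finite_measure_eq_AE) (use AE_C in \<open>auto simp: sets_eq C_borel[unfolded sets_eq]\<close>)
    also have "\<dots> = measure M (C - (\<Union>j. C \<inter> O' j (N j))) + measure M (\<Union>j. C \<inter> O' j (N j))"
      using finite_measure_Diff[OF C_borel sets.countable_UN[OF ms]] by auto
    also have "C - (\<Union>j. C \<inter> O' j (N j)) = K" by (auto simp: K_def)
    finally show "mass - e \<le> measure M K" using Ue by simp
    fix \<eta> :: real assume "0 < \<eta>"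
    then obtain j :: nat where j: "1 / Suc j < \<eta>" using nat_approx_posE by metis
    have "Q (N j) z - Q k z \<le> \<eta>" if "k \<ge> N j" "z \<in> K" for k z
      using that j by (force simp: K_def O'_def not_less)
    then show "\<exists>n. \<forall>k\<ge>n. \<forall>z\<in>K. rpot (1 / Suc n) M z - rpot (1 / Suc k) M z \<le> \<eta>"
      unfolding Q_def by blast
  qed
qed

end

text \<open>The drop \<open>ln (max \<rho>' d) - ln (max \<rho> d)\<close> does not change when all
  three quantities are doubled, and it does not increase with the distance. It serves to carry
  estimates from a nearest point of \<open>K\<close> to an arbitrary point, since distances to
  \<open>K\<close> at most double.\<close>

lemma trunc_log_diff_le:
  fixes d d' :: real
  assumes "0 < \<rho>" "\<rho> \<le> \<rho>'" "0 \<le> d'" "d' \<le> 2 * d"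
  shows "ln (max \<rho>' d) - ln (max \<rho> d) \<le> ln (max (2 * \<rho>') d') - ln (max (2 * \<rho>) d')"
proof -
  have "max \<rho>' d * max (2 * \<rho>) d' \<le> max (2 * \<rho>') d' * max \<rho> d"
  proof -
    consider "d \<le> \<rho>" | "\<rho> < d" "d \<le> \<rho>'" | "\<rho>' < d" by linarith
    then show ?thesis
    proof cases
      case 1
      then have "max (2 * \<rho>') d' = 2 * \<rho>'" "max (2 * \<rho>) d' = 2 * \<rho>" "max \<rho> d = \<rho>" "max \<rho>' d = \<rho>'"
        using assms by auto
      then show ?thesis by simp
    next
      case 2
      then have e: "max (2 * \<rho>') d' = 2 * \<rho>'" "max \<rho> d = d" "max \<rho>' d = \<rho>'"
        using assms by auto
      have "max (2 * \<rho>) d' \<le> 2 * d" using 2 assms by auto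
      then have "\<rho>' * max (2 * \<rho>) d' \<le> \<rho>' * (2 * d)" using assms by (intro mult_left_mono) auto
      then show ?thesis unfolding e by simp
    next
      case 3
      then have e: "max \<rho> d = d" "max \<rho>' d = d" using assms by auto
      have "max (2 * \<rho>) d' \<le> max (2 * \<rho>') d'" using assms by auto
      then show ?thesis unfolding e using 3 assms by (simp add: mult.commute mult_left_mono)
    qed
  qed
  then have "ln (max \<rho>' d * max (2 * \<rho>) d') \<le> ln (max (2 * \<rho>') d' * max \<rho> d)"
    using assms by (subst ln_le_cancel_iff) auto
  moreover have "max \<rho>' d > 0" "max \<rho> d > 0" "max (2 * \<rho>') d' > 0" "max (2 * \<rho>) d' > 0" using assms by auto
  ultimately show ?thesis by (simp add: ln_mult)
qed

lemma trunc_log_double: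
  fixes d d' :: real
  assumes "0 < \<rho>" "d' \<le> 2 * d"
  shows "ln (max \<rho> d') - ln 2 \<le> ln (max \<rho> d)"
proof -
  have "ln (max \<rho> d') \<le> ln (2 * max \<rho> d)" using assms by (subst ln_le_cancel_iff) auto
  moreover have "max \<rho> d > 0" using assms by simp
  ultimately show ?thesis by (simp add: ln_mult)
qed

lemma nearest_point:
  fixes K :: "complex set"
  assumes "compact K" "K \<noteq> {}"
  obtains y where "y \<in> K" "\<And>t. t \<in> K \<Longrightarrow> cmod (y - t) \<le> 2 * cmod (z - t)"
proof -
  obtain y where y: "y \<in> K" "\<And>t. t \<in> K \<Longrightarrow> dist z y \<le> dist z t"
    using distance_attains_inf[of K z] assms compact_imp_closed by metis
  have "cmod (y - t) \<le> 2 * cmod (z - t)" if "t \<in> K" for t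
    using y(2)[OF that] dist_triangle2[of y t z] dist_triangle[of y t z] by (simp add: dist_norm norm_minus_commute)
  then show ?thesis using that y by blast
qed

text \<open>The restriction of \<open>\<mu>\<close> to \<open>K\<close> has a continuous potential (Evans-Vasilesco), expressed through
  the uniform Cauchy property of its truncations.\<close>

lemma domination:
  assumes mu: "compact_carried \<mu> S" "measure \<mu> UNIV = 1"
    and nu: "compact_carried \<nu> D" "measure \<nu> UNIV = 1"
    and B: "\<And>z r. z \<in> S \<Longrightarrow> 0 < r \<Longrightarrow> -B \<le> rpot r \<mu> z"
    and dom: "\<And>z \<rho> \<epsilon>. z \<in> S \<Longrightarrow> 0 < \<rho> \<Longrightarrow> 0 < \<epsilon> \<Longrightarrow> \<exists>r>0. rpot r \<nu> z \<le> A + \<epsilon> + rpot \<rho> \<mu> z"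
    and eps: "0 < \<epsilon>"
  obtains K r \<rho>1 where "compact K" "K \<subseteq> S" "1 - \<epsilon> \<le> measure \<mu> K" "0 < measure \<mu> K" "0 < r" "0 < \<rho>1"
    "\<forall>\<rho> z. 0 < \<rho> \<longrightarrow> \<rho> < \<rho>1 \<longrightarrow>
        rpot r \<nu> z \<le> rpot \<rho> (density \<mu> (indicat_real K)) z / measure \<mu> K + A + \<epsilon>"
proof -
  interpret mu: compact_carried \<mu> S by fact
  interpret nu: compact_carried \<nu> D by fact
  obtain R where R: "0 < R" "S \<subseteq> ball 0 R" by (rule mu.C_ball)
  define D0 where "D0 = 2 * R + 1"
  have D0: "1 \<le> D0" "0 \<le> ln D0" using R by (auto simp: D0_def)
  have D0S: "cmod (z - t) \<le> D0" if "z \<in> S" "t \<in> S" for z t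
  proof -
    have "cmod z < R" "cmod t < R" using that R by auto
    then show ?thesis using norm_triangle_ineq4[of z t] by (simp add: D0_def)
  qed
  \<comment> \<open>-c will bound the truncated potentials of the restricted measure from below in
    the whole plane: \<open>B\<close> on the support, \<open>ln D0\<close> for the removed mass,
    \<open>ln 2\<close> for passing to a nearest point of \<open>K\<close>.\<close>
  define c where "c = B + ln D0 + ln 2"
  \<comment> \<open>In this order the bounds give \<kappa> \<ge> 1/2, mass at least 1 - \<epsilon>,
    a contribution of at most \<epsilon>/4 from the removed mass, and a loss of at most \<epsilon>/4
    from dividing by \<kappa>.\<close>
  define e where "e = Min {1/2, \<epsilon>, \<epsilon> / (4 * (ln D0 + 1)), \<epsilon> / (8 * (\<bar>c\<bar> + 1))}"
  have e0: "0 < e" using eps D0 by (simp add: e_def add_nonneg_pos)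
  have "e \<le> 1/2" "e \<le> \<epsilon>" "e \<le> \<epsilon> / (4 * (ln D0 + 1))" "e \<le> \<epsilon> / (8 * (\<bar>c\<bar> + 1))"
    unfolding e_def by (rule Min_le, simp, simp)+
  note e = e0 this
  have eD: "e * ln D0 \<le> \<epsilon> / 4"
  proof -
    have "e * (ln D0 + 1) \<le> \<epsilon> / 4" using e(4) D0 by (simp add: field_simps)
    then show ?thesis using e by (simp add: algebra_simps)
  qed
  have ec: "2 * \<bar>c\<bar> * e \<le> \<epsilon> / 4"
  proof -
    have "e * (8 * (\<bar>c\<bar> + 1)) \<le> \<epsilon>" using e(5) by (simp add: pos_le_divide_eq)
    then show ?thesis using e by (simp add: algebra_simps)
  qed
  obtain K where K: "compact K" "K \<subseteq> S" "1 - e \<le> measure \<mu> K"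
    and Kun: "\<And>\<eta>. 0 < \<eta> \<Longrightarrow> \<exists>n. \<forall>k\<ge>n. \<forall>z\<in>K. rpot (1 / Suc n) \<mu> z - rpot (1 / Suc k) \<mu> z \<le> \<eta>"
    using mu.rpot_uniformly_Cauchy_on_large_compact[OF B e(1)] mu(2) by metis
  define \<kappa> where "\<kappa> = measure \<mu> K"
  have \<kappa>: "1/2 \<le> \<kappa>" "\<kappa> \<le> 1" "1 - e \<le> \<kappa>"
    using K e mu.bounded_measure[of K] mu(2) by (auto simp: \<kappa>_def mu.space_eq)
  have Kne: "K \<noteq> {}" using \<kappa> by (auto simp: \<kappa>_def)
  have Kb [measurable]: "K \<in> sets borel" using K by (simp add: borel_compact)
  have ki: "integrable \<mu> (indicat_real K)"
    by (intro integrable_real_indicator) (auto simp: mu.sets_eq mu.emeasure_eq_measure)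
  define \<mu>K where "\<mu>K = density \<mu> (indicat_real K)"
  interpret mk: compact_carried \<mu>K K
    unfolding \<mu>K_def by (rule mu.compact_carried_density) (use K in \<open>auto simp: indicator_def\<close>)
  have mk_int: "integral\<^sup>L \<mu>K f = (\<integral>x. indicat_real K x * f x \<partial>\<mu>)" if "f \<in> borel_measurable borel" for f :: "complex \<Rightarrow> real"
    unfolding \<mu>K_def by (rule mu.integral_density_real) (use that in auto)
  have ker_m: "(\<lambda>t. ln (max r (cmod (z - t)))) \<in> borel_measurable borel" for r z by measurable
  have ker_i: "integrable \<mu> (\<lambda>t. indicat_real K t * ln (max r (cmod (z - t))))" if "0 < r" for r z
    by (rule mu.integrable_mult_bounded[OF _ _ _ mu.kernel_integrable[OF that]]) auto
  have mk_mass: "measure \<mu>K UNIV = \<kappa>"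
    using mk_int[of "\<lambda>_. 1"] by (simp add: mk.space_eq mu.space_eq \<kappa>_def)
  have mk_rpot: "rpot r \<mu>K z = (\<integral>t. indicat_real K t * ln (max r (cmod (z - t))) \<partial>\<mu>)" for r z
    unfolding rpot_def by (rule mk_int[OF ker_m])
  \<comment> \<open>The Cauchy property passes from \<open>K\<close> to all points through the
    nearest point of \<open>K\<close>, with doubled truncation radii. Enlarging the restricted
    measure to \<mu> only increases the right-hand drop, because the kernel grows with the
    radius.\<close>
  have unif: "\<exists>\<rho>'>0. \<rho>' \<le> 1 \<and> (\<forall>\<rho> z. 0 < \<rho> \<longrightarrow> \<rho> \<le> \<rho>' \<longrightarrow> rpot \<rho>' \<mu>K z - rpot \<rho> \<mu>K z \<le> \<eta>)" if "0 < \<eta>" for \<eta>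
  proof -
    from Kun[OF that] obtain n where n: "\<And>k z. k \<ge> n \<Longrightarrow> z \<in> K \<Longrightarrow> rpot (1 / Suc n) \<mu> z - rpot (1 / Suc k) \<mu> z \<le> \<eta>" by blast
    define \<rho>' where "\<rho>' = 1 / (2 * real (Suc n))"
    have \<rho>': "0 < \<rho>'" "\<rho>' \<le> 1" "2 * \<rho>' = 1 / Suc n" by (auto simp: \<rho>'_def field_simps)
    have "rpot \<rho>' \<mu>K z - rpot \<rho> \<mu>K z \<le> \<eta>" if \<rho>: "0 < \<rho>" "\<rho> \<le> \<rho>'" for \<rho> z
    proof -
      obtain y where y: "y \<in> K" "\<And>t. t \<in> K \<Longrightarrow> cmod (y - t) \<le> 2 * cmod (z - t)"
        using nearest_point[OF K(1) Kne] by metis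
      obtain k0 :: nat where k0: "1 / Suc k0 < 2 * \<rho>" using nat_approx_posE[of "2 * \<rho>"] \<rho> by auto
      define k where "k = max n k0"
      have k: "k \<ge> n" "1 / Suc k \<le> 2 * \<rho>"
      proof -
        have "1 / real (Suc k) \<le> 1 / Suc k0" by (auto simp: k_def field_simps)
        then show "1 / Suc k \<le> 2 * \<rho>" using k0 by simp
      qed (simp add: k_def)
      have "rpot \<rho>' \<mu>K z - rpot \<rho> \<mu>K z
          = (\<integral>t. indicat_real K t * ln (max \<rho>' (cmod (z - t))) - indicat_real K t * ln (max \<rho> (cmod (z - t))) \<partial>\<mu>)"
        unfolding mk_rpot using \<rho> by (subst Bochner_Integration.integral_diff) (auto intro!: ker_i)
      also have "\<dots> \<le> (\<integral>t. ln (max (2 * \<rho>') (cmod (y - t))) - ln (max (2 * \<rho>) (cmod (y - t))) \<partial>\<mu>)"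
      proof (rule integral_mono)
        show "integrable \<mu> (\<lambda>t. indicat_real K t * ln (max \<rho>' (cmod (z - t))) - indicat_real K t * ln (max \<rho> (cmod (z - t))))"
          using \<rho> by (intro Bochner_Integration.integrable_diff ker_i) auto
        show "integrable \<mu> (\<lambda>t. ln (max (2 * \<rho>') (cmod (y - t))) - ln (max (2 * \<rho>) (cmod (y - t))))"
          using \<rho> by (intro Bochner_Integration.integrable_diff mu.kernel_integrable) auto
        fix t
        show "indicat_real K t * ln (max \<rho>' (cmod (z - t))) - indicat_real K t * ln (max \<rho> (cmod (z - t)))
          \<le> ln (max (2 * \<rho>') (cmod (y - t))) - ln (max (2 * \<rho>) (cmod (y - t)))"
        proof (cases "t \<in> K")
          case True
          then show ?thesis using trunc_log_diff_le[OF \<rho> _ y(2)[OF True]] by simp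
        next
          case False
          then show ?thesis using ln_max_mono[of "2 * \<rho>" "2 * \<rho>'" "cmod (y - t)"] \<rho> by simp
        qed
      qed
      also have "\<dots> = rpot (2 * \<rho>') \<mu> y - rpot (2 * \<rho>) \<mu> y"
        unfolding rpot_def using \<rho> by (intro Bochner_Integration.integral_diff mu.kernel_integrable) auto
      also have "\<dots> \<le> rpot (1 / Suc n) \<mu> y - rpot (1 / Suc k) \<mu> y"
        using mu.rpot_mono[of "1 / Suc k" "2 * \<rho>" y] k by (simp add: \<rho>'(3))
      also have "\<dots> \<le> \<eta>" by (rule n[OF k(1) y(1)])
      finally show ?thesis .
    qed
    then show ?thesis using \<rho>' by blast
  qed
  \<comment> \<open>The mass outside \<open>K\<close> is at most \<open>e\<close>, and the kernel is
    at most \<open>ln D0\<close> between points of the support.\<close>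
  have rest: "rpot \<rho> \<mu> z \<le> rpot \<rho> \<mu>K z + e * ln D0" if z: "z \<in> S" and \<rho>: "0 < \<rho>" "\<rho> \<le> 1" for z \<rho>
  proof -
    have "rpot \<rho> \<mu> z - rpot \<rho> \<mu>K z = (\<integral>t. ln (max \<rho> (cmod (z - t))) - indicat_real K t * ln (max \<rho> (cmod (z - t))) \<partial>\<mu>)"
      unfolding mk_rpot rpot_def[of \<rho> \<mu>]
      using \<rho> by (subst Bochner_Integration.integral_diff) (auto intro!: ker_i mu.kernel_integrable)
    also have "\<dots> \<le> (\<integral>t. ln D0 - indicat_real K t * ln D0 \<partial>\<mu>)"
    proof (rule integral_mono_AE)
      show "integrable \<mu> (\<lambda>t. ln (max \<rho> (cmod (z - t))) - indicat_real K t * ln (max \<rho> (cmod (z - t))))"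
        using \<rho> by (intro Bochner_Integration.integrable_diff ker_i mu.kernel_integrable) auto
      show "integrable \<mu> (\<lambda>t. ln D0 - indicat_real K t * ln D0)"
        by (intro Bochner_Integration.integrable_diff mu.integrable_mult_bounded) auto
      show "AE t in \<mu>. ln (max \<rho> (cmod (z - t))) - indicat_real K t * ln (max \<rho> (cmod (z - t))) \<le> ln D0 - indicat_real K t * ln D0"
        using mu.AE_C
      proof eventually_elim
        case (elim t)
        have "ln (max \<rho> (cmod (z - t))) \<le> ln D0"
          using \<rho> D0S[OF z elim] D0 by (subst ln_le_cancel_iff) auto
        then show ?case by (auto simp: indicator_def)
      qed
    qed
    also have "\<dots> = (1 - \<kappa>) * ln D0"
      by (subst Bochner_Integration.integral_diff)
         (use ki in \<open>auto intro!: mu.integrable_mult_bounded simp: mu.space_eq mu(2) \<kappa>_def algebra_simps\<close>)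
    also have "\<dots> \<le> e * ln D0" using \<kappa> D0 by (intro mult_right_mono) auto
    finally show ?thesis by simp
  qed
  have lower: "-c \<le> rpot \<rho> \<mu>K z" if \<rho>: "0 < \<rho>" "\<rho> \<le> 1" for \<rho> z
  proof -
    obtain y where y: "y \<in> K" "\<And>t. t \<in> K \<Longrightarrow> cmod (y - t) \<le> 2 * cmod (z - t)"
      using nearest_point[OF K(1) Kne] by metis
    have yS: "y \<in> S" using y K by auto
    have "- B - ln D0 \<le> rpot \<rho> \<mu> y - e * ln D0"
      using B[OF yS \<rho>(1)] mult_right_mono[of e 1 "ln D0"] e D0 by simp
    also have "\<dots> \<le> rpot \<rho> \<mu>K y" using rest[OF yS \<rho>] by simp
    also have "\<dots> - ln 2 \<le> rpot \<rho> \<mu>K y - \<kappa> * ln 2" using \<kappa> by simp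
    also have "\<dots> = (\<integral>t. ln (max \<rho> (cmod (y - t))) - ln 2 \<partial>\<mu>K)"
      unfolding rpot_def using \<rho>
      by (subst Bochner_Integration.integral_diff) (auto intro!: mk.kernel_integrable simp: mk.space_eq mk_mass)
    also have "\<dots> \<le> rpot \<rho> \<mu>K z"
      unfolding rpot_def
      by (intro mk.integral_mono_C continuous_on_diff continuous_on_trunc_log continuous_intros trunc_log_double)
         (use \<rho> y in auto)
    finally show ?thesis by (simp add: c_def)
  qed
  \<comment> \<open>Three errors \<eta> occur: one from \<open>dom\<close>, one that makes the
    inequality defining \<open>U\<close> strict, one from changing the truncation radius. They add
    up to \<epsilon>/4; with the two quarters prepared in \<open>e\<close> the total stays below
    \<epsilon>.\<close>
  define \<eta> where "\<eta> = \<epsilon> / 12"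
  have \<eta>: "0 < \<eta>" using eps by (simp add: \<eta>_def)
  from unif[OF \<eta>] obtain \<rho>' where \<rho>': "0 < \<rho>'" "\<rho>' \<le> 1" "\<And>\<rho> z. 0 < \<rho> \<Longrightarrow> \<rho> \<le> \<rho>' \<Longrightarrow> rpot \<rho>' \<mu>K z - rpot \<rho> \<mu>K z \<le> \<eta>" by blast
  define A' where "A' = A + 2 * \<eta> + e * ln D0"
  \<comment> \<open>The radius in \<open>dom\<close> depends on the point. These open sets increase
    with \<open>n\<close> and cover \<open>K\<close>, so compactness supplies a single radius valid
    near all of \<open>K\<close>.\<close>
  define U where "U n = {y. rpot (1 / Suc n) \<nu> y < A' + rpot \<rho>' \<mu>K y}" for n
  have Uo: "open (U n)" for n
    unfolding U_def by (intro open_Collect_less continuous_intros nu.rpot_cont mk.rpot_cont \<rho>') auto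
  have Umono: "U n \<subseteq> U k" if "n \<le> k" for n k
  proof -
    have "rpot (1 / Suc k) \<nu> y \<le> rpot (1 / Suc n) \<nu> y" for y
      by (rule nu.rpot_mono) (use that in \<open>auto simp: field_simps\<close>)
    then show ?thesis unfolding U_def by (auto intro: order_le_less_trans)
  qed
  have "K \<subseteq> (\<Union>n. U n)"
  proof
    fix z assume z: "z \<in> K"
    then have zS: "z \<in> S" using K by auto
    obtain r where r: "0 < r" "rpot r \<nu> z \<le> A + \<eta> + rpot \<rho>' \<mu> z" using dom[OF zS \<rho>'(1) \<eta>] by blast
    obtain n :: nat where n: "1 / Suc n < r" using nat_approx_posE[OF r(1)] by metis
    have "rpot (1 / Suc n) \<nu> z \<le> rpot r \<nu> z" by (rule nu.rpot_mono) (use n in auto)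
    also have "\<dots> \<le> A + \<eta> + (rpot \<rho>' \<mu>K z + e * ln D0)" using r(2) rest[OF zS \<rho>'(1,2)] by linarith
    finally show "z \<in> (\<Union>n. U n)" using \<eta> by (auto simp: U_def A'_def intro!: exI[of _ n])
  qed
  then obtain I where I: "finite I" "K \<subseteq> (\<Union>n\<in>I. U n)"
    using compactE_image[OF K(1), of UNIV U] Uo by metis
  define N where "N = Max (insert 0 I)"
  have KU: "K \<subseteq> U N"
  proof
    fix x assume "x \<in> K"
    then obtain n where n: "n \<in> I" "x \<in> U n" using I by auto
    then have "n \<le> N" using I by (simp add: N_def)
    then show "x \<in> U N" using Umono n by blast
  qed
  \<comment> \<open>The inequality holds on this closed neighbourhood of \<open>K\<close>. Outside
    it, small circles also avoid the \<rho>-neighbourhood of \<open>K\<close>, so the potential of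
    the restriction is harmonic and the difference \<open>u\<close> satisfies the submean
    inequality.\<close>
  obtain \<rho>0 where \<rho>0: "0 < \<rho>0" "(\<Union>x\<in>K. cball x \<rho>0) \<subseteq> U N"
    using compact_subset_open_imp_cball_epsilon_subset[OF K(1) Uo KU] by metis
  define r where "r = 1 / real (Suc N)"
  have r: "0 < r" by (simp add: r_def)
  define \<rho>1 where "\<rho>1 = min \<rho>0 \<rho>'"
  have \<rho>1: "0 < \<rho>1" using \<rho>0 \<rho>' by (simp add: \<rho>1_def)
  have main: "rpot r \<nu> z \<le> rpot \<rho> \<mu>K z / \<kappa> + A + \<epsilon>" if \<rho>: "0 < \<rho>" "\<rho> < \<rho>1" for \<rho> z
  proof -
    define u where "u z = rpot r \<nu> z - rpot \<rho> \<mu>K z / \<kappa>" for z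
    have \<rho>a: "\<rho> < \<rho>0" "\<rho> \<le> \<rho>'" "\<rho> \<le> 1" using \<rho> \<rho>'(2) by (auto simp: \<rho>1_def)
    have circ_c: "continuous_on {0..1} (\<lambda>\<theta>. rpot r \<nu> (z + of_real s * cis (2 * pi * \<theta>)))"
       "continuous_on {0..1} (\<lambda>\<theta>. rpot \<rho> \<mu>K (z + of_real s * cis (2 * pi * \<theta>)))" for z s
      by (rule continuous_on_compose2[OF nu.rpot_cont[OF r]] continuous_on_compose2[OF mk.rpot_cont[OF \<rho>(1)]],
          (auto intro!: continuous_intros)[2])+
    have circ: "integral {0..1} (\<lambda>\<theta>. u (z + of_real s * cis (2 * pi * \<theta>)))
      = integral {0..1} (\<lambda>\<theta>. rpot r \<nu> (z + of_real s * cis (2 * pi * \<theta>)))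
        - integral {0..1} (\<lambda>\<theta>. rpot \<rho> \<mu>K (z + of_real s * cis (2 * pi * \<theta>))) / \<kappa>" for z s
    proof -
      have i: "(\<lambda>\<theta>. rpot r \<nu> (z + of_real s * cis (2 * pi * \<theta>))) integrable_on {0..1}"
        "(\<lambda>\<theta>. rpot \<rho> \<mu>K (z + of_real s * cis (2 * pi * \<theta>)) / \<kappa>) integrable_on {0..1}"
        using \<kappa> by (intro integrable_continuous_interval circ_c continuous_intros; simp)+
      show ?thesis unfolding u_def by (simp only: Henstock_Kurzweil_Integration.integral_diff[OF i] integral_divide)
    qed
    obtain R2 where R2: "0 < R2" "K \<subseteq> ball 0 R2" by (rule mk.C_ball)
    obtain R3 where R3: "0 < R3" "D \<subseteq> ball 0 R3" by (rule nu.C_ball)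
    define T where "T = r + \<rho> + R2 + R3 + 1"
    have "u z \<le> A + \<epsilon>"
    proof (rule maximum_principle_at_infinity[where K = "\<Union>x\<in>K. cball x \<rho>0" and T = T])
      show "continuous_on UNIV u"
        unfolding u_def using \<kappa> by (intro continuous_intros nu.rpot_cont mk.rpot_cont r \<rho>) auto
      show "(\<Union>x\<in>K. cball x \<rho>0) \<noteq> {}" using Kne \<rho>0 by auto
      show "\<exists>s0>0. \<forall>s. 0 < s \<and> s < s0 \<longrightarrow> u z \<le> integral {0..1} (\<lambda>\<theta>. u (z + of_real s * cis (2 * pi * \<theta>)))"
        if z: "z \<notin> (\<Union>x\<in>K. cball x \<rho>0)" for z
      proof (intro exI[of _ "min r (\<rho>0 - \<rho>)"] conjI allI impI)
        show "0 < min r (\<rho>0 - \<rho>)" using r \<rho>a by simp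
        fix s assume s: "0 < s \<and> s < min r (\<rho>0 - \<rho>)"
        have "rpot r \<nu> z \<le> integral {0..1} (\<lambda>\<theta>. rpot r \<nu> (z + of_real s * cis (2 * pi * \<theta>)))"
          by (rule nu.rpot_submean) (use s in auto)
        moreover have "integral {0..1} (\<lambda>\<theta>. rpot \<rho> \<mu>K (z + of_real s * cis (2 * pi * \<theta>))) = rpot \<rho> \<mu>K z"
        proof (rule mk.rpot_mean_eq)
          fix t assume "t \<in> K"
          then have "\<rho>0 < cmod (z - t)" using z by (auto simp: dist_norm norm_minus_commute not_le)
          then show "\<rho> + s \<le> cmod (z - t)" using s by simp
        qed (use s \<rho> in auto)
        ultimately show "u z \<le> integral {0..1} (\<lambda>\<theta>. u (z + of_real s * cis (2 * pi * \<theta>)))"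
          unfolding circ by (simp add: u_def)
      qed
      have "((\<lambda>z. (rpot r \<nu> z - 1 * ln (cmod z)) - (rpot \<rho> \<mu>K z - \<kappa> * ln (cmod z)) / \<kappa>) \<longlongrightarrow> 0 - 0 / \<kappa>) at_infinity"
        using nu.rpot_at_infinity[OF r] mk.rpot_at_infinity[OF \<rho>(1)] \<kappa>
        by (intro tendsto_intros) (auto simp: mk_mass nu(2))
      also have "(\<lambda>z. (rpot r \<nu> z - 1 * ln (cmod z)) - (rpot \<rho> \<mu>K z - \<kappa> * ln (cmod z)) / \<kappa>) = u"
        using \<kappa> by (auto simp: u_def fun_eq_iff field_simps)
      finally show "(u \<longlongrightarrow> 0) at_infinity" by simp
      have "integral {0..1} (\<lambda>\<theta>. u (of_real T * cis (2 * pi * \<theta>))) = ln T - \<kappa> * ln T / \<kappa>"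
        using circ[of 0 T] nu.rpot_large_circle[OF r R3(2), of T] mk.rpot_large_circle[OF \<rho>(1) R2(2), of T]
          R2 R3 r \<rho> by (simp add: T_def nu(2) mk_mass)
      also have "\<dots> = 0" using \<kappa> by simp
      finally show "0 \<le> integral {0..1} (\<lambda>\<theta>. u (of_real T * cis (2 * pi * \<theta>)))" by simp
      show "u z \<le> A + \<epsilon>" if "z \<in> (\<Union>x\<in>K. cball x \<rho>0)" for z
      proof -
        have "z \<in> U N" using that \<rho>0(2) by blast
        then have "rpot r \<nu> z < A' + rpot \<rho>' \<mu>K z" by (simp add: U_def r_def)
        also have "\<dots> \<le> A' + \<eta> + rpot \<rho> \<mu>K z" using \<rho>'(3)[OF \<rho>(1) \<rho>a(2), of z] by simp
        finally have 1: "rpot r \<nu> z \<le> A' + \<eta> + rpot \<rho> \<mu>K z" by simp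
        \<comment> \<open>Adding \<open>c\<close> makes the potential nonnegative, so dividing by
          \<kappa> \<le> 1 can only increase it; the error is then c/\<kappa> - c.\<close>
        have "(rpot \<rho> \<mu>K z + c) * \<kappa> \<le> rpot \<rho> \<mu>K z + c"
          using lower[OF \<rho>(1) \<rho>a(3), of z] \<kappa> by (simp add: mult_left_le)
        then have 2: "rpot \<rho> \<mu>K z + c \<le> (rpot \<rho> \<mu>K z + c) / \<kappa>" using \<kappa> by (simp add: pos_le_divide_eq)
        have "c / \<kappa> - c = c * ((1 - \<kappa>) / \<kappa>)" using \<kappa> by (simp add: field_simps)
        also have "\<dots> \<le> \<bar>c\<bar> * (e / (1/2))"
          using \<kappa> e by (intro mult_mono frac_le) auto
        also have "\<dots> \<le> \<epsilon> / 4" using ec by (simp add: mult_ac)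
        finally have 3: "c / \<kappa> - c \<le> \<epsilon> / 4" .
        show ?thesis using 1 2[unfolded add_divide_distrib] 3 eD eps unfolding u_def A'_def \<eta>_def by linarith
      qed
    qed
    then show ?thesis by (simp add: u_def)
  qed
  show ?thesis
    by (rule that[OF K(1,2) _ _ r \<rho>1]) (use main \<kappa> e in \<open>auto simp: \<kappa>_def \<mu>K_def\<close>)
qed

section \<open>Choosing coefficients by averaging, so that a sum is rarely much smaller than its
  largest term\<close>

lemma sqrt_unit_increment: "sqrt (y + 1) - sqrt y \<le> 2" for y :: real
proof -
  consider "y \<ge> 0" | "-1 < y" "y < 0" | "y \<le> -1" by linarith
  then show ?thesis
  proof cases
    case 1
    then show ?thesis using sqrt_add_le_add_sqrt[of y 1] by simp
  next
    case 2
    then have "y + 1 \<le> 1" "- 1 \<le> y" by auto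
    then have "sqrt (y + 1) \<le> sqrt 1" "sqrt (- 1) \<le> sqrt y" by (simp_all only: real_sqrt_le_iff)
    then have "sqrt (y + 1) \<le> 1" "- 1 \<le> sqrt y" by (simp_all only: real_sqrt_minus real_sqrt_one)
    then show ?thesis by linarith
  next
    case 3
    then have "sqrt ((- y - 1) + 1) \<le> sqrt (- y - 1) + sqrt 1" by (intro sqrt_add_le_add_sqrt) auto
    moreover have "sqrt (y + 1) = - sqrt (- y - 1)" by (metis real_sqrt_minus minus_diff_eq add.commute diff_minus_eq_add)
    moreover have "sqrt y = - sqrt (- y)" by (simp add: real_sqrt_minus)
    ultimately show ?thesis using 3 by simp
  qed
qed

text \<open>Since \<open>ln y \<ge> 2 - 2 / sqrt y\<close>, an average over \<open>\<xi>\<close> loses only a bounded amount.\<close>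

lemma log_linear_average:
  fixes a b :: complex
  assumes G: "0 < G"
  shows "ln (max G (max (cmod a) (cmod b))) - 10 \<le> integral {1..2} (\<lambda>\<xi>. ln (max G (cmod (a + of_real \<xi> * b))))"
proof -
  define h where "h \<xi> = ln (max G (cmod (a + of_real \<xi> * b)))" for \<xi> :: real
  have ci: "h integrable_on {1..2}" unfolding h_def
    by (intro integrable_continuous_interval continuous_on_trunc_log continuous_intros G)
  have low: "m \<le> integral {1..2} h" if "\<And>\<xi>. 1 \<le> \<xi> \<Longrightarrow> \<xi> \<le> 2 \<Longrightarrow> m \<le> h \<xi>" for m
  proof -
    have "integral {1..2} (\<lambda>_::real. m) \<le> integral {1..2} h"
      by (rule integral_le) (use that ci in auto)
    then show ?thesis by simp
  qed
  \<comment> \<open>The constant 10: if |a| \<ge> 4|b| the loss is only \<open>ln 2\<close>.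
    Otherwise it is \<open>ln 4\<close>, at most 3, from replacing the maximum by |b|, plus 6 = 4 *
    2 - 2 from the integral of the minorant.\<close>
  have ln2: "ln (2::real) \<le> 1" "ln (4::real) \<le> 3" using ln_le_minus_one[of 2] ln_le_minus_one[of 4] by auto
  have "ln (max G (max (cmod a) (cmod b))) - 10 \<le> integral {1..2} h"
  proof (cases "max (cmod a) (cmod b) \<le> G")
    case True
    have "ln G \<le> integral {1..2} h" by (rule low) (use G in \<open>auto simp: h_def\<close>)
    then show ?thesis using True by (simp add: max_def split: if_splits)
  next
    case nG: False
    show ?thesis
    proof (cases "4 * cmod b \<le> cmod a")
      case True
      then have a: "cmod a > 0" "max (cmod a) (cmod b) = cmod a" "G < cmod a" using nG G by (auto simp: max_def split: if_splits)
      have "ln (cmod a / 2) \<le> integral {1..2} h"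
      proof (rule low)
        fix \<xi> :: real assume \<xi>: "1 \<le> \<xi>" "\<xi> \<le> 2"
        have "cmod (of_real \<xi> * b) \<le> 2 * cmod b" using \<xi> by (simp add: norm_mult mult_right_mono)
        then have "cmod a / 2 \<le> cmod (a + of_real \<xi> * b)"
          using True norm_diff_ineq[of a "of_real \<xi> * b"] by linarith
        then show "ln (cmod a / 2) \<le> h \<xi>" unfolding h_def using a G by (subst ln_le_cancel_iff) auto
      qed
      then show ?thesis using a ln2 by (simp add: ln_div max_absorb2)
    next
      case False
      then have b: "cmod b > 0" by (smt (verit) norm_ge_zero)
      then have b0: "b \<noteq> 0" by auto
      have mx: "ln (max G (max (cmod a) (cmod b))) \<le> ln 4 + ln (cmod b)"
      proof -
        have "ln (max G (max (cmod a) (cmod b))) \<le> ln (4 * cmod b)"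
          using nG False G by (subst ln_le_cancel_iff) auto
        then show ?thesis using b by (simp add: ln_mult)
      qed
      \<comment> \<open>\<open>x0\<close> is the real part of the root -a/b of the linear function,
        so |a + \<xi> b| \<ge> |b| |\<xi> - x0| for real \<xi>.\<close>
      define x0 where "x0 = - Re (a / b)"
      \<comment> \<open>At \<open>x0\<close> the lower bound by the logarithm of the distance is
        void; the value there is chosen so that the minorant equals \<open>ln G\<close>.\<close>
      define f' where "f' \<xi> = (if \<xi> = x0 then ln G - ln (cmod b) else 2 - 2 / sqrt \<bar>\<xi> - x0\<bar>)" for \<xi>
      \<comment> \<open>Since \<open>sqrt\<close> is extended as an odd function, 2 \<xi> - 4
        sqrt(\<xi> - x0) is continuous across \<open>x0\<close> and is an antiderivative on both
        sides of it.\<close>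
      have "(f' has_integral ((2 * 2 - 4 * sqrt (2 - x0)) - (2 * 1 - 4 * sqrt (1 - x0)))) {1..2}"
      proof (rule fundamental_theorem_of_calculus_interior_strong[where S = "{x0}"])
        fix x assume x: "x \<in> {1<..<2} - {x0}"
        have "((\<lambda>\<xi>. sqrt (\<xi> - x0)) has_real_derivative (1 / (2 * sqrt \<bar>x - x0\<bar>))) (at x)"
        proof -
          have d: "(sqrt has_real_derivative (1 / (2 * sqrt \<bar>x - x0\<bar>))) (at (x - x0))"
          proof (rule DERIV_real_sqrt_generic)
            assume "x - x0 < 0"
            then have "sqrt \<bar>x - x0\<bar> = - sqrt (x - x0)" by (metis abs_of_neg real_sqrt_minus)
            then show "1 / (2 * sqrt \<bar>x - x0\<bar>) = - inverse (sqrt (x - x0)) / 2"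
              by (simp add: field_simps)
          qed (use x in \<open>auto simp: field_simps\<close>)
          have "((\<lambda>\<xi>. \<xi> - x0) has_real_derivative 1) (at x)" by (auto intro!: derivative_eq_intros)
          from DERIV_chain2[OF d this] show ?thesis by simp
        qed
        then have "((\<lambda>\<xi>. 2 * \<xi> - 4 * sqrt (\<xi> - x0)) has_real_derivative (2 * 1 - 4 * (1 / (2 * sqrt \<bar>x - x0\<bar>)))) (at x)"
          by (intro DERIV_diff DERIV_cmult DERIV_ident)
        then show "((\<lambda>\<xi>. 2 * \<xi> - 4 * sqrt (\<xi> - x0)) has_vector_derivative f' x) (at x)"
          using x by (simp add: f'_def has_real_derivative_iff_has_vector_derivative)
      qed (auto intro!: continuous_intros)
      then have F: "(f' has_integral (2 - 4 * (sqrt ((1 - x0) + 1) - sqrt (1 - x0)))) {1..2}"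
        by (simp add: algebra_simps)
      have F': "((\<lambda>\<xi>. ln (cmod b) + f' \<xi>) has_integral (ln (cmod b) + (2 - 4 * (sqrt ((1 - x0) + 1) - sqrt (1 - x0))))) {1..2}"
        using has_integral_const_real[of "ln (cmod b)" 1 2] by (intro has_integral_add F) simp
      have "ln (cmod b) + (2 - 4 * (sqrt ((1 - x0) + 1) - sqrt (1 - x0))) \<le> integral {1..2} h"
      proof (rule has_integral_le[OF F' integrable_integral[OF ci]])
        fix \<xi> :: real
        show "ln (cmod b) + f' \<xi> \<le> h \<xi>"
        proof (cases "\<xi> = x0")
          case True
          then show ?thesis using G by (simp add: f'_def h_def)
        next
          case ne: False
          define y where "y = \<bar>\<xi> - x0\<bar>"
          have y: "y > 0" using ne by (simp add: y_def)
          have "y = \<bar>Re (of_real \<xi> + a / b)\<bar>" by (simp add: y_def x0_def)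
          also have "\<dots> \<le> cmod (of_real \<xi> + a / b)" by (rule abs_Re_le_cmod)
          finally have "cmod b * y \<le> cmod b * cmod (of_real \<xi> + a / b)" by (intro mult_left_mono) auto
          also have "\<dots> = cmod (a + of_real \<xi> * b)" using b0 by (simp add: norm_mult[symmetric] algebra_simps)
          finally have "ln (cmod b * y) \<le> h \<xi>" unfolding h_def using b y G by (subst ln_le_cancel_iff) auto
          moreover have "2 - 2 / sqrt y \<le> ln y"
          proof -
            define q where "q = sqrt y"
            have q: "q > 0" "y = q\<^sup>2" using y by (auto simp: q_def)
            then show ?thesis
              using ln_le_minus_one[of "1 / q"] by (simp add: ln_div ln_realpow)
          qed
          ultimately show ?thesis using b y ne by (simp add: ln_mult f'_def y_def)
        qed
      qed
      moreover have "2 - 4 * 2 \<le> 2 - 4 * (sqrt ((1 - x0) + 1) - sqrt (1 - x0))"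
        by (intro diff_left_mono mult_left_mono sqrt_unit_increment) simp
      ultimately have "ln (cmod b) - 6 \<le> integral {1..2} h" by simp
      then show ?thesis using mx ln2(2) by simp
    qed
  qed
  then show ?thesis by (simp add: h_def[abs_def])
qed

context compact_carried begin

text \<open>The pointwise average bound is integrated over \<open>M\<close> and the integrals are
  swapped. As [1,2] has length 1, the maximising \<xi> does at least as well as the average.\<close>

lemma choose_coefficient:
  fixes a b :: "complex \<Rightarrow> complex" and G :: "complex \<Rightarrow> real"
  assumes a: "continuous_on UNIV a" and b: "continuous_on UNIV b" and G: "continuous_on UNIV G" "\<And>z. 0 < G z"
  shows "\<exists>\<xi>\<in>{1..2}. (\<integral>z. ln (max (G z) (max (cmod (a z)) (cmod (b z)))) \<partial>M) - 10 * mass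
     \<le> (\<integral>z. ln (max (G z) (cmod (a z + of_real \<xi> * b z))) \<partial>M)"
proof -
  define h where "h \<xi> z = ln (max (G z) (cmod (a z + of_real \<xi> * b z)))" for \<xi> :: real and z
  have pos: "max (G z) x \<noteq> 0" for z x using G(2)[of z] by (simp add: max_def)
  have G2: "continuous_on UNIV (\<lambda>x::real \<times> complex. G (snd x))" "continuous_on UNIV (\<lambda>x::real \<times> complex. a (snd x))"
     "continuous_on UNIV (\<lambda>x::real \<times> complex. b (snd x))"
    by (rule continuous_on_compose2[OF G(1) continuous_on_snd[OF continuous_on_id]]
          continuous_on_compose2[OF a continuous_on_snd[OF continuous_on_id]]
          continuous_on_compose2[OF b continuous_on_snd[OF continuous_on_id]], simp)+
  have hc: "continuous_on UNIV (\<lambda>(\<xi>, z). h \<xi> z)"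
    unfolding h_def split_beta' by (intro continuous_intros G2) (use pos in auto)
  have hc2: "continuous_on UNIV (\<lambda>\<xi>. \<integral>z. h \<xi> z \<partial>M)" by (rule continuous_on_integral[OF hc])
  obtain \<xi> where \<xi>: "\<xi> \<in> {1..2}" "\<And>x. x \<in> {1..2} \<Longrightarrow> (\<integral>z. h x z \<partial>M) \<le> (\<integral>z. h \<xi> z \<partial>M)"
    using continuous_attains_sup[OF compact_Icc _ continuous_on_subset[OF hc2 subset_UNIV], of 1 2] by auto
  have mc: "continuous_on UNIV (\<lambda>z. ln (max (G z) (max (cmod (a z)) (cmod (b z)))))"
    by (intro continuous_intros a b G) (use pos in auto)
  have "(\<integral>z. ln (max (G z) (max (cmod (a z)) (cmod (b z)))) \<partial>M) - 10 * mass
     = (\<integral>z. ln (max (G z) (max (cmod (a z)) (cmod (b z)))) - 10 \<partial>M)"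
    by (subst Bochner_Integration.integral_diff) (auto intro!: integrable_cont mc simp: space_eq)
  also have "\<dots> \<le> (\<integral>z. integral {1..2} (\<lambda>\<xi>. h \<xi> z) \<partial>M)"
  proof (rule integral_mono_C)
    show "continuous_on UNIV (\<lambda>z. ln (max (G z) (max (cmod (a z)) (cmod (b z)))) - 10)"
      by (intro continuous_on_diff mc continuous_intros)
    show "continuous_on UNIV (\<lambda>z. integral {1..2} (\<lambda>\<xi>. h \<xi> z))"
      unfolding cbox_interval[symmetric]
      by (rule integral_continuous_on_param)
         (use continuous_on_compose2[OF hc, of "UNIV \<times> cbox 1 2" "\<lambda>(t, x). (x, t)"] in
          \<open>simp add: split_beta' continuous_on_Pair continuous_on_fst continuous_on_snd continuous_on_id\<close>)
    show "ln (max (G z) (max (cmod (a z)) (cmod (b z)))) - 10 \<le> integral {1..2} (\<lambda>\<xi>. h \<xi> z)" for z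
      unfolding h_def by (rule log_linear_average[OF G(2)])
  qed
  also have "\<dots> = integral {1..2} (\<lambda>\<xi>. \<integral>z. h \<xi> z \<partial>M)" by (rule integral_swap[OF hc, symmetric])
  also have "\<dots> \<le> integral {1..2} (\<lambda>_::real. \<integral>z. h \<xi> z \<partial>M)"
    by (rule integral_le) (use \<xi> in \<open>auto intro!: integrable_continuous_interval continuous_on_subset[OF hc2]\<close>)
  also have "\<dots> = (\<integral>z. h \<xi> z \<partial>M)" by simp
  finally show ?thesis using \<xi>(1) unfolding h_def by blast
qed

end

lemma Max_insert_max: "finite X \<Longrightarrow> Max (insert (max x y) X) = Max (insert x (insert y X))" for x :: "'a::linorder"
  by (cases "X = {}") (auto simp: max.assoc)

lemma continuous_on_Max_insert:
  fixes f :: "nat \<Rightarrow> 'a::topological_space \<Rightarrow> real"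
  assumes "continuous_on A g" "\<And>k. k < m \<Longrightarrow> continuous_on A (f k)"
  shows "continuous_on A (\<lambda>z. Max (insert (g z) ((\<lambda>k. f k z) ` {..<m})))"
  using assms
proof (induction m arbitrary: g)
  case (Suc m)
  have "continuous_on A (\<lambda>z. Max (insert (max (g z) (f m z)) ((\<lambda>k. f k z) ` {..<m})))"
    by (rule Suc.IH) (auto intro!: continuous_intros Suc.prems)
  then show ?case by (simp add: lessThan_Suc Max_insert_max del: Max_insert)
qed simp

context compact_carried begin

text \<open>In the induction the last term is first absorbed into the lower cut-off, which is why
  \<open>G\<close> is a function and is generalised. One application of the single-coefficient lemma
  then turns the maximum of partial sum and last term into a sum, again at cost 10 per unit of
  mass.\<close>

lemma choose_coefficients:
  fixes a :: "nat \<Rightarrow> complex \<Rightarrow> complex" and G :: "complex \<Rightarrow> real"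
  assumes a: "\<And>k. continuous_on UNIV (a k)" and G: "continuous_on UNIV G" "\<And>z. 0 < G z"
  shows "\<exists>\<xi>. (\<forall>k. \<xi> k \<in> {1..2}) \<and> (\<integral>z. ln (Max (insert (G z) ((\<lambda>k. cmod (a k z)) ` {..<m}))) \<partial>M) - 10 * real m * mass
     \<le> (\<integral>z. ln (max (G z) (cmod (\<Sum>k<m. of_real (\<xi> k) * a k z))) \<partial>M)"
  using G
proof (induction m arbitrary: G)
  case 0
  have "max (G z) 0 = G z" for z using less_imp_le[OF 0(2)[of z]] by (rule max_absorb1)
  then show ?case by (intro exI[of _ "\<lambda>_. 1"]) simp
next
  case (Suc m)
  define G' where "G' z = max (G z) (cmod (a m z))" for z
  have G': "continuous_on UNIV G'" "\<And>z. 0 < G' z"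
    unfolding G'_def using Suc.prems(2) by (auto intro!: continuous_intros Suc.prems(1) a simp: less_max_iff_disj)
  from Suc.IH[OF G'] obtain \<xi> where \<xi>: "\<forall>k. \<xi> k \<in> {1..2}"
    "(\<integral>z. ln (Max (insert (G' z) ((\<lambda>k. cmod (a k z)) ` {..<m}))) \<partial>M) - 10 * real m * mass
     \<le> (\<integral>z. ln (max (G' z) (cmod (\<Sum>k<m. of_real (\<xi> k) * a k z))) \<partial>M)"
    by (elim exE conjE) (rule that)
  have sc: "continuous_on UNIV (\<lambda>z. \<Sum>k<m. of_real (\<xi> k) * a k z)"
    by (intro continuous_intros a)
  from choose_coefficient[OF sc a[of m] Suc.prems] obtain x where x: "x \<in> {1..2}"
    "(\<integral>z. ln (max (G z) (max (cmod (\<Sum>k<m. of_real (\<xi> k) * a k z)) (cmod (a m z)))) \<partial>M) - 10 * mass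
     \<le> (\<integral>z. ln (max (G z) (cmod ((\<Sum>k<m. of_real (\<xi> k) * a k z) + of_real x * a m z))) \<partial>M)"
    by (elim bexE) (rule that)
  have e1: "max (G z) (max (cmod (\<Sum>k<m. of_real (\<xi> k) * a k z)) (cmod (a m z)))
     = max (G' z) (cmod (\<Sum>k<m. of_real (\<xi> k) * a k z))" for z
    unfolding G'_def by (simp only: max.assoc max.commute[of "cmod (a m z)"])
  have e2: "Max (insert (G' z) ((\<lambda>k. cmod (a k z)) ` {..<m})) = Max (insert (G z) ((\<lambda>k. cmod (a k z)) ` {..<Suc m}))" for z
    by (simp only: G'_def lessThan_Suc image_insert Max_insert_max[OF finite_imageI[OF finite_lessThan]])
  have "(\<Sum>k<m. of_real ((\<xi>(m := x)) k) * a k z) = (\<Sum>k<m. of_real (\<xi> k) * a k z)" for z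
    by (rule sum.cong) auto
  then have e3: "(\<Sum>k<Suc m. of_real ((\<xi>(m := x)) k) * a k z) = (\<Sum>k<m. of_real (\<xi> k) * a k z) + of_real x * a m z" for z
    by simp
  show ?case
  proof (intro exI[of _ "\<xi>(m := x)"] conjI)
    show "\<forall>k. (\<xi>(m := x)) k \<in> {1..2}" using \<xi>(1) x(1) by simp
    show "(\<integral>z. ln (Max (insert (G z) ((\<lambda>k. cmod (a k z)) ` {..<Suc m}))) \<partial>M) - 10 * real (Suc m) * mass
     \<le> (\<integral>z. ln (max (G z) (cmod (\<Sum>k<Suc m. of_real ((\<xi>(m := x)) k) * a k z))) \<partial>M)"
    proof -
      have "10 * real (Suc m) * mass = 10 * real m * mass + 10 * mass" by (simp add: algebra_simps)
      then show ?thesis using \<xi>(2) x(2) unfolding e1 e2 e3 by linarith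
    qed
  qed
qed

end

section \<open>Integrating the domination against a maximum of logarithms\<close>

definition maxdist :: "(nat \<Rightarrow> real) \<Rightarrow> (nat \<Rightarrow> complex) \<Rightarrow> nat \<Rightarrow> complex \<Rightarrow> real" where
  "maxdist v c m z = Max ((\<lambda>k. v k * cmod (z - c k)) ` {..<m})"

lemma Max_insert_const:
  assumes "0 < m"
  shows "Max (insert x (f ` {..<m::nat})) = max x (Max (f ` {..<m}))"
  by (rule Max_insert) (use assms in auto)

lemma continuous_on_max_maxdist:
  assumes "0 < m"
  shows "continuous_on A (\<lambda>z. max x (maxdist v c m z))"
proof -
  have "continuous_on A (\<lambda>z. Max (insert x ((\<lambda>k. v k * cmod (z - c k)) ` {..<m})))"
    by (rule continuous_on_Max_insert) (auto intro!: continuous_intros)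
  then show ?thesis by (simp add: Max_insert_const[OF assms] maxdist_def)
qed

lemma continuous_on_ln_max_maxdist:
  assumes "0 < m" "0 < x"
  shows "continuous_on A (\<lambda>z. ln (max x (maxdist v c m z)))"
  by (intro continuous_on_ln continuous_on_max_maxdist assms) (use assms in \<open>auto simp: max_def\<close>)

lemma maxdist_ge: "k < m \<Longrightarrow> v k * cmod (z - c k) \<le> maxdist v c m z"
  unfolding maxdist_def by (intro Max_ge) auto

lemma maxdist_attained:
  assumes "0 < m"
  obtains k where "k < m" "maxdist v c m z = v k * cmod (z - c k)"
proof -
  have "maxdist v c m z \<in> (\<lambda>k. v k * cmod (z - c k)) ` {..<m}"
    unfolding maxdist_def by (rule Max_in) (use assms in auto)
  then show ?thesis using that by auto
qed

text \<open>The coefficient of degree \<open>n\<close> is the sum of the \<open>x k\<close>; its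
  positivity forces exactly \<open>n\<close> zeros, counted with multiplicity.\<close>

lemma factor_combination:
  fixes x :: "nat \<Rightarrow> real" and c :: "nat \<Rightarrow> complex"
  assumes "0 < (\<Sum>k<m. x k)"
  obtains \<zeta> where "\<And>z. (\<Sum>k<m. of_real (x k) * (z - c k) ^ n) = of_real (\<Sum>k<m. x k) * (\<Prod>i<n. (z - \<zeta> i))"
proof -
  define Q where "Q = (\<Sum>k<m. smult (of_real (x k)) ([:- c k, 1:] ^ n))"
  have cn: "coeff ([:- d, 1:] ^ n) n = 1" "degree ([:- d, 1:] ^ n) = n" for d :: complex
    by (auto simp: coeff_linear_power degree_linear_power)
  have cQ: "coeff Q n = of_real (\<Sum>k<m. x k)"
    by (simp add: Q_def coeff_sum cn)
  have "degree Q \<le> n"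
    unfolding Q_def by (intro degree_sum_le) (auto intro: order_trans[OF degree_smult_le] simp: cn)
  moreover have "n \<le> degree Q" by (rule le_degree) (use assms in \<open>simp add: cQ del: of_real_sum\<close>)
  ultimately have dQ: "degree Q = n" by simp
  obtain \<zeta> where \<zeta>: "smult (lead_coeff Q) (\<Prod>i<degree Q. [:-\<zeta> i, 1:]) = Q"
    by (rule complex_poly_decompose')
  show ?thesis
  proof
    fix z
    have "(\<Sum>k<m. of_real (x k) * (z - c k) ^ n) = poly Q z"
      by (simp add: Q_def poly_sum poly_power)
    also have "\<dots> = of_real (\<Sum>k<m. x k) * (\<Prod>i<n. (z - \<zeta> i))"
      by (subst \<zeta>[symmetric]) (simp add: dQ cQ poly_prod del: of_real_sum)
    finally show "(\<Sum>k<m. of_real (x k) * (z - c k) ^ n) = of_real (\<Sum>k<m. x k) * (\<Prod>i<n. (z - \<zeta> i))" .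
  qed
qed

text \<open>The function \<open>log max\<^sub>k v\<^sub>k |z - c\<^sub>k|\<close> is, up to \<open>O(1/n)\<close> in the mean, \<open>1/n\<close> times the logarithm of a
  polynomial \<open>\<Sum> \<xi>\<^sub>k (v\<^sub>k (z - c\<^sub>k))\<^sup>n\<close>, so it can be integrated against the pointwise domination of
  potentials at the zeros of that polynomial.\<close>

lemma maxdist_domination_step:
  fixes n m :: nat and L A :: real
  assumes nu: "compact_carried \<nu> D" "measure \<nu> UNIV = 1"
    and mk: "compact_carried M K" "measure M UNIV = \<kappa>" "0 < \<kappa>"
    and r: "0 < r" "0 < \<rho>1"
    and dom: "\<And>\<rho> z. 0 < \<rho> \<Longrightarrow> \<rho> < \<rho>1 \<Longrightarrow> rpot r \<nu> z \<le> rpot \<rho> M z / \<kappa> + A"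
    and v: "\<And>k. k < m \<Longrightarrow> 0 \<le> v k" "\<And>k. k < m \<Longrightarrow> v k \<le> V" "k0 < m" "v k0 = V" "0 < V"
    and L: "L \<le> (\<integral>z. ln (max (V * r) (maxdist v c m z)) \<partial>\<nu>)"
    and \<delta>: "0 < \<delta>" and n: "0 < n"
  shows "n * L - 10 * m \<le> ln (2 * m) + n * (\<integral>z. ln (max \<delta> (maxdist v c m z)) \<partial>M) / \<kappa> + n * A"
proof -
  interpret nu: compact_carried \<nu> D by fact
  interpret mk: compact_carried M K by fact
  have m: "0 < m" using v by auto
  define a where "a k z = (of_real (v k) * (z - c k)) ^ n" for k z
  have ac: "continuous_on UNIV (a k)" for k unfolding a_def by (intro continuous_intros)
  \<comment> \<open>The cut-off matches the truncation of the zeros at radius \<open>r\<close>: the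
    leading coefficient is at least V^n, so G \<le> P r z everywhere.\<close>
  define G where "G = (V * r) ^ n"
  have G: "0 < G" using v r by (simp add: G_def)
  obtain \<xi> where \<xi>: "\<And>k. \<xi> k \<in> {1..2}" and
    \<xi>i: "(\<integral>z. ln (Max (insert G ((\<lambda>k. cmod (a k z)) ` {..<m}))) \<partial>\<nu>) - 10 * real m * measure \<nu> UNIV
     \<le> (\<integral>z. ln (max G (cmod (\<Sum>k<m. of_real (\<xi> k) * a k z))) \<partial>\<nu>)"
    using nu.choose_coefficients[where a = a and G = "\<lambda>_. G" and m = m, OF ac continuous_on_const] G by blast
  define x where "x k = \<xi> k * v k ^ n" for k
  define X where "X = (\<Sum>k<m. x k)"
  have x0: "0 \<le> x k" if "k < m" for k using \<xi>[of k] v(1)[OF that] by (simp add: x_def)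
  have XV: "V ^ n \<le> X"
  proof -
    have "V ^ n \<le> x k0" using \<xi>[of k0] v(4,5) by (simp add: x_def)
    also have "\<dots> \<le> X" unfolding X_def by (rule member_le_sum) (use v x0 in auto)
    finally show ?thesis .
  qed
  have X: "0 < X" using XV v(5) by (meson order_less_le_trans zero_less_power)
  obtain \<zeta> where \<zeta>: "\<And>z. (\<Sum>k<m. of_real (x k) * (z - c k) ^ n) = of_real X * (\<Prod>i<n. (z - \<zeta> i))"
    using factor_combination[of x m c n] X unfolding X_def by metis
  define Q where "Q z = (\<Sum>k<m. of_real (\<xi> k) * a k z)" for z
  have Q: "Q z = of_real X * (\<Prod>i<n. (z - \<zeta> i))" for z
    unfolding \<zeta>[symmetric] Q_def a_def x_def by (simp add: power_mult_distrib mult_ac)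
  \<comment> \<open>The logarithm of |Q| with each distance to a zero truncated at \<rho>. By
    symmetry of the kernel, its integral against a measure is a sum of truncated potentials at the
    zeros, where \<open>dom\<close> applies.\<close>
  define F where "F \<rho> z = ln X + (\<Sum>i<n. ln (max \<rho> (cmod (\<zeta> i - z))))" for \<rho> z
  define P where "P \<rho> z = X * (\<Prod>i<n. max \<rho> (cmod (\<zeta> i - z)))" for \<rho> z
  have FP: "F \<rho> z = ln (P \<rho> z)" if "0 < \<rho>" for \<rho> z
  proof -
    have p: "max \<rho> (cmod (\<zeta> i - z)) > 0" for i using that by simp
    then have p': "max \<rho> (cmod (\<zeta> i - z)) \<noteq> 0" for i using less_irrefl by metis
    have "ln (\<Prod>i<n. max \<rho> (cmod (\<zeta> i - z))) = (\<Sum>i<n. ln (max \<rho> (cmod (\<zeta> i - z))))"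
      by (rule ln_prod) (use p' in auto)
    moreover have "(\<Prod>i<n. max \<rho> (cmod (\<zeta> i - z))) > 0" by (intro prod_pos) (use p in auto)
    ultimately show ?thesis using X p' by (simp add: F_def P_def ln_mult)
  qed
  have PQ: "cmod (Q z) \<le> P \<rho> z" "P 0 z = cmod (Q z)" for \<rho> z
  proof -
    have "cmod (Q z) = X * (\<Prod>i<n. cmod (\<zeta> i - z))"
      using X by (simp add: Q norm_mult prod_norm norm_minus_commute)
    moreover have "(\<Prod>i<n. cmod (\<zeta> i - z)) \<le> (\<Prod>i<n. max \<rho> (cmod (\<zeta> i - z)))"
      by (intro prod_mono) auto
    ultimately show "cmod (Q z) \<le> P \<rho> z" "P 0 z = cmod (Q z)" using X by (auto simp: P_def)
  qed
  have Fc: "continuous_on UNIV (F \<rho>)" if "0 < \<rho>" for \<rho>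
    unfolding F_def by (intro continuous_intros continuous_on_trunc_log that)
  have Fint: "(\<integral>z. F \<rho> z \<partial>N) = measure N UNIV * ln X + (\<Sum>i<n. rpot \<rho> N (\<zeta> i))"
    if \<rho>: "0 < \<rho>" and N: "compact_carried N K'" for \<rho> N K'
  proof -
    interpret N: compact_carried N K' by fact
    show ?thesis unfolding F_def rpot_def
      by (subst Bochner_Integration.integral_add)
         (auto intro!: N.kernel_integrable \<rho> simp: N.space_eq Bochner_Integration.integral_sum N.kernel_integrable[OF \<rho>])
  qed
  have upper: "(\<integral>z. F r z \<partial>\<nu>) \<le> (\<integral>z. F \<rho> z \<partial>M) / \<kappa> + n * A" if \<rho>: "0 < \<rho>" "\<rho> < \<rho>1" for \<rho>
  proof -
    have "(\<integral>z. F r z \<partial>\<nu>) = ln X + (\<Sum>i<n. rpot r \<nu> (\<zeta> i))" using Fint[OF r(1) nu(1)] nu(2) by simp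
    also have "\<dots> \<le> ln X + (\<Sum>i<n. rpot \<rho> M (\<zeta> i) / \<kappa> + A)"
      by (intro add_left_mono sum_mono dom \<rho>)
    also have "\<dots> = (\<integral>z. F \<rho> z \<partial>M) / \<kappa> + n * A"
      using Fint[OF \<rho>(1) mk(1)] mk(2,3) by (simp add: sum.distrib sum_divide_distrib add_divide_distrib)
    finally show ?thesis .
  qed
  define E where "E = \<delta> ^ n"
  have E: "0 < E" using \<delta> by (simp add: E_def)
  have E': "max E y \<noteq> 0" for y using E by (simp add: max_def)
  \<comment> \<open>The lower cut-off \<delta>^n keeps the integrand continuous down to \<rho> = 0,
    even at the zeros of \<open>Q\<close>, so the limit \<rho> \<rightarrow> 0 can be taken under
    the integral.\<close>
  define H where "H \<rho> z = ln (max E (P \<rho> z))" for \<rho> z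
  have Hcc: "continuous_on UNIV (\<lambda>(\<rho>, z). H \<rho> z)"
    unfolding H_def P_def split_beta' by (intro continuous_intros ballI E')
  have Hc: "continuous_on UNIV (\<lambda>\<rho>. \<integral>z. H \<rho> z \<partial>M)" by (rule mk.continuous_on_integral[OF Hcc])
  have Hz: "continuous_on UNIV (H \<rho>)" for \<rho> by (rule continuous_on_section[OF Hcc])
  have "n * L - 10 * m \<le> (\<integral>z. F r z \<partial>\<nu>)"
  proof -
    have "n * L \<le> n * (\<integral>z. ln (max (V * r) (maxdist v c m z)) \<partial>\<nu>)" using L by (intro mult_left_mono) auto
    also have "\<dots> = (\<integral>z. n * ln (max (V * r) (maxdist v c m z)) \<partial>\<nu>)" by simp
    also have "\<dots> \<le> (\<integral>z. ln (Max (insert G ((\<lambda>k. cmod (a k z)) ` {..<m}))) \<partial>\<nu>)"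
    proof (rule nu.integral_mono_C)
      show "continuous_on UNIV (\<lambda>z. n * ln (max (V * r) (maxdist v c m z)))"
        using v r by (intro continuous_on_mult continuous_on_const continuous_on_ln_max_maxdist m) simp
      have ge: "G \<le> Max (insert G ((\<lambda>k. cmod (a k z)) ` {..<m}))" for z by (rule Max_ge) auto
      show "continuous_on UNIV (\<lambda>z. ln (Max (insert G ((\<lambda>k. cmod (a k z)) ` {..<m}))))"
      proof (intro continuous_on_ln continuous_on_Max_insert continuous_intros ac ballI)
        show "Max (insert G ((\<lambda>k. cmod (a k z)) ` {..<m})) \<noteq> 0" for z using ge[of z] G by linarith
      qed
      fix z
      obtain k where k: "k < m" "maxdist v c m z = v k * cmod (z - c k)" by (rule maxdist_attained[OF m])
      have "(max (V * r) (maxdist v c m z)) ^ n \<le> Max (insert G ((\<lambda>k. cmod (a k z)) ` {..<m}))"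
      proof (cases "maxdist v c m z \<le> V * r")
        case True
        then show ?thesis using ge by (simp add: G_def max_absorb1)
      next
        case False
        then have "(max (V * r) (maxdist v c m z)) ^ n = cmod (a k z)"
          using k v(1)[OF k(1)] by (simp add: a_def norm_power norm_mult max_absorb2)
        also have "\<dots> \<le> Max (insert G ((\<lambda>k. cmod (a k z)) ` {..<m}))" using k by (intro Max_ge) auto
        finally show ?thesis .
      qed
      moreover have "0 < max (V * r) (maxdist v c m z)" using v r by (simp add: less_max_iff_disj)
      ultimately show "n * ln (max (V * r) (maxdist v c m z)) \<le> ln (Max (insert G ((\<lambda>k. cmod (a k z)) ` {..<m})))"
        by (subst ln_realpow[symmetric], simp, subst ln_le_cancel_iff)
           (auto intro: order_less_le_trans[OF G ge])
    qed
    also have "\<dots> \<le> (\<integral>z. ln (max G (cmod (Q z))) \<partial>\<nu>) + 10 * m"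
      using \<xi>i nu(2) unfolding Q_def by simp
    also have "(\<integral>z. ln (max G (cmod (Q z))) \<partial>\<nu>) \<le> (\<integral>z. F r z \<partial>\<nu>)"
    proof (rule nu.integral_mono_C)
      show "continuous_on UNIV (\<lambda>z. ln (max G (cmod (Q z))))"
        unfolding Q_def by (intro continuous_on_trunc_log continuous_intros ac G)
      show "continuous_on UNIV (F r)" by (rule Fc[OF r(1)])
      fix z
      have "G \<le> P r z"
      proof -
        have "r ^ n \<le> (\<Prod>i<n. max r (cmod (\<zeta> i - z)))"
          using prod_mono[of "{..<n}" "\<lambda>_. r" "\<lambda>i. max r (cmod (\<zeta> i - z))"] r by simp
        then show ?thesis unfolding P_def G_def power_mult_distrib using XV X r by (intro mult_mono) auto
      qed
      then show "ln (max G (cmod (Q z))) \<le> F r z"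
        unfolding FP[OF r(1)] using G PQ(1)[of z r] by (subst ln_le_cancel_iff) auto
    qed
    finally show ?thesis by simp
  qed
  then have low: "n * L - 10 * m - n * A \<le> (\<integral>z. H \<rho> z \<partial>M) / \<kappa>" if "0 < \<rho>" "\<rho> < \<rho>1" for \<rho>
  proof -
    have "(\<integral>z. F \<rho> z \<partial>M) \<le> (\<integral>z. H \<rho> z \<partial>M)"
    proof (rule mk.integral_mono_C[OF Fc[OF that(1)] Hz])
      fix z
      have "0 < P \<rho> z" unfolding P_def using X that by (intro mult_pos_pos prod_pos) auto
      then show "F \<rho> z \<le> H \<rho> z" unfolding FP[OF that(1)] H_def using E by (subst ln_le_cancel_iff) auto
    qed
    then have "(\<integral>z. F \<rho> z \<partial>M) / \<kappa> \<le> (\<integral>z. H \<rho> z \<partial>M) / \<kappa>" using mk(3) by (intro divide_right_mono) auto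
    then show ?thesis using upper[OF that] \<open>n * L - 10 * m \<le> (\<integral>z. F r z \<partial>\<nu>)\<close> by linarith
  qed
  have ev: "\<forall>\<^sub>F \<rho> in at_right 0. n * L - 10 * m - n * A \<le> (\<integral>z. H \<rho> z \<partial>M) / \<kappa>"
    using eventually_at_right_real[OF r(2)] by (rule eventually_mono) (use low in auto)
  have "((\<lambda>\<rho>. (\<integral>z. H \<rho> z \<partial>M) / \<kappa>) \<longlongrightarrow> (\<integral>z. H 0 z \<partial>M) / \<kappa>) (at_right 0)"
    using Hc mk(3) by (intro tendsto_intros) (auto simp: continuous_on_def intro: tendsto_within_subset)
  from tendsto_lowerbound[OF this ev]
  have 1: "n * L - 10 * m - n * A \<le> (\<integral>z. H 0 z \<partial>M) / \<kappa>" by simp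
  have "(\<integral>z. H 0 z \<partial>M) \<le> (\<integral>z. ln (2 * m) + n * ln (max \<delta> (maxdist v c m z)) \<partial>M)"
  proof (rule mk.integral_mono_C[OF Hz])
    show "continuous_on UNIV (\<lambda>z. ln (2 * m) + n * ln (max \<delta> (maxdist v c m z)))"
      using \<delta> by (intro continuous_on_add continuous_on_mult continuous_on_const continuous_on_ln_max_maxdist m) simp
    fix z
    define y where "y = max \<delta> (maxdist v c m z)"
    have y: "0 < y" "\<delta> \<le> y" using \<delta> by (auto simp: y_def)
    have "cmod (Q z) \<le> (\<Sum>k<m. 2 * y ^ n)"
      unfolding Q_def
    proof (rule sum_norm_le)
      fix k assume k: "k \<in> {..<m}"
      have "cmod (a k z) = (v k * cmod (z - c k)) ^ n" using v(1)[of k] k by (simp add: a_def norm_power norm_mult)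
      also have "\<dots> \<le> y ^ n"
      proof (rule power_mono)
        show "v k * cmod (z - c k) \<le> y" using maxdist_ge[of k m v z c] k by (simp add: y_def le_max_iff_disj)
        show "0 \<le> v k * cmod (z - c k)" using v(1)[of k] k by simp
      qed
      finally show "cmod (of_real (\<xi> k) * a k z) \<le> 2 * y ^ n"
        unfolding norm_mult using \<xi>[of k] by (intro mult_mono) auto
    qed
    then have "cmod (Q z) \<le> (2 * m) * y ^ n" by simp
    moreover have "E \<le> (2 * m) * y ^ n"
    proof -
      have "1 * \<delta> ^ n \<le> (2 * m) * y ^ n" using m \<delta> y by (intro mult_mono power_mono) auto
      then show ?thesis by (simp add: E_def)
    qed
    ultimately have "H 0 z \<le> ln ((2 * m) * y ^ n)"
      unfolding H_def PQ(2) using E m y by (subst ln_le_cancel_iff) auto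
    also have "\<dots> = ln (2 * m) + n * ln y" using m y by (simp add: ln_mult ln_realpow)
    finally show "H 0 z \<le> ln (2 * m) + n * ln (max \<delta> (maxdist v c m z))" by (simp add: y_def)
  qed
  also have "\<dots> = \<kappa> * ln (2 * m) + n * (\<integral>z. ln (max \<delta> (maxdist v c m z)) \<partial>M)"
    using mk.integrable_cont[OF continuous_on_ln_max_maxdist[OF m \<delta>]] mk(2) by (simp add: mk.space_eq)
  finally have "(\<integral>z. H 0 z \<partial>M) / \<kappa> \<le> ln (2 * m) + n * (\<integral>z. ln (max \<delta> (maxdist v c m z)) \<partial>M) / \<kappa>"
    using mk(3) by (simp add: field_simps)
  with 1 show ?thesis by linarith
qed

text \<open>In the polynomial estimate the terms 10 m and ln(2m) do not grow with \<open>n\<close>,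
  so a violation would be contradicted by large \<open>n\<close>. Afterwards \<epsilon>
  \<rightarrow> 0 replaces the restriction to \<open>K\<close> by \<mu> itself.\<close>

lemma maxdist_domination:
  fixes m :: nat and L A :: real
  assumes mu: "compact_carried \<mu> S" "measure \<mu> UNIV = 1"
    and nu: "compact_carried \<nu> D" "measure \<nu> UNIV = 1"
    and B: "\<And>z r. z \<in> S \<Longrightarrow> 0 < r \<Longrightarrow> -B \<le> rpot r \<mu> z"
    and dom: "\<And>z \<rho> \<epsilon>. z \<in> S \<Longrightarrow> 0 < \<rho> \<Longrightarrow> 0 < \<epsilon> \<Longrightarrow> \<exists>r>0. rpot r \<nu> z \<le> A + \<epsilon> + rpot \<rho> \<mu> z"
    and v: "\<And>k. k < m \<Longrightarrow> 0 \<le> v k" "\<And>k. k < m \<Longrightarrow> v k \<le> V" "k0 < m" "v k0 = V" "0 < V"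
    and L: "\<And>r. 0 < r \<Longrightarrow> L \<le> (\<integral>z. ln (max (V * r) (maxdist v c m z)) \<partial>\<nu>)"
    and \<delta>: "0 < \<delta>"
  shows "L \<le> A + (\<integral>z. ln (max \<delta> (maxdist v c m z)) \<partial>\<mu>)"
proof -
  interpret mu: compact_carried \<mu> S by fact
  have m: "0 < m" using v by auto
  define g where "g z = ln (max \<delta> (maxdist v c m z))" for z
  have gc: "continuous_on UNIV g" unfolding g_def by (rule continuous_on_ln_max_maxdist[OF m \<delta>])
  have gi: "integrable \<mu> g" by (rule mu.integrable_cont[OF gc])
  have gm: "g \<in> borel_measurable borel" by (rule borel_measurable_continuous_onI[OF gc])
  \<comment> \<open>Subtracting the lower bound \<open>b\<close> makes the integrand nonnegative, so
    restricting \<mu> to \<open>K\<close> can only lower its integral.\<close>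
  define b where "b = ln \<delta>"
  have gb: "b \<le> g z" for z using \<delta> by (simp add: b_def g_def)
  define Y where "Y = (\<integral>z. g z - b \<partial>\<mu>)"
  have Y0: "0 \<le> Y" unfolding Y_def by (rule integral_nonneg_AE) (use gb in auto)
  have Yg: "Y = integral\<^sup>L \<mu> g - b" unfolding Y_def using gi mu(2) by (simp add: mu.space_eq)
  have est: "L \<le> A + \<epsilon> + b + Y / (1 - \<epsilon>)" if \<epsilon>: "0 < \<epsilon>" "\<epsilon> < 1" for \<epsilon>
  proof -
    obtain K r \<rho>1 where K: "compact K" "K \<subseteq> S" "1 - \<epsilon> \<le> measure \<mu> K" "0 < measure \<mu> K" "0 < r" "0 < \<rho>1"
      "\<forall>\<rho> z. 0 < \<rho> \<longrightarrow> \<rho> < \<rho>1 \<longrightarrow>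
        rpot r \<nu> z \<le> rpot \<rho> (density \<mu> (indicat_real K)) z / measure \<mu> K + A + \<epsilon>"
      by (rule domination[OF mu nu B dom \<epsilon>(1)]) (assumption | rule that)+
    define \<kappa> where "\<kappa> = measure \<mu> K"
    have Kb [measurable]: "K \<in> sets borel" using K by (simp add: borel_compact)
    define M where "M = density \<mu> (indicat_real K)"
    have mk: "compact_carried M K"
      unfolding M_def by (rule mu.compact_carried_density) (use K in \<open>auto simp: indicator_def\<close>)
    interpret mk: compact_carried M K by fact
    have mint: "integral\<^sup>L M f = (\<integral>x. indicat_real K x * f x \<partial>\<mu>)" if "f \<in> borel_measurable borel" for f :: "complex \<Rightarrow> real"
      unfolding M_def by (rule mu.integral_density_real) (use that in auto)
    have mass: "measure M UNIV = \<kappa>"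
      using mint[of "\<lambda>_. 1"] by (simp add: mk.space_eq mu.space_eq \<kappa>_def)
    define J where "J = integral\<^sup>L M g"
    have step: "n * L - 10 * m \<le> ln (2 * m) + n * J / \<kappa> + n * (A + \<epsilon>)" if "0 < n" for n :: nat
      unfolding J_def g_def
      by (rule maxdist_domination_step[OF nu mk mass _ K(5,6) _ v L[OF K(5)] \<delta> that])
         (use K in \<open>auto simp: \<kappa>_def M_def add.assoc\<close>)
    have "L \<le> A + \<epsilon> + J / \<kappa>"
    proof (rule ccontr)
      assume "\<not> ?thesis"
      then have "0 < L - (A + \<epsilon> + J / \<kappa>)" by simp
      from reals_Archimedean3[OF this] obtain n :: nat where n: "10 * m + ln (2 * m) < n * (L - (A + \<epsilon> + J / \<kappa>))" by blast
      moreover have "0 < 10 * m + ln (2 * m)" using m by (intro add_pos_nonneg) auto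
      ultimately have "0 < n" by (cases n) auto
      from step[OF this] n show False by (simp add: algebra_simps)
    qed
    also have "J = (\<integral>z. g z - b \<partial>M) + \<kappa> * b"
      unfolding J_def using mk.integrable_cont[OF gc] by (simp add: mass mk.space_eq)
    also have "(\<integral>z. g z - b \<partial>M) \<le> Y"
    proof -
      have "(\<integral>z. g z - b \<partial>M) = (\<integral>z. indicat_real K z * (g z - b) \<partial>\<mu>)"
        by (rule mint) (use gm in simp)
      also have "\<dots> \<le> Y" unfolding Y_def
        by (rule integral_mono) (use gi gb in \<open>auto intro!: mu.integrable_mult_bounded simp: indicator_def\<close>)
      finally show ?thesis .
    qed
    finally have "L \<le> A + \<epsilon> + (Y + \<kappa> * b) / \<kappa>"
      using K(4) by (simp add: \<kappa>_def divide_right_mono)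
    also have "(Y + \<kappa> * b) / \<kappa> = b + Y / \<kappa>" using K(4) by (simp add: \<kappa>_def field_simps)
    also have "Y / \<kappa> \<le> Y / (1 - \<epsilon>)" using Y0 K \<epsilon> by (intro divide_left_mono) (auto simp: \<kappa>_def)
    finally show ?thesis by simp
  qed
  have "((\<lambda>\<epsilon>. A + \<epsilon> + b + Y / (1 - \<epsilon>)) \<longlongrightarrow> A + 0 + b + Y / (1 - 0)) (at_right 0)"
    by (intro tendsto_intros) auto
  moreover have "\<forall>\<^sub>F \<epsilon> in at_right 0. L \<le> A + \<epsilon> + b + Y / (1 - \<epsilon>)"
    using eventually_at_right_real[OF zero_less_one] by (rule eventually_mono) (use est in auto)
  ultimately have "L \<le> A + 0 + b + Y / (1 - 0)" by (rule tendsto_lowerbound) simp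
  then show ?thesis using Yg by (simp add: g_def[abs_def])
qed

section \<open>Extended integrals and sums of measures\<close>

lemma enn2ereal_eq_real: "x \<noteq> \<infinity> \<Longrightarrow> enn2ereal x = ereal (enn2real x)"
  by (cases x) (auto simp: enn2ereal_ennreal)

lemma eint_real:
  assumes "integrable M f"
  shows "eint M (\<lambda>x. ereal (f x)) = ereal (integral\<^sup>L M f)"
proof -
  have "(\<integral>\<^sup>+ x. ennreal (f x) \<partial>M) \<noteq> \<infinity>" "(\<integral>\<^sup>+ x. ennreal (- f x) \<partial>M) \<noteq> \<infinity>"
    using assms by (auto simp: real_integrable_def)
  then show ?thesis
    unfolding eint_def real_lebesgue_integral_def[OF assms] by (simp add: enn2ereal_eq_real)
qed

text \<open>Monotone convergence is used separately for the positive parts, which decrease from a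
  finite integral, and for the negative parts, which increase. The limit of the former is finite, so
  the difference never becomes \<infinity> - \<infinity>.\<close>

lemma eint_decseq:
  fixes f :: "nat \<Rightarrow> 'a \<Rightarrow> real"
  assumes int: "\<And>n. integrable M (f n)" and dec: "\<And>n x. f (Suc n) x \<le> f n x"
    and lim: "\<And>x. g x = (INF n. ereal (f n x))"
  shows "eint M g = (INF n. ereal (integral\<^sup>L M (f n)))"
proof -
  have mono: "f k x \<le> f n x" if "n \<le> k" for n k x
    using lift_Suc_antimono_le[of "\<lambda>n. f n x", OF dec that] .
  have fm [measurable]: "f n \<in> borel_measurable M" for n using int by auto
  have fg: "(\<lambda>n. ereal (f n x)) \<longlonglongrightarrow> g x" for x
    unfolding lim by (rule LIMSEQ_INF) (use mono in \<open>auto simp: decseq_def\<close>)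
  have pos: "e2ennreal (g x) = (INF n. ennreal (f n x))" for x
  proof (rule LIMSEQ_unique)
    show "(\<lambda>n. ennreal (f n x)) \<longlonglongrightarrow> e2ennreal (g x)" using tendsto_e2ennrealI[OF fg[of x]] by simp
    show "(\<lambda>n. ennreal (f n x)) \<longlonglongrightarrow> (INF n. ennreal (f n x))"
      by (rule LIMSEQ_INF) (use mono in \<open>auto simp: decseq_def ennreal_leI\<close>)
  qed
  have neg: "e2ennreal (- g x) = (SUP n. ennreal (- f n x))" for x
  proof (rule LIMSEQ_unique)
    have "(\<lambda>n. - ereal (f n x)) \<longlonglongrightarrow> - g x" using fg[of x] by (intro tendsto_intros)
    from tendsto_e2ennrealI[OF this] show "(\<lambda>n. ennreal (- f n x)) \<longlonglongrightarrow> e2ennreal (- g x)" by simp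
    show "(\<lambda>n. ennreal (- f n x)) \<longlonglongrightarrow> (SUP n. ennreal (- f n x))"
      by (rule LIMSEQ_SUP) (use mono in \<open>auto simp: incseq_def ennreal_leI\<close>)
  qed
  define p where "p n = (\<integral>\<^sup>+ x. ennreal (f n x) \<partial>M)" for n
  define q where "q n = (\<integral>\<^sup>+ x. ennreal (- f n x) \<partial>M)" for n
  have fin: "p n \<noteq> \<infinity>" "q n \<noteq> \<infinity>" for n
    unfolding p_def q_def using int[of n] by (auto simp: real_integrable_def)
  have P: "(\<integral>\<^sup>+ x. e2ennreal (g x) \<partial>M) = (INF n. p n)"
    unfolding pos p_def
  proof (rule nn_integral_monotone_convergence_INF_decseq[where i = 0])
    show "decseq (\<lambda>n x. ennreal (f n x))" by (intro decseq_SucI le_funI ennreal_leI dec)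
    show "(\<integral>\<^sup>+ x. ennreal (f 0 x) \<partial>M) < \<infinity>" using fin(1)[of 0] by (simp add: p_def less_top)
  qed simp
  have N: "(\<integral>\<^sup>+ x. e2ennreal (- g x) \<partial>M) = (SUP n. q n)"
    unfolding neg q_def
  proof (rule nn_integral_monotone_convergence_SUP)
    show "incseq (\<lambda>n x. ennreal (- f n x))" by (intro incseq_SucI le_funI ennreal_leI) (simp add: dec)
  qed simp
  have pl: "p \<longlonglongrightarrow> (INF n. p n)"
    by (rule LIMSEQ_INF) (auto simp: decseq_def p_def intro!: nn_integral_mono ennreal_leI mono)
  have ql: "q \<longlonglongrightarrow> (SUP n. q n)"
    by (rule LIMSEQ_SUP) (auto simp: incseq_def q_def intro!: nn_integral_mono ennreal_leI mono)
  have "(INF n. p n) \<le> p 0" by (rule INF_lower) simp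
  then have Pf: "(INF n. p n) \<noteq> \<infinity>" using fin(1)[of 0] by (metis neq_top_trans infinity_ennreal_def)
  have "(\<lambda>n. enn2ereal (p n) - enn2ereal (q n)) \<longlonglongrightarrow> enn2ereal (INF n. p n) - enn2ereal (SUP n. q n)"
  proof (rule tendsto_diff_ereal_general)
    show "(\<lambda>n. enn2ereal (p n)) \<longlonglongrightarrow> enn2ereal (INF n. p n)" by (rule tendsto_enn2erealI[OF pl])
    show "(\<lambda>n. enn2ereal (q n)) \<longlonglongrightarrow> enn2ereal (SUP n. q n)" by (rule tendsto_enn2erealI[OF ql])
    have "enn2ereal (INF n. p n) = ereal (enn2real (INF n. p n))" using Pf by (rule enn2ereal_eq_real)
    then show "\<not> (enn2ereal (INF n. p n) = \<infinity> \<and> enn2ereal (SUP n. q n) = \<infinity> \<or>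
       enn2ereal (INF n. p n) = - \<infinity> \<and> enn2ereal (SUP n. q n) = - \<infinity>)" by (simp only: ereal.distinct) simp
  qed
  moreover have "enn2ereal (p n) - enn2ereal (q n) = ereal (integral\<^sup>L M (f n))" for n
    using eint_real[OF int[of n]] by (simp add: eint_def p_def q_def)
  ultimately have "(\<lambda>n. ereal (integral\<^sup>L M (f n))) \<longlonglongrightarrow> eint M g"
    by (simp add: eint_def P N)
  moreover have "(\<lambda>n. ereal (integral\<^sup>L M (f n))) \<longlonglongrightarrow> (INF n. ereal (integral\<^sup>L M (f n)))"
    by (rule LIMSEQ_INF) (auto simp: decseq_def intro!: integral_mono int mono)
  ultimately show ?thesis by (rule LIMSEQ_unique)
qed

lemma elog_INF:
  assumes "0 \<le> x"
  shows "elog x = (INF n. ereal (ln (max (1 / Suc n) x)))"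
proof (cases "x = 0")
  case True
  have "(INF n. ereal (ln (max (1 / Suc n) x))) = -\<infinity>"
  proof (rule ereal_bot)
    fix B :: real
    obtain n :: nat where n: "1 / Suc n < exp B" using nat_approx_posE[of "exp B"] by auto
    have "(INF n. ereal (ln (max (1 / Suc n) x))) \<le> ereal (ln (max (1 / Suc n) x))" by (rule INF_lower) simp
    also have "max (1 / Suc n) x = 1 / Suc n" using True by simp
    also have "ln (1 / Suc n) \<le> B" using n by (metis exp_gt_zero less_imp_le ln_exp ln_le_cancel_iff of_nat_0_less_iff zero_less_Suc zero_less_divide_1_iff)
    finally show "(INF n. ereal (ln (max (1 / Suc n) x))) \<le> ereal B" by simp
  qed
  then show ?thesis using True by (simp add: elog_def)
next
  case False
  then have x: "0 < x" using assms by simp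
  show ?thesis
  proof (rule antisym)
    show "elog x \<le> (INF n. ereal (ln (max (1 / Suc n) x)))"
      using x by (intro INF_greatest) (auto simp: elog_def)
    obtain n :: nat where "1 / Suc n < x" using nat_approx_posE[OF x] by auto
    then have "ereal (ln (max (1 / Suc n) x)) = elog x" using x by (simp add: elog_def)
    moreover have "(INF n. ereal (ln (max (1 / Suc n) x))) \<le> ereal (ln (max (1 / Suc n) x))"
      by (rule INF_lower) simp
    ultimately show "(INF n. ereal (ln (max (1 / Suc n) x))) \<le> elog x" by simp
  qed
qed

context compact_carried begin

lemma eint_elog:
  fixes h :: "complex \<Rightarrow> real"
  assumes h: "\<And>z. 0 \<le> h z" and c: "\<And>n. continuous_on UNIV (\<lambda>z. ln (max (1 / Suc n) (h z)))"
  shows "eint M (\<lambda>z. elog (h z)) = (INF n. ereal (\<integral>z. ln (max (1 / Suc n) (h z)) \<partial>M))"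
proof (rule eint_decseq)
  show "integrable M (\<lambda>z. ln (max (1 / Suc n) (h z)))" for n by (rule integrable_cont[OF c])
  show "ln (max (1 / Suc (Suc n)) (h x)) \<le> ln (max (1 / Suc n) (h x))" for n x
    by (rule ln_max_mono) (simp_all add: frac_le)
  show "elog (h x) = (INF n. ereal (ln (max (1 / Suc n) (h x))))" for x by (rule elog_INF[OF h])
qed

lemma logpot_INF: "logpot M z = (INF n. ereal (rpot (1 / Suc n) M z))"
proof -
  have "continuous_on UNIV (\<lambda>t. ln (max (1 / Suc n) (cmod (z - t))))" for n
    by (intro continuous_on_trunc_log continuous_on_diff continuous_on_const continuous_on_id) simp
  then show ?thesis
    unfolding logpot_def rpot_def by (intro eint_elog[of "\<lambda>t. cmod (z - t)"] norm_ge_zero)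
qed

lemma logpot_tendsto: "(\<lambda>n. ereal (rpot (1 / Suc n) M z)) \<longlonglongrightarrow> logpot M z"
  unfolding logpot_INF
  by (rule LIMSEQ_INF, rule decseq_SucI, subst ereal_less_eq, rule rpot_mono) (simp_all add: frac_le)

lemma logpot_le_rpot:
  assumes "0 < r"
  shows "logpot M z \<le> ereal (rpot r M z)"
proof -
  obtain n :: nat where n: "1 / Suc n < r" using nat_approx_posE[OF assms] by auto
  have "logpot M z \<le> ereal (rpot (1 / Suc n) M z)" unfolding logpot_INF by (rule INF_lower) simp
  also have "\<dots> \<le> ereal (rpot r M z)" using rpot_mono[of "1 / Suc n" r z] n by simp
  finally show ?thesis .
qed

lemma logpot_finite: "logpot M z \<noteq> \<infinity>"
  using logpot_le_rpot[of 1 z] by auto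

lemma logpot_less_obtain:
  assumes "logpot M z < ereal x"
  obtains r where "0 < r" "rpot r M z < x"
proof -
  obtain n where "rpot (1 / Suc n) M z < x"
    using assms unfolding logpot_INF INF_less_iff by auto
  then show ?thesis by (intro that[of "1 / Suc n"]) auto
qed

lemma energy_INF: "eint M (logpot M) = (INF n. ereal (\<integral>z. rpot (1 / Suc n) M z \<partial>M))"
proof (rule eint_decseq)
  show "integrable M (rpot (1 / Suc n) M)" for n by (rule integrable_cont[OF rpot_cont]) simp
  show "rpot (1 / Suc (Suc n)) M x \<le> rpot (1 / Suc n) M x" for n x by (rule rpot_mono) (simp_all add: frac_le)
qed (rule logpot_INF)

end

lemma tendsto_sum_ereal:
  fixes f :: "'b \<Rightarrow> 'a \<Rightarrow> ereal"
  assumes "finite J" "\<And>j. j \<in> J \<Longrightarrow> (f j \<longlongrightarrow> l j) G" "\<And>j. j \<in> J \<Longrightarrow> l j \<noteq> \<infinity>"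
  shows "((\<lambda>x. \<Sum>j\<in>J. f j x) \<longlongrightarrow> (\<Sum>j\<in>J. l j)) G"
  using assms
proof (induction J rule: finite_induct)
  case (insert j J)
  have fin: "(\<Sum>j\<in>J. l j) \<noteq> \<infinity>" using insert.prems(2) by (simp add: sum_Pinfty)
  have lj: "l j \<noteq> \<infinity>" by (rule insert.prems(2)) simp
  have IH: "((\<lambda>x. \<Sum>j\<in>J. f j x) \<longlongrightarrow> (\<Sum>j\<in>J. l j)) G"
    by (rule insert.IH) (rule insert.prems, simp)+
  have "((\<lambda>x. f j x + (\<Sum>j\<in>J. f j x)) \<longlongrightarrow> l j + (\<Sum>j\<in>J. l j)) G"
    by (rule tendsto_add_ereal_general[OF _ _ IH]) (use fin lj insert.prems(1) in simp_all)
  then show ?case using insert.hyps by simp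
qed simp

section \<open>Finite sums of measures\<close>

definition sum_measure :: "nat \<Rightarrow> (nat \<Rightarrow> complex measure) \<Rightarrow> complex measure" where
  "sum_measure m M = measure_of UNIV (sets borel) (\<lambda>A. \<Sum>j<m. emeasure (M j) A)"

lemma sets_sum_measure [simp, measurable_cong]: "sets (sum_measure m M) = sets borel"
  unfolding sum_measure_def using sets.sigma_sets_eq[of borel] by (subst sets_measure_of) auto

lemma space_sum_measure [simp]: "space (sum_measure m M) = UNIV"
  using sets_eq_imp_space_eq[OF sets_sum_measure] by simp

lemma emeasure_sum_measure:
  assumes "\<And>j. j < m \<Longrightarrow> sets (M j) = sets borel" "A \<in> sets borel"
  shows "emeasure (sum_measure m M) A = (\<Sum>j<m. emeasure (M j) A)"
proof (rule emeasure_measure_of[OF sum_measure_def])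
  show "countably_additive (sets (sum_measure m M)) (\<lambda>A. \<Sum>j<m. emeasure (M j) A)"
  proof (rule countably_additiveI)
    fix A :: "nat \<Rightarrow> complex set"
    assume A: "range A \<subseteq> sets (sum_measure m M)" "disjoint_family A"
    have "(\<Sum>i. \<Sum>j<m. emeasure (M j) (A i)) = (\<Sum>j<m. \<Sum>i. emeasure (M j) (A i))"
      by (rule suminf_sum) (rule summableI)
    also have "\<dots> = (\<Sum>j<m. emeasure (M j) (\<Union>i. A i))"
      by (intro sum.cong refl suminf_emeasure A(2)) (use A(1) assms(1) in auto)
    finally show "(\<Sum>i. \<Sum>j<m. emeasure (M j) (A i)) = (\<Sum>j<m. emeasure (M j) (\<Union>i. A i))" .
  qed
qed (use assms(2) in \<open>auto simp: positive_def\<close>)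

lemma nn_integral_sum_measure:
  assumes M: "\<And>j. j < m \<Longrightarrow> sets (M j) = sets borel" and f: "f \<in> borel_measurable borel"
  shows "(\<integral>\<^sup>+x. f x \<partial>sum_measure m M) = (\<Sum>j<m. \<integral>\<^sup>+x. f x \<partial>M j)"
  using f
proof (induction f rule: borel_measurable_induct)
  case (cong f g)
  then show ?case by (simp cong: nn_integral_cong)
next
  case (set A)
  then show ?case using M by (simp add: emeasure_sum_measure[OF M])
next
  case (mult u c)
  have "(\<integral>\<^sup>+x. c * u x \<partial>M j) = c * (\<integral>\<^sup>+x. u x \<partial>M j)" if "j < m" for j
    by (rule nn_integral_cmult) (use mult(2) in \<open>simp add: measurable_cong_sets[OF M[OF that] refl]\<close>)
  then show ?case using mult
    by (subst nn_integral_cmult) (auto simp: sum_distrib_left measurable_cong_sets[OF sets_sum_measure refl])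
next
  case (add u v)
  have "(\<integral>\<^sup>+x. v x + u x \<partial>M j) = (\<integral>\<^sup>+x. v x \<partial>M j) + (\<integral>\<^sup>+x. u x \<partial>M j)" if "j < m" for j
    by (rule nn_integral_add) (use add in \<open>auto simp: measurable_cong_sets[OF M[OF that] refl]\<close>)
  then show ?case using add
    by (subst nn_integral_add) (auto simp: sum.distrib measurable_cong_sets[OF sets_sum_measure refl])
next
  case (seq U)
  have "(\<integral>\<^sup>+x. (SUP i. U i) x \<partial>M j) = (SUP i. \<integral>\<^sup>+x. U i x \<partial>M j)" if "j < m" for j
    unfolding SUP_apply
    by (rule nn_integral_monotone_convergence_SUP) (use seq in \<open>auto simp: measurable_cong_sets[OF M[OF that] refl]\<close>)
  then have "(\<Sum>j<m. \<integral>\<^sup>+x. (SUP i. U i) x \<partial>M j) = (\<Sum>j<m. SUP i. \<integral>\<^sup>+x. U i x \<partial>M j)" by (intro sum.cong) auto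
  also have "\<dots> = (SUP i. \<Sum>j<m. \<integral>\<^sup>+x. U i x \<partial>M j)"
    by (rule ennreal_SUP_sum[symmetric]) (use seq(3) in \<open>auto simp: incseq_def le_fun_def intro!: nn_integral_mono\<close>)
  also have "\<dots> = (SUP i. \<integral>\<^sup>+x. U i x \<partial>sum_measure m M)" using seq by simp
  also have "\<dots> = (\<integral>\<^sup>+x. (SUP i. U i) x \<partial>sum_measure m M)"
    unfolding SUP_apply
    by (rule nn_integral_monotone_convergence_SUP[symmetric])
       (use seq in \<open>auto simp: measurable_cong_sets[OF sets_sum_measure refl]\<close>)
  finally show ?case by simp
qed

lemma compact_carried_sum_measure:
  assumes "\<And>j. j < m \<Longrightarrow> compact_carried (M j) (C j)"
  shows "compact_carried (sum_measure m M) (\<Union>j<m. C j)"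
proof (intro compact_carried.intro compact_carried_axioms.intro finite_measureI)
  have s: "sets (M j) = sets borel" if "j < m" for j
    using assms[OF that] by (simp add: compact_carried_def compact_carried_axioms_def)
  have fin: "emeasure (M j) A \<noteq> \<infinity>" if "j < m" for j A
  proof -
    interpret compact_carried "M j" "C j" by (rule assms[OF that])
    show ?thesis by (simp add: emeasure_eq_measure)
  qed
  have null: "emeasure (M j) (UNIV - C j) = 0" "compact (C j)" if "j < m" for j
    using assms[OF that] by (auto simp: compact_carried_def compact_carried_axioms_def)
  show "emeasure (sum_measure m M) (space (sum_measure m M)) \<noteq> \<infinity>"
    using fin by (auto simp: emeasure_sum_measure[OF s])
  show "sets (sum_measure m M) = sets borel" by simp
  show cC: "compact (\<Union>j<m. C j)" using null by (intro compact_UN) auto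
  have b: "UNIV - (\<Union>j<m. C j) \<in> sets borel" using borel_compact[OF cC] by auto
  have "emeasure (M j) (UNIV - (\<Union>j<m. C j)) = 0" if "j < m" for j
  proof -
    have "emeasure (M j) (UNIV - (\<Union>j<m. C j)) \<le> emeasure (M j) (UNIV - C j)"
      by (rule emeasure_mono) (use that borel_compact[OF null(2)[OF that]] s[OF that] in auto)
    then show ?thesis using null[OF that] by simp
  qed
  then show "emeasure (sum_measure m M) (UNIV - (\<Union>j<m. C j)) = 0"
    by (simp add: emeasure_sum_measure[OF s b])
qed

lemma integral_sum_measure:
  fixes g :: "complex \<Rightarrow> real"
  assumes cc: "\<And>j. j < m \<Longrightarrow> compact_carried (M j) (C j)" and g: "continuous_on UNIV g"
  shows "integral\<^sup>L (sum_measure m M) g = (\<Sum>j<m. integral\<^sup>L (M j) g)"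
proof -
  interpret S: compact_carried "sum_measure m M" "\<Union>j<m. C j" by (rule compact_carried_sum_measure[OF cc])
  have s: "sets (M j) = sets borel" if "j < m" for j
    using cc[OF that] by (simp add: compact_carried_def compact_carried_axioms_def)
  have gm [measurable]: "g \<in> borel_measurable borel" by (rule borel_measurable_continuous_onI[OF g])
  have gi: "integrable (M j) g" if "j < m" for j
    by (rule compact_carried.integrable_cont[OF cc[OF that] g])
  have fin: "(\<integral>\<^sup>+x. ennreal (g x) \<partial>M j) \<noteq> \<infinity>" "(\<integral>\<^sup>+x. ennreal (- g x) \<partial>M j) \<noteq> \<infinity>" if "j < m" for j
    using gi[OF that] by (auto simp: real_integrable_def)
  have 1: "(\<integral>\<^sup>+x. ennreal (g x) \<partial>sum_measure m M) = (\<Sum>j<m. \<integral>\<^sup>+x. ennreal (g x) \<partial>M j)"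
    by (rule nn_integral_sum_measure[OF s]) auto
  have 2: "(\<integral>\<^sup>+x. ennreal (- g x) \<partial>sum_measure m M) = (\<Sum>j<m. \<integral>\<^sup>+x. ennreal (- g x) \<partial>M j)"
    by (rule nn_integral_sum_measure[OF s]) auto
  have "integral\<^sup>L (sum_measure m M) g = enn2real (\<Sum>j<m. \<integral>\<^sup>+x. ennreal (g x) \<partial>M j) - enn2real (\<Sum>j<m. \<integral>\<^sup>+x. ennreal (- g x) \<partial>M j)"
    unfolding real_lebesgue_integral_def[OF S.integrable_cont[OF g]] 1 2 ..
  also have "enn2real (\<Sum>j<m. \<integral>\<^sup>+x. ennreal (g x) \<partial>M j) = (\<Sum>j<m. enn2real (\<integral>\<^sup>+x. ennreal (g x) \<partial>M j))"
    by (subst enn2real_sum) (use fin in \<open>auto simp: less_top o_def\<close>)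
  also have "enn2real (\<Sum>j<m. \<integral>\<^sup>+x. ennreal (- g x) \<partial>M j) = (\<Sum>j<m. enn2real (\<integral>\<^sup>+x. ennreal (- g x) \<partial>M j))"
    by (subst enn2real_sum) (use fin in \<open>auto simp: less_top o_def\<close>)
  also have "(\<Sum>j<m. enn2real (\<integral>\<^sup>+x. ennreal (g x) \<partial>M j)) - (\<Sum>j<m. enn2real (\<integral>\<^sup>+x. ennreal (- g x) \<partial>M j))
     = (\<Sum>j<m. integral\<^sup>L (M j) g)"
    unfolding sum_subtractf[symmetric] by (intro sum.cong refl real_lebesgue_integral_def[symmetric] gi) auto
  finally show ?thesis .
qed

section \<open>A space-filling curve\<close>

text \<open>Schoenberg's function: even and of period 2, equal to 0 within 1/3 of the even integers,
  to 1 at distance at least 2/3 from them, and linear in between. Writing it through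
  \<open>infdist\<close> yields continuity at once.\<close>

definition zigzag :: "real \<Rightarrow> real" where
  "zigzag t = max 0 (min 1 (3 * infdist t (range (\<lambda>k::int. 2 * of_int k)) - 1))"

lemma zigzag_bounds: "0 \<le> zigzag t" "zigzag t \<le> 1"
  by (auto simp: zigzag_def)

lemma continuous_on_zigzag: "continuous_on A zigzag"
  unfolding zigzag_def by (intro continuous_intros)

lemma infdist_even_integers:
  assumes "0 \<le> y" "y \<le> 1"
  shows "infdist (2 * of_int k + y) (range (\<lambda>k::int. 2 * real_of_int k)) = y"
proof (rule antisym)
  have "infdist (2 * of_int k + y) (range (\<lambda>k::int. 2 * real_of_int k)) \<le> dist (2 * of_int k + y) (2 * real_of_int k)"
    by (rule infdist_le) auto
  then show "infdist (2 * of_int k + y) (range (\<lambda>k::int. 2 * real_of_int k)) \<le> y"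
    using assms by (simp add: dist_real_def)
  have "y \<le> dist (2 * of_int k + y) (2 * real_of_int j)" for j
  proof -
    have "j \<le> k - 1 \<or> j = k \<or> k + 1 \<le> j" by linarith
    then have "real_of_int j \<le> real_of_int k - 1 \<or> j = k \<or> real_of_int k + 1 \<le> real_of_int j"
      by (metis of_int_1 of_int_add of_int_diff of_int_le_iff)
    then show ?thesis using assms by (auto simp: dist_real_def)
  qed
  then show "y \<le> infdist (2 * of_int k + y) (range (\<lambda>k::int. 2 * real_of_int k))"
    unfolding infdist_def by (auto intro!: cINF_greatest)
qed

lemma zigzag_0: "0 \<le> y \<Longrightarrow> y \<le> 1/3 \<Longrightarrow> zigzag (2 * of_int k + y) = 0"
  unfolding zigzag_def by (subst infdist_even_integers) auto

lemma zigzag_1: "2/3 \<le> y \<Longrightarrow> y \<le> 1 \<Longrightarrow> zigzag (2 * of_int k + y) = 1"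
  unfolding zigzag_def by (subst infdist_even_integers) auto

text \<open>The partial sums collapse to floor(2^n x) / 2^n; the restriction x < 1 makes the integer
  part, with which the induction starts, vanish.\<close>

lemma binary_digits:
  fixes x :: real
  assumes "0 \<le> x" "x < 1"
  obtains a :: "nat \<Rightarrow> int" where "\<And>n. a n \<in> {0, 1}" "(\<lambda>n. (1/2) ^ Suc n * real_of_int (a n)) sums x"
proof -
  define a where "a n = \<lfloor>2 ^ Suc n * x\<rfloor> mod 2" for n
  have ps: "(\<Sum>k<n. (1/2) ^ Suc k * real_of_int (a k)) = of_int \<lfloor>2 ^ n * x\<rfloor> / 2 ^ n" for n
  proof (induction n)
    case 0
    have "\<lfloor>x\<rfloor> = 0" using assms by linarith
    then show ?case by simp
  next
    case (Suc n)
    have "\<lfloor>2 ^ Suc n * x / real_of_int 2\<rfloor> = \<lfloor>2 ^ Suc n * x\<rfloor> div 2" by (rule floor_divide_real_eq_div) simp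
    then have d: "\<lfloor>2 ^ Suc n * x\<rfloor> div 2 = \<lfloor>2 ^ n * x\<rfloor>" by simp
    have "\<lfloor>2 ^ Suc n * x\<rfloor> = 2 * \<lfloor>2 ^ n * x\<rfloor> + a n"
      using mult_div_mod_eq[of 2 "\<lfloor>2 ^ Suc n * x\<rfloor>"] unfolding d a_def by simp
    then have "real_of_int \<lfloor>2 ^ Suc n * x\<rfloor> = 2 * of_int \<lfloor>2 ^ n * x\<rfloor> + of_int (a n)"
      by (metis of_int_add of_int_mult of_int_numeral)
    then show ?case using Suc.IH by (simp add: field_simps power_divide)
  qed
  have "(\<lambda>n. of_int \<lfloor>2 ^ n * x\<rfloor> / 2 ^ n) \<longlonglongrightarrow> x"
  proof (rule tendsto_sandwich)
    show "\<forall>\<^sub>F n in sequentially. x - (1/2) ^ n \<le> of_int \<lfloor>2 ^ n * x\<rfloor> / 2 ^ n"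
    proof (rule always_eventually, rule allI)
      fix n :: nat
      have "2 ^ n * x - 1 \<le> real_of_int \<lfloor>2 ^ n * x\<rfloor>" by linarith
      then have "(2 ^ n * x - 1) / 2 ^ n \<le> of_int \<lfloor>2 ^ n * x\<rfloor> / 2 ^ n" by (intro divide_right_mono) auto
      also have "(2 ^ n * x - 1) / 2 ^ n = x - (1/2) ^ n" by (simp add: diff_divide_distrib power_divide)
      finally show "x - (1/2) ^ n \<le> of_int \<lfloor>2 ^ n * x\<rfloor> / 2 ^ n" .
    qed
    show "\<forall>\<^sub>F n in sequentially. of_int \<lfloor>2 ^ n * x\<rfloor> / 2 ^ n \<le> x"
    proof (rule always_eventually, rule allI)
      fix n :: nat
      have "real_of_int \<lfloor>2 ^ n * x\<rfloor> \<le> 2 ^ n * x" by linarith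
      then show "of_int \<lfloor>2 ^ n * x\<rfloor> / 2 ^ n \<le> x" by (simp add: field_simps)
    qed
    have "(\<lambda>n. x - (1/2) ^ n) \<longlonglongrightarrow> x - 0" by (intro tendsto_intros LIMSEQ_power_zero) simp
    then show "(\<lambda>n. x - (1/2) ^ n) \<longlonglongrightarrow> x" by simp
  qed simp
  then have "(\<lambda>n. (1/2) ^ Suc n * real_of_int (a n)) sums x" unfolding sums_def ps .
  moreover have "a n \<in> {0, 1}" for n
    using pos_mod_bound[of 2 "\<lfloor>2 ^ Suc n * x\<rfloor>"] pos_mod_sign[of 2 "\<lfloor>2 ^ Suc n * x\<rfloor>"] unfolding a_def by auto
  ultimately show ?thesis using that by blast
qed

text \<open>Schoenberg's argument: for \<open>t = 2 \<Sum> b\<^sub>j / 3\<^sup>j\<^sup>+\<^sup>1\<close> with binary digits \<open>b\<^sub>j\<close>, the value of the zigzag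
  function at \<open>3\<^sup>k t\<close> reads off \<open>b\<^sub>k\<close>.\<close>

lemma zigzag_reads_digits:
  fixes b :: "nat \<Rightarrow> int"
  assumes b: "\<And>n. b n \<in> {0, 1}"
  obtains t where "0 \<le> t" "t \<le> 1" "\<And>k. zigzag (3 ^ k * t) = b k"
proof -
  define f where "f j = 2 * real_of_int (b j) * (1/3) ^ Suc j" for j
  define t where "t = suminf f"
  have b01: "0 \<le> real_of_int (b j)" "real_of_int (b j) \<le> 1" for j using b[of j] by auto
  have gs: "(\<lambda>j. 2 * (1/3::real) ^ Suc j * (1/3) ^ k) sums (1/3) ^ k" for k
  proof -
    have "(\<lambda>j. (2/3 * (1/3) ^ k) * (1/3::real) ^ j) sums ((2/3 * (1/3) ^ k) * (1 / (1 - 1/3)))"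
      by (intro sums_mult geometric_sums) simp
    then show ?thesis by (simp add: mult_ac)
  qed
  have fsum: "summable f"
    by (rule summable_comparison_test[OF _ sums_summable[OF gs[of 0]]])
       (use b01 in \<open>auto intro!: exI[of _ 0] simp: f_def\<close>)
  have tail: "0 \<le> (\<Sum>j. f (j + k))" "(\<Sum>j. f (j + k)) \<le> (1/3) ^ k" for k
  proof -
    have s: "summable (\<lambda>j. f (j + k))" using fsum by (rule summable_ignore_initial_segment)
    show "0 \<le> (\<Sum>j. f (j + k))" by (rule suminf_nonneg[OF s]) (use b01 in \<open>simp add: f_def\<close>)
    have "(\<Sum>j. f (j + k)) \<le> (\<Sum>j. 2 * (1/3::real) ^ Suc j * (1/3) ^ k)"
      by (rule suminf_le[OF _ s sums_summable[OF gs]]) (use b01 in \<open>auto simp: f_def power_add mult_ac\<close>)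
    also have "\<dots> = (1/3) ^ k" using gs by (rule sums_unique[symmetric])
    finally show "(\<Sum>j. f (j + k)) \<le> (1/3) ^ k" .
  qed
  show ?thesis
  proof
    show "0 \<le> t" "t \<le> 1" using tail[of 0] by (auto simp: t_def)
    fix k
    have "t = (\<Sum>j. f (j + Suc k)) + (\<Sum>i<Suc k. f i)"
      unfolding t_def by (rule suminf_split_initial_segment[OF fsum])
    then have "3 ^ k * t = 3 ^ k * (\<Sum>j. f (j + Suc k)) + 3 ^ k * f k + 3 ^ k * (\<Sum>i<k. f i)"
      by (simp add: distrib_left)
    also have "3 ^ k * (\<Sum>i<k. f i) = (\<Sum>i<k. 3 ^ k * f i)" by (rule sum_distrib_left)
    also have "3 ^ k * f k = 2/3 * b k" by (simp add: f_def power_divide)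
    also have "(\<Sum>i<k. 3 ^ k * f i) = 2 * of_int (\<Sum>i<k. b i * 3 ^ (k - Suc i))"
    proof -
      have "3 ^ k * f i = 2 * (b i * 3 ^ (k - Suc i))" if "i < k" for i
      proof -
        have "(3::real) ^ k = 3 ^ (k - Suc i) * 3 ^ Suc i" using that by (metis Suc_leI le_add_diff_inverse2 power_add)
        then show ?thesis by (simp add: f_def power_divide)
      qed
      then show ?thesis by (simp add: sum_distrib_left)
    qed
    \<comment> \<open>The earlier digits contribute an even integer, which the period ignores. The
      term 2/3 * b k selects the plateau, and the tail, at most 1/3, does not leave it.\<close>
    finally have e: "3 ^ k * t = 2 * of_int (\<Sum>i<k. b i * 3 ^ (k - Suc i)) + (2/3 * b k + 3 ^ k * (\<Sum>j. f (j + Suc k)))" by simp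
    have r: "0 \<le> 3 ^ k * (\<Sum>j. f (j + Suc k))" "3 ^ k * (\<Sum>j. f (j + Suc k)) \<le> 1/3"
    proof -
      show "0 \<le> 3 ^ k * (\<Sum>j. f (j + Suc k))" using tail(1)[of "Suc k"] by simp
      have "3 ^ k * (\<Sum>j. f (j + Suc k)) \<le> 3 ^ k * (1/3) ^ Suc k" using tail(2)[of "Suc k"] by (intro mult_left_mono) auto
      then show "3 ^ k * (\<Sum>j. f (j + Suc k)) \<le> 1/3" by (simp add: power_divide)
    qed
    show "zigzag (3 ^ k * t) = b k"
      unfolding e using b[of k] r by (auto simp del: of_int_sum of_int_mult intro!: zigzag_0 zigzag_1)
  qed
qed

text \<open>A coordinate of Schoenberg's curve: i = 0 collects the digits at even positions, i = 1
  those at odd positions.\<close>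

definition zigzag_series :: "nat \<Rightarrow> real \<Rightarrow> real" where
  "zigzag_series i t = (\<Sum>n. (1/2) ^ Suc n * zigzag (3 ^ (2 * n + i) * t))"

lemma zigzag_series_bounds:
  "continuous_on UNIV (zigzag_series i)" "0 \<le> zigzag_series i t" "zigzag_series i t \<le> 1"
proof -
  have hs: "(\<lambda>n. (1/2::real) ^ Suc n) sums 1" by (rule power_half_series)
  have b: "0 \<le> (1/2) ^ Suc n * zigzag (3 ^ (2 * n + i) * t)" "(1/2) ^ Suc n * zigzag (3 ^ (2 * n + i) * t) \<le> (1/2) ^ Suc n" for n t
    using zigzag_bounds[of "3 ^ (2 * n + i) * t"] mult_left_le[of "zigzag (3 ^ (2 * n + i) * t)" "(1/2) ^ Suc n"] by auto
  have su: "summable (\<lambda>n. (1/2) ^ Suc n * zigzag (3 ^ (2 * n + i) * t))" for t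
    by (rule summable_comparison_test[OF _ sums_summable[OF hs]])
       (intro exI[of _ 0] allI impI, use b in \<open>simp only: real_norm_def abs_of_nonneg\<close>)
  show "0 \<le> zigzag_series i t" unfolding zigzag_series_def by (rule suminf_nonneg[OF su b(1)])
  have "zigzag_series i t \<le> (\<Sum>n. (1/2::real) ^ Suc n)"
    unfolding zigzag_series_def by (rule suminf_le[OF b(2) su sums_summable[OF hs]])
  also have "\<dots> = 1" using hs by (rule sums_unique[symmetric])
  finally show "zigzag_series i t \<le> 1" .
  have "uniform_limit UNIV (\<lambda>n t. \<Sum>k<n. (1/2) ^ Suc k * zigzag (3 ^ (2 * k + i) * t)) (zigzag_series i) sequentially"
    unfolding zigzag_series_def[abs_def]
  proof (rule Weierstrass_m_test_ev[OF _ sums_summable[OF hs]], intro always_eventually allI ballI)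
    show "norm ((1/2) ^ Suc n * zigzag (3 ^ (2 * n + i) * t)) \<le> (1/2) ^ Suc n" for n t
      using b[of n t] by (simp only: real_norm_def abs_of_nonneg)
  qed
  moreover have zc: "continuous_on UNIV (\<lambda>t. zigzag (c * t))" for c
    by (rule continuous_on_compose2[OF continuous_on_zigzag[of UNIV]]) (auto intro!: continuous_intros)
  have "continuous_on UNIV (\<lambda>t. \<Sum>k<n. (1/2) ^ Suc k * zigzag (3 ^ (2 * k + i) * t))" for n
    by (intro continuous_on_sum continuous_on_mult continuous_on_const zc)
  ultimately show "continuous_on UNIV (zigzag_series i)"
    by (intro uniform_limit_theorem[rotated]) (auto intro!: always_eventually)
qed

lemma space_filling_curve:
  obtains g :: "real \<Rightarrow> complex" where "continuous_on UNIV g" "bounded (range g)"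
    "\<And>z. 0 \<le> Re z \<Longrightarrow> Re z < 1 \<Longrightarrow> 0 \<le> Im z \<Longrightarrow> Im z < 1 \<Longrightarrow> \<exists>t\<in>{0..1}. g t = z"
proof -
  define g where "g t = Complex (zigzag_series 0 t) (zigzag_series 1 t)" for t
  show ?thesis
  proof
    have "g = (\<lambda>t. of_real (zigzag_series 0 t) + \<i> * of_real (zigzag_series 1 t))"
      by (auto simp: g_def complex_eq_iff fun_eq_iff)
    then show "continuous_on UNIV g" by (auto intro!: continuous_intros zigzag_series_bounds(1))
    have "cmod (g t) \<le> 2" for t
      using cmod_le[of "g t"] zigzag_series_bounds(2,3)[of 0 t] zigzag_series_bounds(2,3)[of 1 t] by (simp add: g_def)
    then show "bounded (range g)" by (auto simp: bounded_iff)
    fix z assume z: "0 \<le> Re z" "Re z < 1" "0 \<le> Im z" "Im z < 1"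
    obtain a1 where a1: "\<And>n. a1 n \<in> {0, 1}" "(\<lambda>n. (1/2) ^ Suc n * real_of_int (a1 n)) sums Re z"
      using binary_digits[OF z(1,2)] by blast
    obtain a2 where a2: "\<And>n. a2 n \<in> {0, 1}" "(\<lambda>n. (1/2) ^ Suc n * real_of_int (a2 n)) sums Im z"
      using binary_digits[OF z(3,4)] by blast
    \<comment> \<open>Interleaving the binary digits of the two coordinates.\<close>
    define b where "b n = (if even n then a1 (n div 2) else a2 (n div 2))" for n
    have "b n \<in> {0, 1}" for n unfolding b_def using a1(1) a2(1) by presburger
    then obtain t where t: "0 \<le> t" "t \<le> 1" "\<And>k. zigzag (3 ^ k * t) = b k"
      using zigzag_reads_digits[of b] by blast
    have b01: "b (2 * n + 0) = a1 n" "b (2 * n + 1) = a2 n" for n by (auto simp: b_def)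
    have "zigzag_series 0 t = Re z" "zigzag_series 1 t = Im z"
      unfolding zigzag_series_def t(3) b01 using a1(2) a2(2) by (auto simp: sums_iff)
    then have "g t = z" by (simp add: g_def complex_eq_iff)
    then show "\<exists>t\<in>{0..1}. g t = z" using t by auto
  qed
qed

text \<open>This lets points of \<open>K\<close> be pulled back to [0,1], where compactness of
  probability measures on the line can be used, and the limit be pushed forward again.\<close>

lemma compact_curve_cover:
  fixes K :: "complex set"
  assumes "compact K"
  obtains g :: "real \<Rightarrow> complex" where "continuous_on UNIV g" "bounded (range g)"
    "\<And>z. z \<in> K \<Longrightarrow> \<exists>t\<in>{0..1}. g t = z"
proof -
  obtain h :: "real \<Rightarrow> complex" where h: "continuous_on UNIV h" "bounded (range h)"
    "\<And>z. 0 \<le> Re z \<Longrightarrow> Re z < 1 \<Longrightarrow> 0 \<le> Im z \<Longrightarrow> Im z < 1 \<Longrightarrow> \<exists>t\<in>{0..1}. h t = z"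
    using space_filling_curve by blast
  obtain R where R: "0 < R" "\<And>z. z \<in> K \<Longrightarrow> cmod z \<le> R"
    using bounded_pos[THEN iffD1, OF compact_imp_bounded[OF assms]] by blast
  \<comment> \<open>The square [-R,R]^2 corresponds to the middle square [1/4,3/4]^2 of the unit
    square, safely inside the half-open range that the curve reaches.\<close>
  define g where "g t = of_real (4 * R) * h t - of_real (2 * R) * Complex 1 1" for t
  show ?thesis
  proof
    show "continuous_on UNIV g" unfolding g_def by (intro continuous_intros h)
    have "bounded ((\<lambda>x. of_real (4 * R) * x - of_real (2 * R) * Complex 1 1) ` range h)"
      using bounded_linear_image[OF h(2) bounded_linear_mult_right[of "of_real (4 * R)"]]
      by (auto simp: image_image intro!: bounded_minus_comp)
    then show "bounded (range g)" by (simp add: g_def image_image)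
    fix z assume "z \<in> K"
    then have n: "\<bar>Re z\<bar> \<le> R" "\<bar>Im z\<bar> \<le> R"
      using R(2) abs_Re_le_cmod[of z] abs_Im_le_cmod[of z] by force+
    define y where "y = (z + of_real (2 * R) * Complex 1 1) / of_real (4 * R)"
    have ReIm: "Re y = (Re z + 2 * R) / (4 * R)" "Im y = (Im z + 2 * R) / (4 * R)"
      by (simp_all add: y_def Re_divide_of_real Im_divide_of_real del: of_real_mult)
    have "0 \<le> Re y" "Re y < 1" "0 \<le> Im y" "Im y < 1"
      using n R(1) unfolding ReIm by (auto simp: divide_less_eq)
    then obtain t where t: "t \<in> {0..1}" "h t = y" using h(3) by blast
    have "g t = z" using t(2) R(1) by (simp add: g_def y_def)
    then show "\<exists>t\<in>{0..1}. g t = z" using t by auto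
  qed
qed

section \<open>Compact sets of zero capacity\<close>

lemma distr_compact_carried:
  assumes P: "prob_space \<Omega>" and X: "X \<in> borel_measurable \<Omega>" and R: "\<And>x. X x \<in> C" and C: "compact C"
  shows "compact_carried (distr \<Omega> borel X) C" "measure (distr \<Omega> borel X) UNIV = 1"
proof -
  interpret prob_space \<Omega> by fact
  interpret D: prob_space "distr \<Omega> borel X" by (rule prob_space_distr[OF X])
  show "measure (distr \<Omega> borel X) UNIV = 1" using D.prob_space by simp
  show "compact_carried (distr \<Omega> borel X) C"
  proof (intro compact_carried.intro compact_carried_axioms.intro)
    show "finite_measure (distr \<Omega> borel X)" by unfold_locales
    have "UNIV - C \<in> sets borel" using borel_compact[OF C] by auto
    then have "emeasure (distr \<Omega> borel X) (UNIV - C) = emeasure \<Omega> (X -` (UNIV - C) \<inter> space \<Omega>)"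
      by (rule emeasure_distr[OF X])
    also have "X -` (UNIV - C) \<inter> space \<Omega> = {}" using R by auto
    finally show "emeasure (distr \<Omega> borel X) (UNIV - C) = 0" by simp
  qed (use C in auto)
qed

text \<open>The pulled-back counting measures on [0,1] are tight. Skorohod's representation turns
  weak convergence of a subsequence into pointwise convergence of random variables, so double
  integrals of a continuous kernel converge by two applications of dominated convergence.\<close>

lemma empirical_weak_limit:
  fixes z :: "nat \<Rightarrow> complex"
  assumes K: "compact K" and z: "\<And>i. z i \<in> K"
  obtains \<sigma> s where "compact_carried \<sigma> K" "measure \<sigma> UNIV = 1" "strict_mono (s :: nat \<Rightarrow> nat)"
    "\<forall>k :: complex \<Rightarrow> complex \<Rightarrow> real. continuous_on UNIV (\<lambda>(x, y). k x y) \<longrightarrow>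
      (\<lambda>n. (\<Sum>i\<le>s n. \<Sum>j\<le>s n. k (z i) (z j)) / (real (Suc (s n)))\<^sup>2) \<longlonglongrightarrow> (\<integral>x. \<integral>y. k x y \<partial>\<sigma> \<partial>\<sigma>)"
proof -
  obtain g :: "real \<Rightarrow> complex" where g: "continuous_on UNIV g" "bounded (range g)"
    "\<And>z. z \<in> K \<Longrightarrow> \<exists>t\<in>{0..1}. g t = z" using compact_curve_cover[OF K] by blast
  have "\<forall>i. \<exists>t. t \<in> {0..1} \<and> g t = z i" using g(3)[OF z] by blast
  then obtain t where t: "\<And>i. t i \<in> {0..1}" "\<And>i. g (t i) = z i" by metis
  obtain R where R: "\<And>x. g x \<in> cball 0 R" using g(2) by (auto simp: bounded_iff)
  define U where "U n = uniform_count_measure {..n::nat}" for n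
  have Up: "prob_space (U n)" for n unfolding U_def by (rule prob_space_uniform_count_measure) auto
  have tm: "t \<in> borel_measurable (U n)" for n
    unfolding U_def by (auto simp: measurable_def sets_uniform_count_measure space_uniform_count_measure)
  define m where "m n = distr (U n) borel t" for n
  have md: "real_distribution (m n)" for n
    unfolding m_def by (rule prob_space.real_distribution_distr[OF Up tm])
  have mint: "integral\<^sup>L (m n) f = (\<Sum>i\<le>n. f (t i)) / Suc n" if "f \<in> borel_measurable borel" for f :: "real \<Rightarrow> real" and n
  proof -
    have "integral\<^sup>L (m n) f = (\<integral>i. f (t i) \<partial>U n)" unfolding m_def by (rule integral_distr[OF tm that])
    also have "\<dots> = (\<Sum>i\<le>n. f (t i)) / Suc n" unfolding U_def by (subst integral_uniform_count_measure) auto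
    finally show ?thesis .
  qed
  have "tight m"
    unfolding tight_def
  proof (intro conjI allI impI)
    show "real_distribution (m n)" for n by (rule md)
    fix \<epsilon> :: real assume \<epsilon>: "0 < \<epsilon>"
    have "measure (m n) {-1<..1} = 1" for n
    proof -
      interpret real_distribution "m n" by (rule md)
      have "measure (m n) {-1<..1} = integral\<^sup>L (m n) (indicat_real {-1<..1})" by simp
      also have "\<dots> = (\<Sum>i\<le>n. indicat_real {-1<..1} (t i)) / Suc n" by (rule mint) simp
      also have "(\<Sum>i\<le>n. indicat_real {-1<..1} (t i)) = (\<Sum>i\<le>n. 1)"
        by (rule sum.cong) (use t(1) in \<open>auto simp: indicator_def\<close>, meson atLeastAtMost_iff le_minus_one_simps(3) less_le_trans order_less_le_trans neg_less_0_iff_less zero_less_one)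
      finally show ?thesis by simp
    qed
    then show "\<exists>a b. a < b \<and> (\<forall>n. 1 - \<epsilon> < measure (m n) {a<..b})"
      using \<epsilon> by (intro exI[of _ "-1"] exI[of _ 1]) auto
  qed
  then obtain r M where r: "strict_mono (r :: nat \<Rightarrow> nat)" and M: "real_distribution M" "weak_conv_m (m \<circ> id \<circ> r) M"
    using tight_imp_convergent_subsubsequence[of m id] strict_mono_id by metis
  have md': "\<And>n. real_distribution ((m \<circ> id \<circ> r) n)" using md by simp
  from Skorohod[OF md' M(1) M(2)] obtain \<Omega> :: "real measure" and Yn :: "nat \<Rightarrow> real \<Rightarrow> real" and Y where
    sk: "prob_space \<Omega>" "\<forall>n. Yn n \<in> borel_measurable \<Omega>" "\<forall>n. distr \<Omega> borel (Yn n) = (m \<circ> id \<circ> r) n"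
      "Y \<in> measurable \<Omega> lborel" "distr \<Omega> borel Y = M" "\<forall>x\<in>space \<Omega>. (\<lambda>n. Yn n x) \<longlonglongrightarrow> Y x"
    by (elim exE conjE) (rule that)
  then have \<Omega>: "prob_space \<Omega>" and Yn: "\<And>n. Yn n \<in> borel_measurable \<Omega>" "\<And>n. distr \<Omega> borel (Yn n) = m (r n)"
    and Y: "Y \<in> borel_measurable \<Omega>" and lim: "\<And>x. x \<in> space \<Omega> \<Longrightarrow> (\<lambda>n. Yn n x) \<longlonglongrightarrow> Y x"
    by simp_all
  interpret \<Omega>: prob_space \<Omega> by fact
  define \<sigma> where "\<sigma> = distr \<Omega> borel (\<lambda>x. g (Y x))"
  have gb [measurable]: "g \<in> borel_measurable borel" by (rule borel_measurable_continuous_onI[OF g(1)])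
  have gY: "(\<lambda>x. g (Y x)) \<in> borel_measurable \<Omega>" using Y by measurable
  have sig: "compact_carried \<sigma> (cball 0 R)" "measure \<sigma> UNIV = 1"
    unfolding \<sigma>_def using distr_compact_carried[OF \<Omega> gY R] by auto
  interpret S: compact_carried \<sigma> "cball 0 R" by (rule sig)
  have conv: "(\<lambda>n. (\<Sum>i\<le>r n. \<Sum>j\<le>r n. k (z i) (z j)) / (real (Suc (r n)))\<^sup>2) \<longlonglongrightarrow> (\<integral>x. \<integral>y. k x y \<partial>\<sigma> \<partial>\<sigma>)"
    if k: "continuous_on UNIV (\<lambda>(x, y). k x y)" for k :: "complex \<Rightarrow> complex \<Rightarrow> real"
  proof -
    have "compact ((\<lambda>(x, y). k x y) ` (cball 0 R \<times> cball 0 R))"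
      by (intro compact_continuous_image continuous_on_subset[OF k] compact_Times compact_cball) auto
    then obtain B where B: "\<forall>v \<in> (\<lambda>(x, y). k x y) ` (cball 0 R \<times> cball 0 R). norm v \<le> B"
      using compact_imp_bounded bounded_iff by metis
    have kB: "\<bar>k (g x) (g y)\<bar> \<le> B" for x y using B R by (metis (mono_tags, lifting) SigmaI case_prod_conv imageI real_norm_def)
    have k1: "continuous_on UNIV (\<lambda>x. k x y)" for y
      using continuous_on_compose2[OF k, of UNIV "\<lambda>x. (x, y)"] by (simp add: continuous_on_Pair)
    have k2: "continuous_on UNIV (k x)" for x by (rule continuous_on_section[OF k])
    have k1m: "(\<lambda>x. k (g x) c) \<in> borel_measurable borel" for c
      using borel_measurable_continuous_onI[OF k1] by measurable
    have k2m: "(\<lambda>y. k c (g y)) \<in> borel_measurable borel" for c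
      using borel_measurable_continuous_onI[OF k2] by measurable
    define J where "J n x = (\<integral>y. k (g (Yn n x)) (g (Yn n y)) \<partial>\<Omega>)" for n x
    define J0 where "J0 x = (\<integral>y. k (g (Y x)) (g (Y y)) \<partial>\<Omega>)" for x
    have tend: "(\<lambda>n. k (g (Yn n x)) (g (Yn n y))) \<longlonglongrightarrow> k (g (Y x)) (g (Y y))" if "x \<in> space \<Omega>" "y \<in> space \<Omega>" for x y
    proof -
      have "(\<lambda>n. (g (Yn n x), g (Yn n y))) \<longlonglongrightarrow> (g (Y x), g (Y y))"
        by (intro tendsto_Pair continuous_on_tendsto_compose[OF g(1) lim] that) auto
      from continuous_on_tendsto_compose[OF k this] show ?thesis by simp
    qed
    have Jlim: "(\<lambda>n. J n x) \<longlonglongrightarrow> J0 x" if "x \<in> space \<Omega>" for x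
      unfolding J_def J0_def
    proof (rule integral_dominated_convergence[where w = "\<lambda>_. B"])
      show "(\<lambda>y. k (g (Y x)) (g (Y y))) \<in> borel_measurable \<Omega>" using measurable_compose[OF Y k2m] .
      show "(\<lambda>y. k (g (Yn n x)) (g (Yn n y))) \<in> borel_measurable \<Omega>" for n using measurable_compose[OF Yn(1) k2m] .
    qed (use tend that kB in auto)
    have J_eq: "J n x = (\<Sum>j\<le>r n. k (g (Yn n x)) (z j)) / Suc (r n)" for n x
    proof -
      have "J n x = integral\<^sup>L (distr \<Omega> borel (Yn n)) (\<lambda>y. k (g (Yn n x)) (g y))"
        unfolding J_def by (rule integral_distr[OF Yn(1) k2m, symmetric])
      also have "\<dots> = (\<Sum>j\<le>r n. k (g (Yn n x)) (g (t j))) / Suc (r n)" unfolding Yn(2) by (rule mint[OF k2m])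
      finally show ?thesis by (simp add: t(2))
    qed
    have Jm: "J n \<in> borel_measurable \<Omega>" for n
    proof -
      have "(\<lambda>x. k (g (Yn n x)) (z j)) \<in> borel_measurable \<Omega>" for j using measurable_compose[OF Yn(1) k1m] .
      then show ?thesis unfolding J_eq[abs_def] by measurable
    qed
    have J0m: "J0 \<in> borel_measurable \<Omega>" by (rule borel_measurable_LIMSEQ_real[OF Jlim Jm])
    have JB: "\<bar>J n x\<bar> \<le> B" for n x
    proof -
      have B0: "0 \<le> B" using kB[of 0 0] by linarith
      have "norm (J n x) \<le> (\<integral>y. norm (k (g (Yn n x)) (g (Yn n y))) \<partial>\<Omega>)" unfolding J_def by (rule integral_norm_bound)
      also have "\<dots> \<le> (\<integral>y. B \<partial>\<Omega>)"
        by (rule integral_mono')(use kB B0 in auto)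
      finally show ?thesis by (simp add: \<Omega>.prob_space)
    qed
    have "(\<lambda>n. integral\<^sup>L \<Omega> (J n)) \<longlonglongrightarrow> integral\<^sup>L \<Omega> J0"
      by (rule integral_dominated_convergence[where w = "\<lambda>_. B", OF J0m Jm]) (use Jlim JB in auto)
    moreover have "integral\<^sup>L \<Omega> (J n) = (\<Sum>i\<le>r n. \<Sum>j\<le>r n. k (z i) (z j)) / (real (Suc (r n)))\<^sup>2" for n
    proof -
      define h where "h x = (\<Sum>j\<le>r n. k (g x) (z j)) / Suc (r n)" for x
      have hm: "h \<in> borel_measurable borel" unfolding h_def using k1m by measurable
      have "integral\<^sup>L \<Omega> (J n) = integral\<^sup>L (distr \<Omega> borel (Yn n)) h"
        unfolding J_eq[abs_def] integral_distr[OF Yn(1) hm] h_def ..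
      also have "\<dots> = (\<Sum>i\<le>r n. h (t i)) / Suc (r n)" unfolding Yn(2) by (rule mint[OF hm])
      also have "\<dots> = (\<Sum>i\<le>r n. \<Sum>j\<le>r n. k (z i) (z j)) / (real (Suc (r n)))\<^sup>2"
        by (simp add: h_def t(2) sum_divide_distrib power2_eq_square)
      finally show ?thesis .
    qed
    moreover have "integral\<^sup>L \<Omega> J0 = (\<integral>x. \<integral>y. k x y \<partial>\<sigma> \<partial>\<sigma>)"
    proof -
      have "(\<lambda>x. \<integral>y. k x y \<partial>\<sigma>) \<in> borel_measurable borel"
        by (rule borel_measurable_continuous_onI[OF S.continuous_on_integral[OF k]])
      then have "(\<integral>x. \<integral>y. k x y \<partial>\<sigma> \<partial>\<sigma>) = (\<integral>x. (\<integral>y. k (g (Y x)) y \<partial>\<sigma>) \<partial>\<Omega>)"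
        unfolding \<sigma>_def by (rule integral_distr[OF gY])
      also have "(\<lambda>x. \<integral>y. k (g (Y x)) y \<partial>\<sigma>) = J0"
        unfolding J0_def \<sigma>_def by (intro ext integral_distr[OF gY] borel_measurable_continuous_onI[OF k2])
      finally show ?thesis by simp
    qed
    ultimately show ?thesis by simp
  qed
  \<comment> \<open>The curve may leave \<open>K\<close>, so \<sigma> has only been placed in a
    ball. Testing with the distance to \<open>K\<close>, which vanishes at all the
    \<open>z i\<close>, shows that \<sigma> is carried by \<open>K\<close>.\<close>
  have "compact_carried \<sigma> K"
  proof (intro compact_carried.intro compact_carried_axioms.intro)
    show "finite_measure \<sigma>" by (rule S.finite_measure_axioms)
    show "sets \<sigma> = sets borel" by (rule S.sets_eq)
    show "compact K" by fact
    have cc: "continuous_on UNIV (\<lambda>(x, y::complex). infdist x K)" unfolding split_beta' by (intro continuous_intros)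
    have ic: "continuous_on UNIV (\<lambda>x. infdist x K)" by (intro continuous_intros)
    have "(\<lambda>n. 0) \<longlonglongrightarrow> (\<integral>x. \<integral>y. infdist x K \<partial>\<sigma> \<partial>\<sigma>)"
      using conv[OF cc] by (simp add: infdist_zero[OF z])
    then have "(\<integral>x. infdist x K \<partial>\<sigma>) = 0" using sig(2) by (simp add: LIMSEQ_const_iff S.space_eq)
    then have "AE x in \<sigma>. infdist x K = 0"
      using integral_nonneg_eq_0_iff_AE[OF S.integrable_cont[OF ic]] infdist_nonneg by auto
    then have "AE x in \<sigma>. x \<in> K"
      by eventually_elim (use in_closed_iff_infdist_zero[OF compact_imp_closed[OF K]] z in blast)
    moreover have "UNIV - K \<in> sets \<sigma>" using borel_compact[OF K] by (auto simp: S.sets_eq)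
    ultimately show "emeasure \<sigma> (UNIV - K) = 0"
      by (subst (asm) AE_iff_measurable[where N = "UNIV - K"]) (auto simp: S.space_eq)
  qed
  then show ?thesis using that sig(2) r conv by blast
qed

text \<open>Leja points: each point maximises the product of the distances to its predecessors. If all these
  products stayed above \<open>exp (- T n)\<close>, a weak limit of the counting measures would have finite energy.\<close>

lemma zero_cap_small_product:
  assumes K: "compact K" "K \<noteq> {}" and cap: "zero_cap K"
  obtains n and z :: "nat \<Rightarrow> complex" where "0 < n" "\<And>i. z i \<in> K"
    "\<And>x. x \<in> K \<Longrightarrow> (\<Prod>i<n. cmod (x - z i)) \<le> exp (- T * n)"
proof -
  note done_if = that
  define pl where "pl l x = prod_list (map (\<lambda>v. cmod (x - v)) l)" for l and x :: complex
  have plc: "continuous_on A (pl l)" for A l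
    unfolding pl_def by (induction l) (auto intro!: continuous_intros)
  have "\<exists>x\<in>K. \<forall>y\<in>K. pl l y \<le> pl l x" for l
    by (rule continuous_attains_sup[OF K plc])
  then obtain pick where pick: "\<And>l. pick l \<in> K" "\<And>l y. y \<in> K \<Longrightarrow> pl l y \<le> pl l (pick l)" by metis
  \<comment> \<open>\<open>L n\<close> lists the first \<open>n\<close> Leja points, so that each
    choice sees all its predecessors.\<close>
  define L where "L n = rec_nat [] (\<lambda>_ l. l @ [pick l]) n" for n
  define z where "z n = pick (L n)" for n
  have L: "pl (L n) x = (\<Prod>i<n. cmod (x - z i))" for n x
    by (induction n) (simp_all add: L_def pl_def z_def)
  have zK: "z i \<in> K" for i unfolding z_def by (rule pick)
  have zmax: "(\<Prod>i<n. cmod (x - z i)) \<le> (\<Prod>i<n. cmod (z n - z i))" if "x \<in> K" for n x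
    using pick(2)[OF that, of "L n"] unfolding L z_def by simp
  show ?thesis
  proof (rule ccontr)
    assume no: "\<not> thesis"
    have big: "exp (- T * n) < (\<Prod>i<n. cmod (z n - z i))" if n: "0 < n" for n
    proof (rule ccontr)
      assume "\<not> exp (- T * n) < (\<Prod>i<n. cmod (z n - z i))"
      then have "(\<Prod>i<n. cmod (x - z i)) \<le> exp (- T * n)" if "x \<in> K" for x using zmax[OF that, of n] by linarith
      from done_if[OF n zK this] no show False by simp
    qed
    have low: "- T * n \<le> (\<Sum>i<n. ln (max r (cmod (z n - z i))))" if r: "0 < r" for r and n :: nat
    proof (cases "n = 0")
      case False
      have p: "max r (cmod (z n - z i)) > 0" for i using r by simp
      have "exp (- T * n) \<le> (\<Prod>i<n. max r (cmod (z n - z i)))"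
        using big[of n] False prod_mono[of "{..<n}" "\<lambda>i. cmod (z n - z i)" "\<lambda>i. max r (cmod (z n - z i))"] by force
      also have "\<dots> = exp (\<Sum>i<n. ln (max r (cmod (z n - z i))))"
        by (simp add: exp_sum exp_ln[OF p])
      finally show ?thesis by simp
    qed simp
    define k where "k r x y = ln (max r (cmod (x - y)))" for r and x y :: complex
    \<comment> \<open>Each new point adds its interaction with the earlier ones twice and one
      diagonal term \<open>ln r\<close>. After division by n^2 the diagonal disappears, leaving -T
      for every truncation radius.\<close>
    have sumlow: "- T * n * (real n - 1) + n * ln r \<le> (\<Sum>i<n. \<Sum>j<n. k r (z i) (z j))" if r: "0 < r" for r and n :: nat
    proof (induction n)
      case (Suc n)
      have sym: "(\<Sum>i<n. k r (z i) (z n)) = (\<Sum>i<n. k r (z n) (z i))"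
        by (rule sum.cong) (simp_all add: k_def norm_minus_commute)
      have diag: "k r (z n) (z n) = ln r" using r by (simp add: k_def)
      have "(\<Sum>i<Suc n. \<Sum>j<Suc n. k r (z i) (z j)) = (\<Sum>i<n. \<Sum>j<n. k r (z i) (z j)) + 2 * (\<Sum>i<n. k r (z n) (z i)) + ln r"
        by (simp add: sum.distrib sym diag)
      moreover have "- T * n \<le> (\<Sum>i<n. k r (z n) (z i))" using low[OF r, of n] by (simp add: k_def)
      moreover have "- T * Suc n * (real (Suc n) - 1) + Suc n * ln r = (- T * n * (real n - 1) + n * ln r) + 2 * (- T * n) + ln r"
        by (simp add: algebra_simps)
      ultimately show ?case using Suc.IH by linarith
    qed simp
    obtain \<sigma> s where \<sigma>: "compact_carried \<sigma> K" "measure \<sigma> UNIV = 1" "strict_mono (s :: nat \<Rightarrow> nat)" and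
      conv: "\<forall>k :: complex \<Rightarrow> complex \<Rightarrow> real. continuous_on UNIV (\<lambda>(x, y). k x y) \<longrightarrow>
        (\<lambda>n. (\<Sum>i\<le>s n. \<Sum>j\<le>s n. k (z i) (z j)) / (real (Suc (s n)))\<^sup>2) \<longlonglongrightarrow> (\<integral>x. \<integral>y. k x y \<partial>\<sigma> \<partial>\<sigma>)"
      by (rule empirical_weak_limit[OF K(1) zK]) (rule that)
    interpret S: compact_carried \<sigma> K by fact
    have energy: "- T \<le> (\<integral>x. rpot r \<sigma> x \<partial>\<sigma>)" if r: "0 < r" for r
    proof -
      have c: "(\<lambda>n. (\<Sum>i\<le>s n. \<Sum>j\<le>s n. k r (z i) (z j)) / (real (Suc (s n)))\<^sup>2) \<longlonglongrightarrow> (\<integral>x. rpot r \<sigma> x \<partial>\<sigma>)"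
        unfolding rpot_def using conv[rule_format, of "k r"] continuous_on_log_kernel[OF r] unfolding k_def by blast
      have "(\<lambda>N. - T * (real N / Suc N) + ln r / Suc N) \<longlonglongrightarrow> - T * 1 + 0"
        by (intro tendsto_intros LIMSEQ_n_over_Suc_n lim_const_over_n[THEN LIMSEQ_Suc])
      then have "((\<lambda>N. - T * (real N / Suc N) + ln r / Suc N) \<circ> s) \<longlonglongrightarrow> - T"
        using LIMSEQ_subseq_LIMSEQ[OF _ \<sigma>(3)] by simp
      then have l: "(\<lambda>n. - T * (real (s n) / Suc (s n)) + ln r / Suc (s n)) \<longlonglongrightarrow> - T" by (simp add: o_def)
      show ?thesis
      proof (rule LIMSEQ_le[OF l c], intro exI allI impI)
        fix n
        define N where "N = Suc (s n)"
        have "- T * (real (s n) / Suc (s n)) + ln r / Suc (s n) = (- T * N * (real N - 1) + N * ln r) / (real N)\<^sup>2"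
          by (simp add: N_def field_simps power2_eq_square)
        also have "\<dots> \<le> (\<Sum>i<N. \<Sum>j<N. k r (z i) (z j)) / (real N)\<^sup>2"
          by (intro divide_right_mono sumlow r) simp
        finally show "- T * (real (s n) / Suc (s n)) + ln r / Suc (s n) \<le> (\<Sum>i\<le>s n. \<Sum>j\<le>s n. k r (z i) (z j)) / (real (Suc (s n)))\<^sup>2"
          by (simp add: N_def lessThan_Suc_atMost)
      qed
    qed
    have "eint \<sigma> (\<lambda>z. logpot \<sigma> z) = - \<infinity>"
      using cap K(1) S.sets_eq S.null_C \<sigma>(2) S.emeasure_eq_measure[of UNIV] unfolding zero_cap_def by (metis ennreal_1 subset_refl)
    moreover have "ereal (- T) \<le> eint \<sigma> (logpot \<sigma>)"
      unfolding S.energy_INF by (rule INF_greatest) (use energy in simp)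
    ultimately show False by simp
  qed
qed

section \<open>The upper bound\<close>

lemma (in compact_carried) integral_mass_0:
  assumes "mass = 0"
  shows "integral\<^sup>L M f = (0::real)"
proof -
  have "emeasure M (space M) = 0" using assms by (simp add: emeasure_eq_measure space_eq)
  then have "AE x in M. f x = 0" by (intro AE_I[where N = "space M"]) auto
  then show ?thesis by (rule integral_eq_zero_AE)
qed

lemma cs_borel_measure_carried:
  assumes "cs_borel_measure \<nu>"
  obtains C where "compact_carried \<nu> C"
proof -
  obtain K where K: "sets \<nu> = sets borel" "emeasure \<nu> UNIV < \<infinity>" "compact K" "emeasure \<nu> (UNIV - K) = 0"
    using assms by (auto simp: cs_borel_measure_def)
  have "space \<nu> = UNIV" using sets_eq_imp_space_eq[OF K(1)] by simp
  then have "compact_carried \<nu> K"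
    using K by (intro compact_carried.intro compact_carried_axioms.intro finite_measureI) auto
  then show ?thesis by (rule that)
qed

lemma compact_carried_cs_borel:
  assumes "compact_carried \<nu> C"
  shows "cs_borel_measure \<nu>"
proof -
  interpret compact_carried \<nu> C by fact
  show ?thesis
    unfolding cs_borel_measure_def using sets_eq compact_C null_C by (auto simp: emeasure_eq_measure)
qed

text \<open>The complement of the support is a union of null balls, and Lindelof's theorem leaves
  countably many of them.\<close>

lemma msupp_null:
  assumes "sets \<mu> = sets borel"
  shows "emeasure \<mu> (UNIV - msupp \<mu>) = 0"
proof -
  define \<B> where "\<B> = {ball z e |z e. emeasure \<mu> (ball z e) = 0}"
  have cov: "UNIV - msupp \<mu> = \<Union>\<B>"
  proof (intro set_eqI iffI)
    fix x assume "x \<in> UNIV - msupp \<mu>"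
    then obtain e where "e > 0" "emeasure \<mu> (ball x e) = 0" by (auto simp: msupp_def)
    then show "x \<in> \<Union>\<B>" unfolding \<B>_def by (intro UnionI[of "ball x e"]) auto
  next
    fix x assume "x \<in> \<Union>\<B>"
    then obtain z e where ze: "emeasure \<mu> (ball z e) = 0" "x \<in> ball z e" by (auto simp: \<B>_def)
    then obtain d where d: "d > 0" "ball x d \<subseteq> ball z e" by (meson open_ball open_contains_ball)
    then have "emeasure \<mu> (ball x d) \<le> emeasure \<mu> (ball z e)" by (intro emeasure_mono) (auto simp: assms)
    then show "x \<in> UNIV - msupp \<mu>" using d ze by (auto simp: msupp_def)
  qed
  obtain \<C> where \<C>: "\<C> \<subseteq> \<B>" "countable \<C>" "\<Union>\<C> = \<Union>\<B>"
    using Lindelof[of \<B>] by (auto simp: \<B>_def)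
  have "(\<Union>b\<in>\<C>. b) \<in> null_sets \<mu>"
    by (rule null_sets_UN'[OF \<C>(2)]) (use \<C>(1) in \<open>auto simp: \<B>_def null_sets_def assms\<close>)
  then show ?thesis using cov \<C>(3) by auto
qed

text \<open>With the last point frozen at a finite value, that value moves to the right-hand side
  and the induction hypothesis bounds the remaining suprema. Excluding +\<infinity> keeps the
  subtractions meaningful.\<close>

lemma sum_SUP_le:
  fixes f :: "nat \<Rightarrow> 'a \<Rightarrow> ereal"
  assumes "E \<noteq> {}" "\<And>j. j < m \<Longrightarrow> (SUP x\<in>E. f j x) \<noteq> \<infinity>"
    and "\<And>c. (\<And>j. j < m \<Longrightarrow> c j \<in> E) \<Longrightarrow> (\<Sum>j<m. f j (c j)) \<le> Y"
  shows "(\<Sum>j<m. SUP x\<in>E. f j x) \<le> Y"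
  using assms
proof (induction m arbitrary: Y)
  case 0
  then show ?case by auto
next
  case (Suc m)
  define A where "A = (\<Sum>j<m. SUP x\<in>E. f j x)"
  have Afin: "A \<noteq> \<infinity>" unfolding A_def using Suc.prems(2) by (auto simp: sum_Pinfty)
  have Sm: "(SUP x\<in>E. f m x) \<noteq> \<infinity>" by (rule Suc.prems(2)) simp
  have fz: "f m z \<le> Y - A" if A: "A \<noteq> -\<infinity>" and z: "z \<in> E" for z
  proof (cases "f m z")
    case (real x)
    have "(\<Sum>j<m. f j (c j)) \<le> Y - ereal x" if c: "\<And>j. j < m \<Longrightarrow> c j \<in> E" for c
    proof -
      have "(\<Sum>j<m. f j ((c(m := z)) j)) = (\<Sum>j<m. f j (c j))" by (rule sum.cong) auto
      moreover have "(\<Sum>j<Suc m. f j ((c(m := z)) j)) \<le> Y"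
        by (rule Suc.prems(3)) (use c z in \<open>auto simp: less_Suc_eq\<close>)
      ultimately have "(\<Sum>j<m. f j (c j)) + ereal x \<le> Y" using real by simp
      then show ?thesis by (simp add: ereal_le_minus)
    qed
    then have "A \<le> Y - ereal x"
      unfolding A_def by (intro Suc.IH Suc.prems(1,2)) auto
    then show ?thesis using real A Afin by (cases A; cases Y) auto
  next
    case PInf
    have "f m z \<le> (SUP x\<in>E. f m x)" using z by (rule SUP_upper)
    then show ?thesis using Sm PInf by simp
  next
    case MInf
    then show ?thesis by simp
  qed
  have "A + (SUP x\<in>E. f m x) \<le> Y"
  proof (cases "A = -\<infinity>")
    case True
    then show ?thesis using Sm by (cases "SUP x\<in>E. f m x") auto
  next
    case False
    then have "(SUP x\<in>E. f m x) \<le> Y - A" using fz by (intro SUP_least)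
    then show ?thesis using False Afin by (cases A; cases Y; cases "SUP x\<in>E. f m x") auto
  qed
  then show ?case by (simp add: A_def)
qed

section \<open>Consequences of admissibility and of the equilibrium conditions\<close>

locale weighted_setting =
  fixes E :: "complex set" and w :: "complex \<Rightarrow> real" and \<mu> :: "complex measure" and F :: real
  assumes closed_E: "closed E" and adm: "admissible_weight E w" and equil: "weighted_equilibrium E w \<mu> F"
begin

lemma w_nonneg: "z \<in> E \<Longrightarrow> 0 \<le> w z"
  using adm by (simp add: admissible_weight_def)

lemma w_usc: "z \<in> E \<Longrightarrow> w z < c \<Longrightarrow> \<exists>e>0. \<forall>y\<in>E. dist y z < e \<longrightarrow> w y < c"
  using adm by (simp add: admissible_weight_def)

lemma w_bounded_on:
  assumes "compact K" "K \<subseteq> E"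
  shows "\<exists>B. \<forall>z\<in>K. w z \<le> B"
proof -
  have "\<forall>z\<in>K. \<exists>e>0. \<forall>y\<in>E. dist y z < e \<longrightarrow> w y < w z + 1" using w_usc assms(2) by (meson less_add_one subsetD)
  then obtain e where e: "\<And>z. z \<in> K \<Longrightarrow> e z > 0" "\<And>z y. z \<in> K \<Longrightarrow> y \<in> E \<Longrightarrow> dist y z < e z \<Longrightarrow> w y < w z + 1" by metis
  have "K \<subseteq> (\<Union>z\<in>K. ball z (e z))" using e(1) by force
  then obtain I where I: "I \<subseteq> K" "finite I" "K \<subseteq> (\<Union>z\<in>I. ball z (e z))"
    using compactE_image[OF assms(1), of K "\<lambda>z. ball z (e z)"] by blast
  define B where "B = Max (insert 0 ((\<lambda>z. w z + 1) ` I))"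
  have "w y \<le> B" if y: "y \<in> K" for y
  proof -
    obtain z where z: "z \<in> I" "dist y z < e z" using I y by (auto simp: dist_commute)
    then have "w y < w z + 1" using e(2)[of z y] I(1) y assms(2) by blast
    also have "\<dots> \<le> B" unfolding B_def using I z by (intro Max_ge) auto
    finally show ?thesis by simp
  qed
  then show ?thesis by blast
qed

lemma weight_at_infinity: "\<epsilon> > 0 \<Longrightarrow> \<exists>R\<ge>1. \<forall>z\<in>E. R < cmod z \<longrightarrow> cmod z * w z < \<epsilon>"
proof (cases "bounded E")
  case True
  then obtain R where "\<forall>z\<in>E. cmod z \<le> R" by (auto simp: bounded_iff)
  then show ?thesis by (intro exI[of _ "max 1 R"]) force
next
  case False
  assume "\<epsilon> > 0"
  with False adm obtain R where "\<forall>z\<in>E. cmod z > R \<longrightarrow> cmod z * w z < \<epsilon>"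
    by (auto simp: admissible_weight_def)
  then show ?thesis by (intro exI[of _ "max 1 R"]) auto
qed

lemma weight_bounds:
  obtains W where "1 \<le> W" "\<And>z. z \<in> E \<Longrightarrow> w z \<le> W" "\<And>z. z \<in> E \<Longrightarrow> cmod z * w z \<le> W"
proof -
  obtain R where R: "R \<ge> 1" "\<And>z. z \<in> E \<Longrightarrow> R < cmod z \<Longrightarrow> cmod z * w z < 1"
    using weight_at_infinity[of 1] by auto
  have "compact (E \<inter> cball 0 R)" using closed_E by (intro closed_Int_compact) auto
  then obtain B where B: "\<And>z. z \<in> E \<Longrightarrow> cmod z \<le> R \<Longrightarrow> w z \<le> B"
    using w_bounded_on[of "E \<inter> cball 0 R"] by (metis IntI inf_le1 mem_cball_0)
  define W where "W = R * (\<bar>B\<bar> + 1)"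
  have W: "1 \<le> W" "\<bar>B\<bar> + 1 \<le> W"
    unfolding W_def using R(1) mult_mono[of 1 R 1 "\<bar>B\<bar> + 1"] mult_right_mono[of 1 R "\<bar>B\<bar> + 1"] by auto
  show ?thesis
  proof
    show "1 \<le> W" by (rule W)
    fix z assume z: "z \<in> E"
    show "w z \<le> W"
    proof (cases "cmod z \<le> R")
      case True
      then show ?thesis using B[OF z True] W by linarith
    next
      case False
      then have "1 * w z \<le> cmod z * w z" using R(1) w_nonneg[OF z] by (intro mult_right_mono) auto
      then show ?thesis using R(2)[OF z] False W by simp
    qed
    show "cmod z * w z \<le> W"
    proof (cases "cmod z \<le> R")
      case True
      then have "cmod z * w z \<le> R * (\<bar>B\<bar> + 1)" using B[OF z True] w_nonneg[OF z] R(1) by (intro mult_mono) auto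
      then show ?thesis by (simp add: W_def)
    next
      case False
      then show ?thesis using R(2)[OF z] W by simp
    qed
  qed
qed

abbreviation "S \<equiv> msupp \<mu>"

lemma S_props: "compact S" "S \<subseteq> E"
  and support_ineq: "z \<in> S \<Longrightarrow> logpot \<mu> z + elog (w z) + ereal F \<ge> 0"
  and exceptional: "zero_cap {z\<in>E. logpot \<mu> z + elog (w z) + ereal F > 0}"
  using equil by (auto simp: weighted_equilibrium_def)

lemma mu_carried: "compact_carried \<mu> S" and mu_mass: "measure \<mu> UNIV = 1"
proof -
  have s: "sets \<mu> = sets borel" "emeasure \<mu> UNIV = 1" using equil by (auto simp: weighted_equilibrium_def)
  then have "space \<mu> = UNIV" using sets_eq_imp_space_eq[OF s(1)] by simp
  then show "compact_carried \<mu> S"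
    using s S_props(1) msupp_null[OF s(1)]
    by (intro compact_carried.intro compact_carried_axioms.intro finite_measureI) auto
  show "measure \<mu> UNIV = 1" using s(2) by (simp add: measure_def)
qed

sublocale mu: compact_carried \<mu> S by (rule mu_carried)

lemma support_pos: "z \<in> S \<Longrightarrow> 0 < w z"
  using support_ineq[of z] mu.logpot_finite[of z]
  by (cases "logpot \<mu> z") (auto simp: elog_def split: if_splits)

text \<open>The equilibrium inequality on the support and the boundedness of the weight combine to
  the lower bound that the domination argument requires.\<close>

lemma potential_lower_on_support:
  obtains B where "0 \<le> B" "\<And>z r. z \<in> S \<Longrightarrow> 0 < r \<Longrightarrow> - B \<le> rpot r \<mu> z"
proof -
  obtain W where W: "1 \<le> W" "\<And>z. z \<in> E \<Longrightarrow> w z \<le> W" by (rule weight_bounds) blast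
  have "- (\<bar>F\<bar> + ln W) \<le> rpot r \<mu> z" if z: "z \<in> S" and r: "0 < r" for z r
  proof -
    have "0 \<le> logpot \<mu> z + elog (w z) + ereal F" by (rule support_ineq[OF z])
    also have "\<dots> \<le> ereal (rpot r \<mu> z) + ereal (ln W) + ereal F"
    proof (intro add_mono order_refl mu.logpot_le_rpot[OF r])
      have "z \<in> E" using z S_props by auto
      then show "elog (w z) \<le> ereal (ln W)" using support_pos[OF z] W by (auto simp: elog_def ln_mono)
    qed
    finally show ?thesis by simp
  qed
  then show ?thesis using that[of "\<bar>F\<bar> + ln W"] W by auto
qed

text \<open>A point mass has truncated potential \<open>ln r\<close> at its atom, which is unbounded
  below as \<open>r\<close> tends to 0. Two points of positive weight are what keeps a maximum of
  weighted distances away from 0.\<close>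

lemma two_support_points: "\<exists>a b. a \<in> S \<and> b \<in> S \<and> a \<noteq> b"
proof (rule ccontr)
  assume n: "\<not> ?thesis"
  have ne: "S \<noteq> {}"
  proof
    assume e: "S = {}"
    have "emeasure \<mu> (UNIV - S) = 0" by (rule mu.null_C)
    then show False using e mu_mass by (simp add: measure_def)
  qed
  then obtain a where a: "a \<in> S" by auto
  then have Sa: "S = {a}" using n by auto
  obtain B where B: "0 \<le> B" "\<And>z r. z \<in> S \<Longrightarrow> 0 < r \<Longrightarrow> - B \<le> rpot r \<mu> z" by (rule potential_lower_on_support) blast
  define r where "r = exp (- B - 1)"
  have r: "0 < r" by (simp add: r_def)
  have "rpot r \<mu> a = (\<integral>t. ln r \<partial>\<mu>)"
    unfolding rpot_def
    by (intro mu.integral_cong_C continuous_on_trunc_log continuous_intros r) (use Sa r in auto)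
  also have "\<dots> = - B - 1" using mu_mass by (simp add: mu.space_eq r_def)
  finally show False using B(2)[OF a r] by simp
qed

lemma E_nonempty: "E \<noteq> {}"
  using two_support_points S_props by auto

lemma term_bounded:
  assumes "cs_borel_measure \<nu>"
  shows "(SUP z\<in>E. ereal (measure \<nu> UNIV) * elog (w z) + logpot \<nu> z) \<noteq> \<infinity>"
proof -
  obtain C where "compact_carried \<nu> C" using cs_borel_measure_carried[OF assms] .
  then interpret compact_carried \<nu> C .
  obtain W where W: "1 \<le> W" "\<And>z. z \<in> E \<Longrightarrow> w z \<le> W" "\<And>z. z \<in> E \<Longrightarrow> cmod z * w z \<le> W" by (rule weight_bounds) blast
  obtain R where R: "0 < R" "C \<subseteq> ball 0 R" by (rule C_ball)
  define H where "H = W * (2 + R)"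
  have H: "1 \<le> H" unfolding H_def using W(1) R(1) mult_mono[of 1 W 1 "2 + R"] by simp
  have "ereal mass * elog (w z) + logpot \<nu> z \<le> ereal (mass * ln H)" if z: "z \<in> E" for z
  proof (cases "mass = 0")
    case True
    have "logpot \<nu> z \<le> ereal (rpot 1 \<nu> z)" by (rule logpot_le_rpot) simp
    then show ?thesis using True integral_mass_0[OF True] by (simp add: rpot_def zero_ereal_def[symmetric])
  next
    case False
    then have m0: "0 < mass" by (simp add: zero_less_measure_iff)
    show ?thesis
    proof (cases "w z = 0")
      case True
      then show ?thesis using m0 logpot_finite[of z] by (cases "logpot \<nu> z") (auto simp: elog_def)
    next
      case False
      then have wz: "0 < w z" using w_nonneg[OF z] by simp
      have "rpot 1 \<nu> z \<le> mass * ln (1 + cmod z + R)"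
      proof (rule rpot_upper)
        fix t assume "t \<in> C"
        then have "cmod t < R" using R by auto
        then show "cmod (z - t) \<le> 1 + cmod z + R" using norm_triangle_ineq4[of z t] by linarith
      qed (use R in \<open>auto simp: add_nonneg_nonneg\<close>)
      then have "mass * ln (w z) + rpot 1 \<nu> z \<le> mass * (ln (w z) + ln (1 + cmod z + R))" by (simp add: distrib_left)
      also have "ln (w z) + ln (1 + cmod z + R) = ln (w z * (1 + cmod z + R))"
        using wz R by (subst ln_mult) (auto simp: add_nonneg_eq_0_iff)
      also have "mass * ln (w z * (1 + cmod z + R)) \<le> mass * ln H"
      proof (rule mult_left_mono)
        have p: "0 < 1 + cmod z + R" using R norm_ge_zero[of z] by linarith
        have "w z * (1 + cmod z + R) = w z + cmod z * w z + R * w z" by (simp add: algebra_simps)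
        also have "\<dots> \<le> W + W + R * W" using W(2,3)[OF z] R by (intro add_mono mult_left_mono) auto
        also have "\<dots> = H" by (simp add: H_def algebra_simps)
        finally show "ln (w z * (1 + cmod z + R)) \<le> ln H" using wz p by (intro ln_mono) auto
      qed simp
      finally have "mass * ln (w z) + rpot 1 \<nu> z \<le> mass * ln H" .
      moreover have "ereal mass * elog (w z) + logpot \<nu> z \<le> ereal (mass * ln (w z)) + ereal (rpot 1 \<nu> z)"
        using wz by (intro add_mono logpot_le_rpot) (auto simp: elog_def)
      ultimately show ?thesis by (simp add: order_trans)
    qed
  qed
  then have "(SUP z\<in>E. ereal mass * elog (w z) + logpot \<nu> z) \<le> ereal (mass * ln H)" by (rule SUP_least)
  then show ?thesis by auto
qed

lemma upper_bound_points:
  assumes fam: "measure_family m \<nu>" and c: "\<And>j. j < m \<Longrightarrow> c j \<in> E"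
  shows "(\<Sum>j<m. ereal (measure (\<nu> j) UNIV) * elog (w (c j)) + logpot (\<nu> j) (c j))
    \<le> eint \<mu> (\<lambda>z. elog (maxdist (\<lambda>k. w (c k)) c m z)) + ereal F + sup_total E w m \<nu>"
    (is "?L \<le> ?X + ereal F + ?s")
proof -
  define \<alpha> where "\<alpha> j = measure (\<nu> j) UNIV" for j
  have sum\<alpha>: "(\<Sum>j<m. \<alpha> j) = 1" using fam by (simp add: measure_family_def \<alpha>_def)
  have m: "0 < m" using sum\<alpha> by (cases m) auto
  have "\<forall>j. \<exists>C. j < m \<longrightarrow> compact_carried (\<nu> j) C"
    using fam cs_borel_measure_carried unfolding measure_family_def by metis
  then obtain C where C: "\<And>j. j < m \<Longrightarrow> compact_carried (\<nu> j) (C j)" by metis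
  define v where "v k = w (c k)" for k
  have v0: "0 \<le> v k" if "k < m" for k using w_nonneg c[OF that] by (simp add: v_def)
  have \<alpha>0: "0 \<le> \<alpha> j" for j by (simp add: \<alpha>_def)
  have fin: "logpot (\<nu> j) z \<noteq> \<infinity>" if "j < m" for j z
    by (rule compact_carried.logpot_finite[OF C[OF that]])
  have elf: "ereal (\<alpha> j) * elog (v j) \<noteq> \<infinity>" if "j < m" for j
    using \<alpha>0[of j] by (cases "\<alpha> j = 0") (auto simp: elog_def)
  have tf: "ereal (\<alpha> j) * elog (v j) + logpot (\<nu> j) (c j) \<noteq> \<infinity>" if "j < m" for j
    using fin[OF that, of "c j"] elf[OF that] by simp
  have Lf: "?L \<noteq> \<infinity>" using tf by (auto simp: sum_Pinfty \<alpha>_def v_def)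
  have mx0: "0 \<le> maxdist v c m z" for z
    using maxdist_ge[OF m, of v z c] v0[OF m] by (meson mult_nonneg_nonneg norm_ge_zero order_trans)
  have Xeq: "?X = (INF n. ereal (\<integral>z. ln (max (1 / Suc n) (maxdist v c m z)) \<partial>\<mu>))"
    unfolding v_def[symmetric]
    by (rule mu.eint_elog[OF mx0 continuous_on_ln_max_maxdist[OF m]]) simp
  show ?thesis
  proof (cases "?L = -\<infinity>")
    case True
    then show ?thesis by (metis ereal_infty_less_eq(2) ereal_less_eq(2))
  next
    case False
    then obtain L where L: "?L = ereal L" using Lf by (cases ?L) auto
    \<comment> \<open>A term with positive mass and zero weight is -\<infinity>, and no other term
      is +\<infinity> to compensate, so the sum would not be finite.\<close>
    have vpos: "0 < v j" if j: "j < m" "0 < \<alpha> j" for j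
    proof (rule ccontr)
      assume "\<not> 0 < v j"
      then have "ereal (\<alpha> j) * elog (v j) + logpot (\<nu> j) (c j) = -\<infinity>"
        using j fin[OF j(1), of "c j"] by (cases "logpot (\<nu> j) (c j)") (auto simp: elog_def)
      moreover have "(\<Sum>i\<in>{..<m} - {j}. ereal (\<alpha> i) * elog (v i) + logpot (\<nu> i) (c i)) \<noteq> \<infinity>"
        using tf by (auto simp: sum_Pinfty)
      ultimately have "?L = -\<infinity>"
        unfolding \<alpha>_def v_def using j(1) by (subst sum.remove[of _ j]) auto
      then show False using False by simp
    qed
    define V where "V = Max (v ` {..<m})"
    have V: "v k \<le> V" if "k < m" for k unfolding V_def using that by (intro Max_ge) auto
    have "V \<in> v ` {..<m}" unfolding V_def using m by (intro Max_in) auto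
    then obtain k0 where k0: "k0 < m" "v k0 = V" by auto
    have V0: "0 < V"
    proof -
      have "\<exists>j<m. 0 < \<alpha> j"
      proof (rule ccontr)
        assume "\<not> ?thesis"
        then have "\<alpha> j = 0" if "j < m" for j using that \<alpha>0[of j] by (meson antisym_conv1 not_less)
        then show False using sum\<alpha> by simp
      qed
      then show ?thesis using vpos V by (meson order_less_le_trans)
    qed
    define \<nu>t where "\<nu>t = sum_measure m \<nu>"
    have nt: "compact_carried \<nu>t (\<Union>j<m. C j)" unfolding \<nu>t_def by (rule compact_carried_sum_measure[OF C])
    interpret nt: compact_carried \<nu>t "\<Union>j<m. C j" by (rule nt)
    have nint: "integral\<^sup>L \<nu>t g = (\<Sum>j<m. integral\<^sup>L (\<nu> j) g)" if "continuous_on UNIV g" for g :: "complex \<Rightarrow> real"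
      unfolding \<nu>t_def by (rule integral_sum_measure[OF C that])
    have nrpot: "rpot r \<nu>t z = (\<Sum>j<m. rpot r (\<nu> j) z)" if "0 < r" for r z
      unfolding rpot_def by (rule nint) (intro continuous_on_trunc_log continuous_intros that)
    have spU: "integral\<^sup>L (\<nu> j) (\<lambda>_. 1::real) = \<alpha> j" if "j < m" for j
      using compact_carried.space_eq[OF C[OF that]] by (simp add: \<alpha>_def)
    have nmass: "measure \<nu>t UNIV = 1"
      using nint[of "\<lambda>_. 1"] spU sum\<alpha> by (simp add: nt.space_eq)
    \<comment> \<open>Each term is an integral of \<open>ln (v j * max r |c j - t|)\<close>, and v j
      * max r |c j - t| is at most the larger of V * r and the weighted maximum. All terms thus
      share one integrand and the measures can be added.\<close>
    have L_le: "L \<le> (\<integral>z. ln (max (V * r) (maxdist v c m z)) \<partial>\<nu>t)" if r: "0 < r" for r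
    proof -
      have Vr: "0 < V * r" using V0 r by simp
      have "?L \<le> (\<Sum>j<m. ereal (\<integral>z. ln (max (V * r) (maxdist v c m z)) \<partial>\<nu> j))"
      proof (rule sum_mono)
        fix j assume "j \<in> {..<m}"
        then have j: "j < m" by simp
        interpret nj: compact_carried "\<nu> j" "C j" by (rule C[OF j])
        show "ereal (measure (\<nu> j) UNIV) * elog (w (c j)) + logpot (\<nu> j) (c j)
          \<le> ereal (\<integral>z. ln (max (V * r) (maxdist v c m z)) \<partial>\<nu> j)"
        proof (cases "\<alpha> j = 0")
          case True
          then have z: "measure (\<nu> j) UNIV = 0" by (simp add: \<alpha>_def)
          have "logpot (\<nu> j) (c j) \<le> ereal (rpot 1 (\<nu> j) (c j))" by (rule nj.logpot_le_rpot) simp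
          then show ?thesis by (simp add: z nj.integral_mass_0[OF z] rpot_def zero_ereal_def[symmetric])
        next
          case False
          then have vj: "0 < v j" using vpos[OF j] \<alpha>0[of j] by simp
          have "ereal (measure (\<nu> j) UNIV) * elog (w (c j)) + logpot (\<nu> j) (c j)
             \<le> ereal (\<alpha> j * ln (v j)) + ereal (rpot r (\<nu> j) (c j))"
            using vj by (intro add_mono nj.logpot_le_rpot r) (auto simp: elog_def v_def \<alpha>_def)
          also have "\<dots> = ereal (\<integral>t. ln (v j) + ln (max r (cmod (c j - t))) \<partial>\<nu> j)"
            by (subst Bochner_Integration.integral_add)
               (auto intro!: nj.kernel_integrable r simp: nj.space_eq rpot_def \<alpha>_def)
          also have "\<dots> \<le> ereal (\<integral>z. ln (max (V * r) (maxdist v c m z)) \<partial>\<nu> j)"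
          proof (subst ereal_less_eq(3), rule nj.integral_mono_C)
            show "continuous_on UNIV (\<lambda>t. ln (v j) + ln (max r (cmod (c j - t))))"
              by (intro continuous_on_add continuous_on_const continuous_on_trunc_log continuous_on_diff continuous_on_id r)
            show "continuous_on UNIV (\<lambda>z. ln (max (V * r) (maxdist v c m z)))"
              by (rule continuous_on_ln_max_maxdist[OF m Vr])
            fix t
            have p: "0 < max r (cmod (c j - t))" using r by simp
            have "ln (v j) + ln (max r (cmod (c j - t))) = ln (v j * max r (cmod (c j - t)))"
              using vj p by (simp add: ln_mult)
            also have "\<dots> \<le> ln (max (V * r) (maxdist v c m t))"
            proof (rule ln_mono)
              show "0 < v j * max r (cmod (c j - t))" using vj p by simp
              have "v j * r \<le> V * r" using V[OF j] r by simp
              moreover have "v j * cmod (c j - t) \<le> maxdist v c m t"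
                using maxdist_ge[OF j, of v t c] by (simp add: norm_minus_commute)
              ultimately show "v j * max r (cmod (c j - t)) \<le> max (V * r) (maxdist v c m t)"
                by (cases "r \<le> cmod (c j - t)") (auto simp: max_def)
            qed
            finally show "ln (v j) + ln (max r (cmod (c j - t))) \<le> ln (max (V * r) (maxdist v c m t))" .
          qed
          finally show ?thesis .
        qed
      qed
      also have "\<dots> = ereal (\<integral>z. ln (max (V * r) (maxdist v c m z)) \<partial>\<nu>t)"
        by (simp add: nint[OF continuous_on_ln_max_maxdist[OF m Vr]])
      finally show ?thesis by (simp add: L)
    qed
    obtain B where B: "0 \<le> B" "\<And>z r. z \<in> S \<Longrightarrow> 0 < r \<Longrightarrow> - B \<le> rpot r \<mu> z" by (rule potential_lower_on_support) blast
    \<comment> \<open>Stated for every real upper bound \<open>M\<close> of the supremum, so that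
      \<open>M\<close> can be chosen arbitrarily low when the supremum is -\<infinity>.\<close>
    have main: "ereal L \<le> ?X + ereal F + ereal M" if M: "?s \<le> ereal M" for M
    proof -
      \<comment> \<open>The bound on ln w + p and the equilibrium inequality are combined so that
        \<open>ln (w z)\<close> cancels; this is where the constant F + M arises.\<close>
      have dom: "\<exists>r>0. rpot r \<nu>t z \<le> (F + M) + \<epsilon> + rpot \<rho> \<mu> z" if z: "z \<in> S" and \<rho>: "0 < \<rho>" and \<epsilon>: "0 < \<epsilon>" for z \<rho> \<epsilon>
      proof -
        have zE: "z \<in> E" using z S_props by auto
        have wz: "0 < w z" by (rule support_pos[OF z])
        have el: "elog (w z) = ereal (ln (w z))" using wz by (simp add: elog_def)
        have "logpot \<nu>t z = (\<Sum>j<m. logpot (\<nu> j) z)"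
        proof (rule LIMSEQ_unique[OF nt.logpot_tendsto])
          have "(\<lambda>n. \<Sum>j<m. ereal (rpot (1 / Suc n) (\<nu> j) z)) \<longlonglongrightarrow> (\<Sum>j<m. logpot (\<nu> j) z)"
            by (rule tendsto_sum_ereal) (use compact_carried.logpot_tendsto[OF C] fin in auto)
          then show "(\<lambda>n. ereal (rpot (1 / Suc n) \<nu>t z)) \<longlonglongrightarrow> (\<Sum>j<m. logpot (\<nu> j) z)"
            by (simp add: nrpot)
        qed
        moreover have "elog (w z) + (\<Sum>j<m. logpot (\<nu> j) z) \<le> ereal M"
        proof -
          have "elog (w z) + (\<Sum>j<m. logpot (\<nu> j) z) \<le> ?s" unfolding sup_total_def using zE by (rule SUP_upper)
          then show ?thesis using M by (rule order_trans)
        qed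
        ultimately have 1: "ereal (ln (w z)) + logpot \<nu>t z \<le> ereal M" by (simp add: el)
        have "0 \<le> logpot \<mu> z + elog (w z) + ereal F" by (rule support_ineq[OF z])
        also have "\<dots> \<le> ereal (rpot \<rho> \<mu> z) + ereal (ln (w z)) + ereal F"
          unfolding el by (intro add_mono order_refl mu.logpot_le_rpot \<rho>)
        finally have 2: "0 \<le> rpot \<rho> \<mu> z + ln (w z) + F" by simp
        have "logpot \<nu>t z < ereal ((F + M) + \<epsilon> + rpot \<rho> \<mu> z)"
          using 1 2 \<epsilon> nt.logpot_finite[of z] by (cases "logpot \<nu>t z") auto
        then show ?thesis by (rule nt.logpot_less_obtain) (auto intro: less_imp_le)
      qed
      have "L \<le> (F + M) + (\<integral>z. ln (max \<delta> (maxdist v c m z)) \<partial>\<mu>)" if "0 < \<delta>" for \<delta>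
        by (rule maxdist_domination[OF mu_carried mu_mass nt nmass B(2) dom v0 V k0 V0 L_le that])
      then have "ereal (L - (F + M)) \<le> ?X"
        unfolding Xeq by (intro INF_greatest) (simp add: algebra_simps)
      then show ?thesis by (cases ?X) auto
    qed
    have Xf: "?X \<noteq> \<infinity>"
    proof -
      have "?X \<le> ereal (\<integral>z. ln (max (1 / Suc 0) (maxdist v c m z)) \<partial>\<mu>)" unfolding Xeq by (rule INF_lower) simp
      then show ?thesis by auto
    qed
    show ?thesis
    proof (cases ?s)
      case (real M)
      then show ?thesis using main[of M] L by simp
    next
      case PInf
      then show ?thesis by simp
    next
      case MInf
      then have "ereal L \<le> ?X + ereal F + ereal M" for M by (intro main) simp
      from this[of "L - 1 - F - real_of_ereal ?X"] Xf show ?thesis by (cases ?X) auto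
    qed
  qed
qed

lemma upper_bound:
  assumes fam: "measure_family m \<nu>"
  shows "lhs_sum E w m \<nu> \<le> C_m E w \<mu> F m + sup_total E w m \<nu>"
  unfolding lhs_sum_def
proof (rule sum_SUP_le[OF E_nonempty])
  show "(SUP z\<in>E. ereal (measure (\<nu> j) UNIV) * elog (w z) + logpot (\<nu> j) z) \<noteq> \<infinity>" if "j < m" for j
    by (rule term_bounded) (use fam that in \<open>simp add: measure_family_def\<close>)
  fix c :: "nat \<Rightarrow> complex" assume c: "\<And>j. j < m \<Longrightarrow> c j \<in> E"
  have "eint \<mu> (\<lambda>z. elog (maxdist (\<lambda>k. w (c k)) c m z)) + ereal F \<le> C_m E w \<mu> F m"
    unfolding C_m_def maxdist_def by (intro add_mono SUP_upper order_refl) (use c in auto)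
  then show "(\<Sum>j<m. ereal (measure (\<nu> j) UNIV) * elog (w (c j)) + logpot (\<nu> j) (c j)) \<le> C_m E w \<mu> F m + sup_total E w m \<nu>"
    using upper_bound_points[OF fam c] by (meson add_right_mono order_trans)
qed

end

section \<open>Sharpness\<close>

text \<open>When \<open>A\<close> and \<open>B\<close> run through two partitions of the plane,
  these measures add up to (1 - \<epsilon>) M + \<epsilon> N.\<close>

definition mixture :: "real \<Rightarrow> complex measure \<Rightarrow> complex set \<Rightarrow> complex measure \<Rightarrow> complex set \<Rightarrow> complex measure" where
  "mixture \<epsilon> M A N B = sum_measure 2 (\<lambda>i. if i = 0 then density M (\<lambda>x. (1 - \<epsilon>) * indicat_real A x)
     else density N (\<lambda>x. \<epsilon> * indicat_real B x))"

lemma mixture: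
  assumes M: "compact_carried M C" and N: "compact_carried N D" and \<epsilon>: "0 \<le> \<epsilon>" "\<epsilon> \<le> 1"
    and [measurable]: "A \<in> sets borel" "B \<in> sets borel"
  shows "compact_carried (mixture \<epsilon> M A N B) (C \<union> D)"
    and "\<And>g :: complex \<Rightarrow> real. continuous_on UNIV g \<Longrightarrow> integral\<^sup>L (mixture \<epsilon> M A N B) g
      = (1 - \<epsilon>) * (\<integral>x. indicat_real A x * g x \<partial>M) + \<epsilon> * (\<integral>x. indicat_real B x * g x \<partial>N)"
proof -
  interpret M: compact_carried M C by fact
  interpret N: compact_carried N D by fact
  define Q where "Q i = (if i = 0 then density M (\<lambda>x. (1 - \<epsilon>) * indicat_real A x)
     else density N (\<lambda>x. \<epsilon> * indicat_real B x))" for i :: nat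
  define P where "P i = (if i = 0 then C else D)" for i :: nat
  have "compact_carried (density M (\<lambda>x. (1 - \<epsilon>) * indicat_real A x)) C"
    by (rule M.compact_carried_density) (use \<epsilon> M.compact_C in \<open>auto simp: indicator_def\<close>)
  moreover have "compact_carried (density N (\<lambda>x. \<epsilon> * indicat_real B x)) D"
    by (rule N.compact_carried_density) (use \<epsilon> N.compact_C in \<open>auto simp: indicator_def\<close>)
  ultimately have Q: "compact_carried (Q i) (P i)" for i by (simp add: Q_def P_def)
  have U: "(\<Union>j<2. P j) = C \<union> D" by (auto simp: P_def lessThan_nat_numeral numeral_2_eq_2 lessThan_Suc)
  have mx: "mixture \<epsilon> M A N B = sum_measure 2 Q" by (simp add: mixture_def Q_def[abs_def])
  show "compact_carried (mixture \<epsilon> M A N B) (C \<union> D)"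
    unfolding mx U[symmetric] by (rule compact_carried_sum_measure[OF Q])
  fix g :: "complex \<Rightarrow> real" assume g: "continuous_on UNIV g"
  have gm: "g \<in> borel_measurable borel" by (rule borel_measurable_continuous_onI[OF g])
  have "integral\<^sup>L (mixture \<epsilon> M A N B) g = integral\<^sup>L (Q 0) g + integral\<^sup>L (Q 1) g"
    unfolding mx integral_sum_measure[OF Q g] by (simp add: numeral_2_eq_2)
  also have "integral\<^sup>L (Q 0) g = (\<integral>x. (1 - \<epsilon>) * indicat_real A x * g x \<partial>M)"
    unfolding Q_def using \<epsilon> gm by (simp add: M.integral_density_real)
  also have "\<dots> = (1 - \<epsilon>) * (\<integral>x. indicat_real A x * g x \<partial>M)" by (simp add: mult.assoc)
  also have "integral\<^sup>L (Q 1) g = (\<integral>x. \<epsilon> * indicat_real B x * g x \<partial>N)"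
    unfolding Q_def using \<epsilon> gm by (simp add: N.integral_density_real)
  also have "\<dots> = \<epsilon> * (\<integral>x. indicat_real B x * g x \<partial>N)" by (simp add: mult.assoc)
  finally show "integral\<^sup>L (mixture \<epsilon> M A N B) g
      = (1 - \<epsilon>) * (\<integral>x. indicat_real A x * g x \<partial>M) + \<epsilon> * (\<integral>x. indicat_real B x * g x \<partial>N)" .
qed

lemma (in compact_carried) integral_partition:
  fixes g :: "complex \<Rightarrow> real"
  assumes [measurable]: "\<And>k. k < m \<Longrightarrow> A k \<in> sets borel"
    and part: "\<And>z. (\<Sum>k<m. indicat_real (A k) z) = 1" and g: "integrable M g"
  shows "(\<Sum>k<m. \<integral>x. indicat_real (A k) x * g x \<partial>M) = integral\<^sup>L M g"
proof -
  have "integrable M (\<lambda>x. indicat_real (A k) x * g x)" if "k < m" for k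
    by (rule integrable_mult_bounded[OF _ _ _ g]) (use assms(1)[OF that] in auto)
  then have "(\<Sum>k<m. \<integral>x. indicat_real (A k) x * g x \<partial>M) = (\<integral>x. (\<Sum>k<m. indicat_real (A k) x * g x) \<partial>M)"
    by (intro Bochner_Integration.integral_sum[symmetric]) auto
  also have "(\<lambda>x. \<Sum>k<m. indicat_real (A k) x * g x) = g"
    by (simp add: sum_distrib_right[symmetric] part)
  finally show ?thesis .
qed

lemma mixture_family_sum:
  fixes g :: "complex \<Rightarrow> real"
  assumes M: "compact_carried M C" and N: "compact_carried N D" and \<epsilon>: "0 \<le> \<epsilon>" "\<epsilon> \<le> 1"
    and A: "\<And>k. k < m \<Longrightarrow> A k \<in> sets borel" "\<And>z. (\<Sum>k<m. indicat_real (A k) z) = 1"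
    and B: "\<And>k. k < m \<Longrightarrow> B k \<in> sets borel" "\<And>z. (\<Sum>k<m. indicat_real (B k) z) = 1"
    and g: "continuous_on UNIV g"
  shows "(\<Sum>k<m. integral\<^sup>L (mixture \<epsilon> M (A k) N (B k)) g) = (1 - \<epsilon>) * integral\<^sup>L M g + \<epsilon> * integral\<^sup>L N g"
proof -
  interpret M: compact_carried M C by fact
  interpret N: compact_carried N D by fact
  have "(\<Sum>k<m. integral\<^sup>L (mixture \<epsilon> M (A k) N (B k)) g)
    = (\<Sum>k<m. (1 - \<epsilon>) * (\<integral>x. indicat_real (A k) x * g x \<partial>M) + \<epsilon> * (\<integral>x. indicat_real (B k) x * g x \<partial>N))"
    by (intro sum.cong refl mixture(2)[OF M N \<epsilon>] A B g) auto
  also have "\<dots> = (1 - \<epsilon>) * integral\<^sup>L M g + \<epsilon> * integral\<^sup>L N g"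
    unfolding sum.distrib sum_distrib_left[symmetric]
    by (simp add: M.integral_partition[OF A M.integrable_cont[OF g]] N.integral_partition[OF B N.integrable_cont[OF g]])
  finally show ?thesis .
qed

text \<open>Ties are broken in favour of the least index, which makes the pieces disjoint.\<close>

lemma sum_indicator_least:
  fixes P :: "nat \<Rightarrow> 'a \<Rightarrow> bool"
  assumes "\<And>z. \<exists>k<m. P k z"
  shows "(\<Sum>k<m. indicat_real {z. P k z \<and> (\<forall>j<k. \<not> P j z)} z) = 1"
proof -
  define k0 where "k0 = (LEAST k. P k z)"
  obtain k where k: "k < m" "P k z" using assms by blast
  have k0: "P k0 z" "k0 < m" "\<And>j. j < k0 \<Longrightarrow> \<not> P j z"
    unfolding k0_def using k LeastI[of "\<lambda>k. P k z"] Least_le[of "\<lambda>k. P k z" k] not_less_Least by auto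
  have "P k z \<and> (\<forall>j<k. \<not> P j z) \<longleftrightarrow> k = k0" for k
    using k0 by (metis linorder_neqE_nat)
  then have "(\<Sum>k<m. indicat_real {z. P k z \<and> (\<forall>j<k. \<not> P j z)} z) = (\<Sum>k<m. if k = k0 then 1 else 0)"
    by (intro sum.cong) (auto simp: indicator_def)
  then show ?thesis using k0 by simp
qed

lemma sum_indicator_two:
  assumes "i < m" "j < m" "i \<noteq> j"
  shows "(\<Sum>k<m::nat. indicat_real (if k = i then A else if k = j then - A else {}) z) = 1"
proof -
  have "(\<Sum>k<m. indicat_real (if k = i then A else if k = j then - A else {}) z)
    = (\<Sum>k<m. (if k = i then indicat_real A z else 0) + (if k = j then 1 - indicat_real A z else 0))"
    using assms by (intro sum.cong) (auto simp: indicator_def)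
  also have "\<dots> = 1" using assms by (simp add: sum.distrib)
  finally show ?thesis .
qed

lemma uniform_points_measure:
  fixes z :: "nat \<Rightarrow> complex"
  assumes n: "0 < n" and C: "compact C" "\<And>i. z i \<in> C"
  obtains \<tau> where "compact_carried \<tau> C" "measure \<tau> UNIV = 1" "\<forall>r x. 0 < r \<longrightarrow> rpot r \<tau> x = (\<Sum>i<n. ln (max r (cmod (x - z i)))) / n"
proof -
  define U where "U = uniform_count_measure {..<n}"
  have Up: "prob_space U" unfolding U_def by (rule prob_space_uniform_count_measure) (use n in auto)
  have zm: "z \<in> borel_measurable U"
    unfolding U_def by (auto simp: measurable_def sets_uniform_count_measure space_uniform_count_measure)
  show ?thesis
  proof
    show "compact_carried (distr U borel z) C" "measure (distr U borel z) UNIV = 1"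
      by (rule distr_compact_carried[OF Up zm C(2,1)])+
    show "\<forall>r x. 0 < r \<longrightarrow> rpot r (distr U borel z) x = (\<Sum>i<n. ln (max r (cmod (x - z i)))) / n"
    proof (intro allI impI)
      fix r :: real and x
      have "rpot r (distr U borel z) x = (\<integral>i. ln (max r (cmod (x - z i))) \<partial>U)"
        unfolding rpot_def by (rule integral_distr[OF zm]) measurable
      also have "\<dots> = (\<Sum>i<n. ln (max r (cmod (x - z i)))) / n" unfolding U_def by (subst integral_uniform_count_measure) auto
      finally show "rpot r (distr U borel z) x = (\<Sum>i<n. ln (max r (cmod (x - z i)))) / n" .
    qed
  qed
qed

text \<open>The truncated product is continuous in \<open>r\<close> down to 0. The slack 1 in 1 - T
  makes the bound at 0 strict, so it survives for some small positive \<open>r\<close>.\<close>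

lemma small_product_rpot:
  fixes z :: "nat \<Rightarrow> complex"
  assumes n: "0 < n" and p: "(\<Prod>i<n. cmod (x - z i)) \<le> exp (- T * n)"
  shows "\<exists>r>0. r \<le> 1 \<and> (\<Sum>i<n. ln (max r (cmod (x - z i)))) / n \<le> 1 - T"
proof -
  have "((\<lambda>r. \<Prod>i<n. max r (cmod (x - z i))) \<longlongrightarrow> (\<Prod>i<n. max 0 (cmod (x - z i)))) (at_right 0)"
    by (intro tendsto_intros)
  moreover have "(\<Prod>i<n. max 0 (cmod (x - z i))) < exp ((1 - T) * n)"
  proof -
    have "(\<Prod>i<n. max 0 (cmod (x - z i))) \<le> exp (- T * n)" using p by simp
    also have "\<dots> < exp ((1 - T) * n)" using n by (simp add: algebra_simps)
    finally show ?thesis .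
  qed
  ultimately have "\<forall>\<^sub>F r in at_right 0. (\<Prod>i<n. max r (cmod (x - z i))) < exp ((1 - T) * n)"
    by (rule order_tendstoD(2))
  moreover have "\<forall>\<^sub>F r in at_right (0::real). r \<in> {0<..<1}" by (rule eventually_at_right_real) simp
  ultimately have "\<forall>\<^sub>F r in at_right 0. r \<in> {0<..<1} \<and> (\<Prod>i<n. max r (cmod (x - z i))) < exp ((1 - T) * n)"
    by eventually_elim auto
  then obtain r where r: "0 < r" "r < 1" "(\<Prod>i<n. max r (cmod (x - z i))) < exp ((1 - T) * n)"
    using eventually_happens'[OF trivial_limit_at_right_real] by force
  have pos: "0 < max r (cmod (x - z i))" for i using r by simp
  have "exp (\<Sum>i<n. ln (max r (cmod (x - z i)))) = (\<Prod>i<n. max r (cmod (x - z i)))"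
    by (simp add: exp_sum exp_ln[OF pos])
  then have "(\<Sum>i<n. ln (max r (cmod (x - z i)))) < (1 - T) * n" using r(3) by (metis exp_less_cancel_iff)
  then have "(\<Sum>i<n. ln (max r (cmod (x - z i)))) / n \<le> 1 - T" using n by (simp add: pos_divide_le_eq)
  then show ?thesis using r by (intro exI[of _ r]) auto
qed

lemma eint_mono: "(\<And>x. f x \<le> g x) \<Longrightarrow> eint M f \<le> eint M g"
  unfolding eint_def
  by (intro ereal_minus_mono) (auto intro!: nn_integral_mono e2ennreal_mono simp: less_eq_ennreal.rep_eq[symmetric])

lemma elog_mono: "x \<le> y \<Longrightarrow> elog x \<le> elog y"
  by (auto simp: elog_def)

lemma maxdist_mono:
  assumes "0 < m" "\<And>k. k < m \<Longrightarrow> \<exists>l<m. v k * cmod (z - c k) \<le> v' l * cmod (z - c' l)"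
  shows "maxdist v c m z \<le> maxdist v' c' m z"
proof -
  obtain k where k: "k < m" "maxdist v c m z = v k * cmod (z - c k)" by (rule maxdist_attained[OF assms(1)])
  then obtain l where "l < m" "v k * cmod (z - c k) \<le> v' l * cmod (z - c' l)" using assms(2) by blast
  then show ?thesis using k maxdist_ge[of l m v' z c'] by simp
qed

text \<open>No point is closer than half the distance of \<open>c i\<close> and \<open>c j\<close>
  to both of them.\<close>

lemma maxdist_pos:
  assumes "i < m" "j < m" "c i \<noteq> c j" "0 < v i" "0 < v j"
  shows "min (v i) (v j) * (cmod (c i - c j) / 2) \<le> maxdist v c m z"
proof -
  have "cmod (c i - c j) \<le> cmod (z - c i) + cmod (z - c j)"
    using norm_triangle_ineq4[of "z - c j" "z - c i"] by simp
  then have "cmod (c i - c j) / 2 \<le> cmod (z - c i) \<or> cmod (c i - c j) / 2 \<le> cmod (z - c j)" by linarith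
  then show ?thesis
  proof
    assume "cmod (c i - c j) / 2 \<le> cmod (z - c i)"
    then have "min (v i) (v j) * (cmod (c i - c j) / 2) \<le> v i * cmod (z - c i)" using assms by (intro mult_mono) auto
    then show ?thesis using maxdist_ge[OF assms(1), of v z c] by linarith
  next
    assume "cmod (c i - c j) / 2 \<le> cmod (z - c j)"
    then have "min (v i) (v j) * (cmod (c i - c j) / 2) \<le> v j * cmod (z - c j)" using assms by (intro mult_mono) auto
    then show ?thesis using maxdist_ge[OF assms(2), of v z c] by linarith
  qed
qed

lemma continuous_on_maxdist:
  assumes "0 < m" "\<And>k. k < m \<Longrightarrow> 0 \<le> v k"
  shows "continuous_on A (maxdist v c m)"
proof -
  have "0 \<le> v 0 * cmod (z - c 0)" for z using assms by simp
  then have "0 \<le> maxdist v c m z" for z using maxdist_ge[OF assms(1), of v z c] order_trans by blast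
  then have "(\<lambda>z. max 0 (maxdist v c m z)) = maxdist v c m" by (simp add: fun_eq_iff)
  then show ?thesis using continuous_on_max_maxdist[OF assms(1), of A 0 v c] by (simp only:)
qed

context weighted_setting begin

text \<open>Passing to a nearest point of the support at most doubles distances and so costs
  \<open>ln 2\<close>.\<close>

lemma potential_lower:
  obtains B where "0 \<le> B" "\<forall>z r. 0 < r \<longrightarrow> - B \<le> rpot r \<mu> z"
proof -
  obtain B where B: "0 \<le> B" "\<And>z r. z \<in> S \<Longrightarrow> 0 < r \<Longrightarrow> - B \<le> rpot r \<mu> z" by (rule potential_lower_on_support) blast
  have "- (B + ln 2) \<le> rpot r \<mu> z" if r: "0 < r" for z r
  proof -
    obtain y where y: "y \<in> S" "\<And>t. t \<in> S \<Longrightarrow> cmod (y - t) \<le> 2 * cmod (z - t)"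
      using nearest_point[OF S_props(1), of z] two_support_points by blast
    have "- (B + ln 2) \<le> rpot r \<mu> y - ln 2" using B(2)[OF y(1) r] by simp
    also have "\<dots> = (\<integral>t. ln (max r (cmod (y - t))) - ln 2 \<partial>\<mu>)"
      unfolding rpot_def using r mu_mass
      by (subst Bochner_Integration.integral_diff) (auto intro!: mu.kernel_integrable simp: mu.space_eq)
    also have "\<dots> \<le> rpot r \<mu> z"
      unfolding rpot_def
      by (intro mu.integral_mono_C continuous_on_diff continuous_on_trunc_log continuous_intros trunc_log_double)
         (use r y in auto)
    finally show ?thesis .
  qed
  then show ?thesis using that[of "B + ln 2"] B(1) by simp
qed

text \<open>The points where log w plus the potential of \<mu> plus \<open>F\<close> is at least
  \<open>h\<close>. The multiplicative form avoids logarithms of zero weights and pairs the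
  semicontinuous \<open>w\<close> with continuous positive factors.\<close>

definition contact :: "real \<Rightarrow> complex set" where
  "contact h = {z\<in>E. \<forall>n. exp h \<le> w z * exp (rpot (1 / Suc n) \<mu> z + F)}"

text \<open>Each condition bounds an upper semicontinuous function from below, hence is closed. Far
  out the exponential of the potential is at most 2|z|, while |z| w(z) tends to 0, so the set is
  bounded.\<close>

lemma contact_compact: "compact (contact h)"
proof -
  have "closed (contact h)"
    unfolding closed_sequential_limits
  proof (intro allI impI, elim conjE)
    fix x l assume x: "\<forall>n. x n \<in> contact h" and l: "x \<longlonglongrightarrow> l"
    have xE: "x k \<in> E" for k using x by (simp add: contact_def)
    then have lE: "l \<in> E" using closed_E l by (meson closed_sequentially)
    have "exp h \<le> w l * exp (rpot (1 / Suc n) \<mu> l + F)" for n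
    proof (rule ccontr)
      define g where "g z = exp (rpot (1 / Suc n) \<mu> z + F)" for z
      have gc: "continuous_on UNIV g" unfolding g_def by (intro continuous_intros mu.rpot_cont) simp
      have gpos: "0 < g z" for z by (simp add: g_def)
      assume "\<not> ?thesis"
      then have "w l * g l < exp h" by (simp only: g_def not_le)
      then have "w l < exp h / g l" using gpos[of l] by (simp add: pos_less_divide_eq)
      then obtain c where c: "w l < c" "c < exp h / g l" using dense by blast
      have c0: "0 < c" using c(1) w_nonneg[OF lE] by simp
      obtain e where e: "e > 0" "\<forall>y\<in>E. dist y l < e \<longrightarrow> w y < c" using w_usc[OF lE c(1)] by blast
      have "\<forall>\<^sub>F k in sequentially. dist (x k) l < e" using l e(1) by (rule tendstoD)
      moreover have "(\<lambda>k. c * g (x k)) \<longlonglongrightarrow> c * g l"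
        by (intro tendsto_mult tendsto_const continuous_on_tendsto_compose[OF gc l]) auto
      then have "\<forall>\<^sub>F k in sequentially. c * g (x k) < exp h"
        using c(2) gpos[of l] by (intro order_tendstoD(2)) (simp_all add: pos_less_divide_eq)
      ultimately have "\<forall>\<^sub>F k in sequentially. dist (x k) l < e \<and> c * g (x k) < exp h" by eventually_elim auto
      then obtain k where k: "dist (x k) l < e" "c * g (x k) < exp h"
        using eventually_happens'[OF sequentially_bot] by force
      have "w (x k) * g (x k) \<le> c * g (x k)" using e(2) xE k(1) gpos[of "x k"] by (intro mult_right_mono) (auto intro: less_imp_le)
      moreover have "exp h \<le> w (x k) * g (x k)" using x by (simp add: contact_def g_def)
      ultimately show False using k(2) by simp
    qed
    then show "l \<in> contact h" using lE by (simp add: contact_def)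
  qed
  moreover have "bounded (contact h)"
  proof -
    obtain R where R: "0 < R" "S \<subseteq> ball 0 R" by (rule mu.C_ball)
    obtain R1 where R1: "R1 \<ge> 1" "\<forall>z\<in>E. R1 < cmod z \<longrightarrow> cmod z * w z < exp (h - F) / 2"
      using weight_at_infinity[of "exp (h - F) / 2"] by auto
    have "cmod z \<le> max R1 R" if z: "z \<in> contact h" for z
    proof (rule ccontr)
      assume "\<not> ?thesis"
      then have zR: "R1 < cmod z" "R < cmod z" by auto
      have zE: "z \<in> E" using z by (simp add: contact_def)
      have "rpot 1 \<mu> z \<le> 1 * ln (2 * cmod z)"
      proof (subst mu_mass[symmetric], rule mu.rpot_upper)
        fix t assume "t \<in> S"
        then have "cmod t < R" using R by auto
        then show "cmod (z - t) \<le> 2 * cmod z" using zR norm_triangle_ineq4[of z t] by linarith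
      qed (use zR R1 in auto)
      then have "exp (rpot 1 \<mu> z) \<le> 2 * cmod z" using zR R by (metis exp_le_cancel_iff exp_ln mult_1 mult_pos_pos order_less_trans zero_less_numeral)
      then have "w z * (exp (rpot 1 \<mu> z) * exp F) \<le> w z * (2 * cmod z * exp F)"
        using w_nonneg[OF zE] by (intro mult_left_mono mult_right_mono) auto
      also have "\<dots> = 2 * exp F * (cmod z * w z)" by simp
      also have "\<dots> < 2 * exp F * (exp (h - F) / 2)" using R1(2) zE zR by (intro mult_strict_left_mono) auto
      also have "\<dots> = exp h" by (simp add: exp_diff)
      finally have "w z * exp (rpot (1 / Suc 0) \<mu> z + F) < exp h" by (simp add: exp_add)
      then show False using z unfolding contact_def by (smt (verit) mem_Collect_eq)
    qed
    then show ?thesis by (auto simp: bounded_iff)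
  qed
  ultimately show ?thesis using compact_eq_bounded_closed by blast
qed

lemma contact_zero_cap:
  assumes "0 < h"
  shows "zero_cap (contact h)"
proof -
  have "contact h \<subseteq> {z\<in>E. logpot \<mu> z + elog (w z) + ereal F > 0}"
  proof
    fix z assume z: "z \<in> contact h"
    then have zE: "z \<in> E" and zn: "\<And>n. exp h \<le> w z * exp (rpot (1 / Suc n) \<mu> z + F)" by (auto simp: contact_def)
    have "w z \<noteq> 0"
    proof
      assume "w z = 0"
      then show False using zn[of 0] by simp
    qed
    then have wz: "0 < w z" using w_nonneg[OF zE] by simp
    have "h - F - ln (w z) \<le> rpot (1 / Suc n) \<mu> z" for n
    proof -
      have "exp h \<le> exp (ln (w z) + (rpot (1 / Suc n) \<mu> z + F))" using zn[of n] wz by (simp add: exp_add)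
      then show ?thesis by simp
    qed
    then have "ereal (h - F - ln (w z)) \<le> logpot \<mu> z" unfolding mu.logpot_INF by (intro INF_greatest) simp
    moreover have "elog (w z) = ereal (ln (w z))" using wz by (simp add: elog_def)
    ultimately have "logpot \<mu> z + elog (w z) + ereal F > 0"
      using assms by (cases "logpot \<mu> z") auto
    then show "z \<in> {z\<in>E. logpot \<mu> z + elog (w z) + ereal F > 0}" using zE by simp
  qed
  then show ?thesis using exceptional unfolding zero_cap_def by (meson order_trans)
qed

lemma not_contact:
  assumes "z \<in> E" "z \<notin> contact h" "0 < w z"
  obtains r where "0 < r" "r \<le> 1" "ln (w z) + rpot r \<mu> z + F < h"
proof -
  obtain n where "w z * exp (rpot (1 / Suc n) \<mu> z + F) < exp h"
    using assms(1,2) by (auto simp: contact_def not_le)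
  then have "exp (ln (w z) + (rpot (1 / Suc n) \<mu> z + F)) < exp h" using assms(3) by (simp add: exp_add)
  then have "ln (w z) + rpot (1 / Suc n) \<mu> z + F < h" by simp
  then show ?thesis by (intro that[of "1 / Suc n"]) auto
qed

text \<open>The potential of \<open>\<mu>\<close> may exceed \<open>- F - log w\<close> on a set of zero capacity. A small multiple of a
  measure with very negative potential there is mixed in; it is split between two distinct points
  \<open>c\<^sub>i\<close>, \<open>c\<^sub>j\<close>, each receiving the part away from it, which is where at least two measures are needed.\<close>

lemma sharp_points:
  assumes c: "\<And>k. k < m \<Longrightarrow> c k \<in> E"
    and ij: "i < m" "j < m" "c i \<noteq> c j" "0 < w (c i)" "0 < w (c j)"
    and x: "x < (\<integral>z. ln (maxdist (\<lambda>k. w (c k)) c m z) \<partial>\<mu>) + F"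
  shows "\<exists>\<nu>. measure_family m \<nu> \<and> ereal x + sup_total E w m \<nu> < lhs_sum E w m \<nu>"
proof -
  define v where "v k = w (c k)" for k
  define f where "f = maxdist v c m"
  have m: "0 < m" using ij by auto
  have v0: "0 \<le> v k" if "k < m" for k using w_nonneg c[OF that] by (simp add: v_def)
  define d where "d = cmod (c i - c j)"
  have d: "0 < d" using ij by (simp add: d_def)
  have iNj: "i \<noteq> j" using ij by auto
  have vij: "0 < v i" "0 < v j" using ij by (auto simp: v_def)
  have fpos: "0 < f z" for z
  proof -
    have "0 < min (v i) (v j) * (d / 2)" using vij d by simp
    also have "\<dots> \<le> f z" unfolding f_def d_def by (rule maxdist_pos) (use ij vij in auto)
    finally show ?thesis .
  qed
  have fc: "continuous_on UNIV f" unfolding f_def by (rule continuous_on_maxdist[OF m v0])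
  have lfc: "continuous_on UNIV (\<lambda>z. ln (f z))" using fc fpos by (intro continuous_on_ln) (auto simp: less_le)
  define I where "I = (\<integral>z. ln (f z) \<partial>\<mu>)"
  have xI: "x < I + F" using x by (simp add: I_def f_def v_def[abs_def])
  \<comment> \<open>-\<Lambda> bounds the logarithm of the weighted distance to \<open>c i\<close>
    or \<open>c j\<close> from below at distance at least d/2.\<close>
  define \<Lambda> where "\<Lambda> = \<bar>ln (v i * (d / 2))\<bar> + \<bar>ln (v j * (d / 2))\<bar>"
  obtain B where B: "0 \<le> B" "\<forall>z r. 0 < r \<longrightarrow> - B \<le> rpot r \<mu> z" by (rule potential_lower)
  obtain W where W: "1 \<le> W" "\<And>z. z \<in> E \<Longrightarrow> w z \<le> W" by (rule weight_bounds) blast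
  \<comment> \<open>The gap is divided into three: the excess allowed outside the contact set, the
    cost \<epsilon> (C1 + I + \<Lambda>) of mixing, and a remainder that keeps the final inequality
    strict.\<close>
  define h where "h = (I + F - x) / 3"
  have h: "0 < h" using xI by (simp add: h_def)
  have Kc: "compact (contact h)" by (rule contact_compact)
  define K where "K = contact h \<union> S"
  have K: "compact K" unfolding K_def using Kc S_props(1) by (rule compact_Un)
  obtain R where R: "1 \<le> R" "K \<subseteq> ball 0 R"
  proof -
    obtain R0 where "\<forall>z\<in>K. cmod z \<le> R0" using compact_imp_bounded[OF K] by (auto simp: bounded_iff)
    then have "K \<subseteq> ball 0 (max 1 (R0 + 1))" by (auto simp: subset_iff less_max_iff_disj intro: order_le_less_trans)
    then show ?thesis by (intro that[of "max 1 (R0 + 1)"]) auto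
  qed
  \<comment> \<open>\<open>C1\<close> bounds the potential of \<tau> minus that of \<mu>: ln(3R) + B
    for |z| \<le> 2R and ln 3 farther out. The summand 1 provides 1 + B \<le> C1, used on the
    contact set.\<close>
  define C1 where "C1 = ln (3 * R) + B + 1"
  have "ln 3 \<le> ln (3 * R)" using R by (intro ln_mono) auto
  moreover have "0 \<le> ln (3 * R)" using R by simp
  ultimately have C1: "ln 3 \<le> C1" "1 + B \<le> C1" using B(1) by (auto simp: C1_def)
  define \<epsilon> where "\<epsilon> = min (1/2) (h / (\<bar>C1 + I + \<Lambda>\<bar> + 1))"
  have \<epsilon>: "0 < \<epsilon>" "\<epsilon> \<le> 1/2" "\<epsilon> * (C1 + I + \<Lambda>) \<le> h"
  proof -
    show "0 < \<epsilon>" using h by (simp add: \<epsilon>_def)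
    show "\<epsilon> \<le> 1/2" unfolding \<epsilon>_def by (rule min.cobounded1)
    have "\<epsilon> * (C1 + I + \<Lambda>) \<le> \<epsilon> * (\<bar>C1 + I + \<Lambda>\<bar> + 1)" using \<open>0 < \<epsilon>\<close> by (intro mult_left_mono) auto
    also have "\<dots> \<le> h / (\<bar>C1 + I + \<Lambda>\<bar> + 1) * (\<bar>C1 + I + \<Lambda>\<bar> + 1)" by (intro mult_right_mono) (auto simp: \<epsilon>_def)
    also have "\<dots> = h" by simp
    finally show "\<epsilon> * (C1 + I + \<Lambda>) \<le> h" .
  qed
  define C2 where "C2 = ln W + ln (2 * R)"
  \<comment> \<open>Since \<open>C2\<close> bounds ln w plus the potential of \<mu> on the contact
    set, \<epsilon> T = C2 + F is exactly the depth that brings the mixture down to -F there, up to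
    \<epsilon> (1 + B).\<close>
  define T where "T = (C2 + F) / \<epsilon>"
  obtain n and \<zeta> :: "nat \<Rightarrow> complex" where n: "0 < n" "\<And>i. \<zeta> i \<in> K"
    "\<And>x. x \<in> contact h \<Longrightarrow> (\<Prod>i<n. cmod (x - \<zeta> i)) \<le> exp (- T * n)"
  proof (cases "contact h = {}")
    case True
    obtain a where "a \<in> S" using two_support_points by blast
    then show ?thesis using that[of 1 "\<lambda>_. a"] True by (auto simp: K_def)
  next
    case False
    show ?thesis
      by (rule zero_cap_small_product[OF Kc False contact_zero_cap[OF h], of T], rule that) (auto simp: K_def)
  qed
  obtain \<tau> where \<tau>: "compact_carried \<tau> K" "measure \<tau> UNIV = 1"
    "\<forall>r x. 0 < r \<longrightarrow> rpot r \<tau> x = (\<Sum>i<n. ln (max r (cmod (x - \<zeta> i)))) / n"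
    by (rule uniform_points_measure[OF n(1) K n(2)]) (rule that)
  interpret tau: compact_carried \<tau> K by (rule \<tau>(1))
  have \<tau>deep: "\<exists>r>0. r \<le> 1 \<and> rpot r \<tau> z \<le> 1 - T" if "z \<in> contact h" for z
    using small_product_rpot[OF n(1) n(3)[OF that]] \<tau>(3) by auto
  have compare: "rpot r \<tau> z - rpot r \<mu> z \<le> C1" if r: "0 < r" "r \<le> 1" for r z
  proof (cases "cmod z \<le> 2 * R")
    case True
    have "rpot r \<tau> z \<le> 1 * ln (3 * R)"
    proof (subst \<tau>(2)[symmetric], rule tau.rpot_upper)
      fix t assume "t \<in> K"
      then have "cmod t < R" using R by auto
      then show "cmod (z - t) \<le> 3 * R" using True norm_triangle_ineq4[of z t] by linarith
    qed (use r R in auto)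
    moreover have "- B \<le> rpot r \<mu> z" using B(2) r by simp
    ultimately show ?thesis by (simp add: C1_def)
  next
    case False
    have ct: "cmod t < R" if "t \<in> K" for t using that R by auto
    have "rpot r \<tau> z \<le> 1 * ln (cmod z + R)"
    proof (subst \<tau>(2)[symmetric], rule tau.rpot_upper)
      fix t assume "t \<in> K"
      then show "cmod (z - t) \<le> cmod z + R" using ct[of t] norm_triangle_ineq4[of z t] by linarith
    qed (use r R(1) norm_ge_zero[of z] in linarith)+
    moreover have "1 * ln (cmod z - R) \<le> rpot r \<mu> z"
    proof (subst mu_mass[symmetric], rule mu.rpot_lower)
      fix t assume "t \<in> S"
      then show "cmod z - R \<le> cmod (z - t)" using ct[of t] norm_triangle_ineq2[of z t] by (simp add: K_def)
    qed (use r R False in auto)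
    moreover have "ln (cmod z + R) \<le> ln 3 + ln (cmod z - R)"
    proof -
      have "ln (cmod z + R) \<le> ln (3 * (cmod z - R))" using R False by (intro ln_mono) auto
      also have "\<dots> = ln 3 + ln (cmod z - R)" using R(1) False by (subst ln_mult) auto
      finally show ?thesis .
    qed
    ultimately show ?thesis using C1(1) by linarith
  qed
  define P where "P k z \<longleftrightarrow> v k * cmod (z - c k) = f z" for k z
  \<comment> \<open>On the k-th piece the weighted distance to \<open>c k\<close> is the maximum
    \<open>f\<close> itself, so evaluating at \<open>c k\<close> loses nothing there.\<close>
  define Sk where "Sk k = {z. P k z \<and> (\<forall>l<k. \<not> P l z)}" for k
  \<comment> \<open>Points at distance at least d/2 from \<open>c i\<close> go to \<open>i\<close>.
    The others are farther than d/2 from \<open>c j\<close> and go to \<open>j\<close>.\<close>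
  define A where "A = {z. d / 2 \<le> cmod (z - c i)}"
  define Tk where "Tk k = (if k = i then A else if k = j then - A else {})" for k
  have Pm: "{z. P k z} \<in> sets borel" for k
    unfolding P_def by (intro borel_closed closed_Collect_eq continuous_intros fc)
  have Skm: "Sk k \<in> sets borel" for k
  proof -
    have "Sk k = {z. P k z} - (\<Union>l<k. {z. P l z})" by (auto simp: Sk_def)
    then show ?thesis using Pm by auto
  qed
  have Am: "A \<in> sets borel" unfolding A_def by (intro borel_closed closed_Collect_le continuous_intros)
  then have Tkm: "Tk k \<in> sets borel" for k by (auto simp: Tk_def)
  have Skp: "(\<Sum>k<m. indicat_real (Sk k) z) = 1" for z
    unfolding Sk_def
  proof (rule sum_indicator_least)
    fix z
    show "\<exists>k<m. P k z" using maxdist_attained[OF m, of v c z] unfolding P_def f_def by metis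
  qed
  have Tkp: "(\<Sum>k<m. indicat_real (Tk k) z) = 1" for z
    unfolding Tk_def by (rule sum_indicator_two[OF ij(1,2) iNj])
  define \<nu> where "\<nu> k = mixture \<epsilon> \<mu> (Sk k) \<tau> (Tk k)" for k
  have \<epsilon>01: "0 \<le> \<epsilon>" "\<epsilon> \<le> 1" using \<epsilon> by auto
  have nu: "compact_carried (\<nu> k) (S \<union> K)" for k
    unfolding \<nu>_def by (rule mixture(1)[OF mu_carried \<tau>(1) \<epsilon>01 Skm Tkm])
  have nint: "integral\<^sup>L (\<nu> k) g = (1 - \<epsilon>) * (\<integral>z. indicat_real (Sk k) z * g z \<partial>\<mu>) + \<epsilon> * (\<integral>z. indicat_real (Tk k) z * g z \<partial>\<tau>)"
    if "continuous_on UNIV g" for g :: "complex \<Rightarrow> real" and k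
    unfolding \<nu>_def by (rule mixture(2)[OF mu_carried \<tau>(1) \<epsilon>01 Skm Tkm that])
  have nsum: "(\<Sum>k<m. integral\<^sup>L (\<nu> k) g) = (1 - \<epsilon>) * integral\<^sup>L \<mu> g + \<epsilon> * integral\<^sup>L \<tau> g"
    if "continuous_on UNIV g" for g :: "complex \<Rightarrow> real"
    unfolding \<nu>_def by (rule mixture_family_sum[OF mu_carried \<tau>(1) \<epsilon>01 Skm Skp Tkm Tkp that])
  define \<alpha> where "\<alpha> k = measure (\<nu> k) UNIV" for k
  have \<alpha>int: "integral\<^sup>L (\<nu> k) (\<lambda>_. y) = \<alpha> k * y" for k and y :: real
    using compact_carried.space_eq[OF nu[of k]] by (simp add: \<alpha>_def)
  have fam: "measure_family m \<nu>"
    unfolding measure_family_def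
  proof (intro conjI allI impI)
    show "cs_borel_measure (\<nu> k)" for k by (rule compact_carried_cs_borel[OF nu])
    show "(\<Sum>j<m. measure (\<nu> j) UNIV) = 1"
      using nsum[of "\<lambda>_. 1"] \<alpha>int[of _ 1] mu_mass \<tau>(2) by (simp add: mu.space_eq tau.space_eq \<alpha>_def)
  qed
  have sup: "sup_total E w m \<nu> \<le> ereal (- F + h + \<epsilon> * C1)"
    unfolding sup_total_def
  proof (rule SUP_least)
    fix z assume z: "z \<in> E"
    have lf: "(\<Sum>k<m. logpot (\<nu> k) z) \<noteq> \<infinity>"
      using compact_carried.logpot_finite[OF nu] by (auto simp: sum_Pinfty)
    show "elog (w z) + (\<Sum>k<m. logpot (\<nu> k) z) \<le> ereal (- F + h + \<epsilon> * C1)"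
    proof (cases "w z = 0")
      case True
      then show ?thesis using lf by (cases "\<Sum>k<m. logpot (\<nu> k) z") (auto simp: elog_def)
    next
      case False
      then have wz: "0 < w z" using w_nonneg[OF z] by simp
      have up: "elog (w z) + (\<Sum>k<m. logpot (\<nu> k) z) \<le> ereal (ln (w z) + rpot r \<mu> z + \<epsilon> * (rpot r \<tau> z - rpot r \<mu> z))" if r: "0 < r" for r
      proof -
        have "(\<Sum>k<m. logpot (\<nu> k) z) \<le> (\<Sum>k<m. ereal (rpot r (\<nu> k) z))"
          by (intro sum_mono compact_carried.logpot_le_rpot[OF nu r])
        also have "\<dots> = ereal ((1 - \<epsilon>) * rpot r \<mu> z + \<epsilon> * rpot r \<tau> z)"
          unfolding rpot_def sum_ereal
          by (subst nsum) (intro continuous_on_trunc_log continuous_on_diff continuous_on_const continuous_on_id r, simp)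
        finally have "elog (w z) + (\<Sum>k<m. logpot (\<nu> k) z) \<le> ereal (ln (w z)) + ereal ((1 - \<epsilon>) * rpot r \<mu> z + \<epsilon> * rpot r \<tau> z)"
          using wz by (intro add_mono) (auto simp: elog_def)
        also have "\<dots> = ereal (ln (w z) + rpot r \<mu> z + \<epsilon> * (rpot r \<tau> z - rpot r \<mu> z))" by (simp add: algebra_simps)
        finally show ?thesis .
      qed
      \<comment> \<open>The radius may depend on \<open>z\<close>, because every truncation
        majorises the logarithmic potential.\<close>
      have "\<exists>r>0. ln (w z) + rpot r \<mu> z + \<epsilon> * (rpot r \<tau> z - rpot r \<mu> z) \<le> - F + h + \<epsilon> * C1"
      proof (cases "z \<in> contact h")
        case False
        obtain r where r: "0 < r" "r \<le> 1" "ln (w z) + rpot r \<mu> z + F < h" by (rule not_contact[OF z False wz])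
        have "\<epsilon> * (rpot r \<tau> z - rpot r \<mu> z) \<le> \<epsilon> * C1" using compare[OF r(1,2)] \<epsilon>(1) by (intro mult_left_mono) auto
        then show ?thesis using r by (intro exI[of _ r]) auto
      next
        case True
        then obtain r where r: "0 < r" "r \<le> 1" "rpot r \<tau> z \<le> 1 - T" using \<tau>deep by blast
        have "rpot r \<mu> z \<le> 1 * ln (2 * R)"
        proof (subst mu_mass[symmetric], rule mu.rpot_upper)
          fix t assume "t \<in> S"
          then have "cmod t < R" "cmod z < R" using R True by (auto simp: K_def)
          then show "cmod (z - t) \<le> 2 * R" using norm_triangle_ineq4[of z t] by linarith
        qed (use r R in auto)
        moreover have "ln (w z) \<le> ln W" using wz W(2)[OF z] by (intro ln_mono) auto
        ultimately have 1: "ln (w z) + rpot r \<mu> z \<le> C2" by (simp add: C2_def)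
        have "rpot r \<tau> z - rpot r \<mu> z \<le> (1 - T) + B" using r(3) B(2) r(1) by (smt (verit))
        then have "\<epsilon> * (rpot r \<tau> z - rpot r \<mu> z) \<le> \<epsilon> * ((1 - T) + B)" using \<epsilon>(1) by (intro mult_left_mono) auto
        also have "\<dots> = \<epsilon> * (1 + B) - (C2 + F)" using \<epsilon>(1) by (simp add: T_def field_simps)
        also have "\<dots> \<le> \<epsilon> * C1 - (C2 + F)" using C1(2) \<epsilon>(1) by simp
        finally show ?thesis using 1 r(1) h by (intro exI[of _ r]) auto
      qed
      then obtain r where "0 < r" "ln (w z) + rpot r \<mu> z + \<epsilon> * (rpot r \<tau> z - rpot r \<mu> z) \<le> - F + h + \<epsilon> * C1" by blast
      then show ?thesis using up[of r] by (meson ereal_less_eq(3) order_trans)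
    qed
  qed
  have term_ge: "ereal ((1 - \<epsilon>) * (\<integral>z. indicat_real (Sk k) z * ln (f z) \<partial>\<mu>) + \<epsilon> * (\<integral>z. indicat_real (Tk k) z * (- \<Lambda>) \<partial>\<tau>))
     \<le> ereal (measure (\<nu> k) UNIV) * elog (w (c k)) + logpot (\<nu> k) (c k)" (is "ereal ?t \<le> _") if k: "k < m" for k
  proof -
    interpret nk: compact_carried "\<nu> k" "S \<union> K" by (rule nu)
    have kc: "continuous_on UNIV (\<lambda>t. ln (max r (cmod (c k - t))))" if "0 < r" for r
      by (intro continuous_on_trunc_log continuous_on_diff continuous_on_const continuous_on_id that)
    show ?thesis
    \<comment> \<open>If the weight vanishes, \<open>c k\<close> never attains the positive maximum
      \<open>f\<close> and is neither \<open>c i\<close> nor \<open>c j\<close>; both pieces are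
      then empty and the k-th measure is 0.\<close>
    proof (cases "v k = 0")
      case True
      have e: "Sk k = {}" "Tk k = {}" using True fpos vij by (auto simp: Sk_def P_def Tk_def less_le)
      have z: "integral\<^sup>L (\<nu> k) g = 0" if "continuous_on UNIV g" for g :: "complex \<Rightarrow> real"
        using nint[OF that, of k] by (simp add: e)
      have "measure (\<nu> k) UNIV = 0" using z[of "\<lambda>_. 1"] \<alpha>int[of k 1] by (simp add: \<alpha>_def)
      moreover have "rpot r (\<nu> k) (c k) = 0" if "0 < r" for r unfolding rpot_def by (rule z[OF kc[OF that]])
      then have "0 \<le> logpot (\<nu> k) (c k)" unfolding nk.logpot_INF by (intro INF_greatest) simp
      ultimately show ?thesis by (simp add: e zero_ereal_def[symmetric])
    next
      case False
      then have vk: "0 < v k" using v0[OF k] by simp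
      have "?t \<le> \<alpha> k * ln (v k) + rpot r (\<nu> k) (c k)" if r: "0 < r" for r
      proof -
        define g where "g t = ln (v k) + ln (max r (cmod (c k - t)))" for t
        have gc: "continuous_on UNIV g" unfolding g_def by (intro continuous_on_add continuous_on_const kc r)
        have ge: "ln (v k * cmod (t - c k)) \<le> g t" if "t \<noteq> c k" for t
        proof -
          have "ln (v k * cmod (t - c k)) = ln (v k) + ln (cmod (c k - t))"
            using vk that by (simp add: ln_mult norm_minus_commute)
          also have "\<dots> \<le> g t" unfolding g_def using r that by (intro add_left_mono ln_mono) auto
          finally show ?thesis .
        qed
        have gS: "indicat_real (Sk k) t * ln (f t) \<le> indicat_real (Sk k) t * g t" for t
        proof (cases "t \<in> Sk k")
          case True
          then have e: "v k * cmod (t - c k) = f t" by (simp add: Sk_def P_def)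
          then have "t \<noteq> c k" using fpos[of t] by auto
          then show ?thesis using ge[of t] e True by simp
        qed simp
        have gT: "indicat_real (Tk k) t * (- \<Lambda>) \<le> indicat_real (Tk k) t * g t" for t
        proof (cases "t \<in> Tk k")
          case True
          have kij: "k = i \<or> k = j" using True by (auto simp: Tk_def split: if_splits)
          have dist: "d / 2 \<le> cmod (t - c k)"
          proof (cases "k = i")
            case True
            then show ?thesis using \<open>t \<in> Tk k\<close> by (simp add: Tk_def A_def)
          next
            case False
            then have "k = j" "cmod (t - c i) < d / 2" using kij True by (auto simp: Tk_def A_def)
            moreover have "d \<le> cmod (t - c i) + cmod (t - c j)"
              using norm_triangle_ineq4[of "t - c j" "t - c i"] by (simp add: d_def)
            ultimately show ?thesis by simp
          qed
          have "- \<Lambda> \<le> ln (v k * (d / 2))" using kij by (auto simp: \<Lambda>_def)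
          also have "\<dots> \<le> ln (v k * cmod (t - c k))" using dist vk d by (intro ln_mono) auto
          also have "\<dots> \<le> g t" by (rule ge) (use dist d in auto)
          finally show ?thesis using True by simp
        qed simp
        have 1: "(\<integral>z. indicat_real (Sk k) z * ln (f z) \<partial>\<mu>) \<le> (\<integral>z. indicat_real (Sk k) z * g z \<partial>\<mu>)"
          by (rule integral_mono[OF _ _ gS]; rule mu.integrable_mult_bounded)
             (use Skm mu.integrable_cont[OF lfc] mu.integrable_cont[OF gc] in auto)
        have 2: "(\<integral>z. indicat_real (Tk k) z * (- \<Lambda>) \<partial>\<tau>) \<le> (\<integral>z. indicat_real (Tk k) z * g z \<partial>\<tau>)"
          by (rule integral_mono[OF _ _ gT]; rule tau.integrable_mult_bounded)
             (use Tkm tau.integrable_cont[OF gc] in auto)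
        have "?t \<le> (1 - \<epsilon>) * (\<integral>z. indicat_real (Sk k) z * g z \<partial>\<mu>) + \<epsilon> * (\<integral>z. indicat_real (Tk k) z * g z \<partial>\<tau>)"
          by (rule add_mono[OF mult_left_mono[OF 1] mult_left_mono[OF 2]]) (use \<epsilon>01 in auto)
        also have "\<dots> = integral\<^sup>L (\<nu> k) g" by (rule nint[OF gc, symmetric])
        also have "\<dots> = \<alpha> k * ln (v k) + rpot r (\<nu> k) (c k)"
          unfolding g_def rpot_def
          by (subst Bochner_Integration.integral_add) (auto simp: nk.kernel_integrable[OF r] nk.space_eq \<alpha>_def)
        finally show ?thesis .
      qed
      then have "?t - \<alpha> k * ln (v k) \<le> rpot r (\<nu> k) (c k)" if "0 < r" for r using that by (simp add: algebra_simps)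
      then have "ereal (?t - \<alpha> k * ln (v k)) \<le> logpot (\<nu> k) (c k)"
        unfolding nk.logpot_INF by (intro INF_greatest) simp
      then have "ereal (\<alpha> k * ln (v k)) + ereal (?t - \<alpha> k * ln (v k)) \<le> ereal (\<alpha> k) * elog (v k) + logpot (\<nu> k) (c k)"
        using vk by (intro add_mono) (auto simp: elog_def)
      then show ?thesis by (simp add: \<alpha>_def v_def)
    qed
  qed
  have lhs: "ereal ((1 - \<epsilon>) * I - \<epsilon> * \<Lambda>) \<le> lhs_sum E w m \<nu>"
  proof -
    have "(1 - \<epsilon>) * I - \<epsilon> * \<Lambda> = (\<Sum>k<m. (1 - \<epsilon>) * (\<integral>z. indicat_real (Sk k) z * ln (f z) \<partial>\<mu>) + \<epsilon> * (\<integral>z. indicat_real (Tk k) z * (- \<Lambda>) \<partial>\<tau>))"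
      unfolding sum.distrib sum_distrib_left[symmetric]
        mu.integral_partition[OF Skm Skp mu.integrable_cont[OF lfc]]
        tau.integral_partition[OF Tkm Tkp tau.integrable_cont[OF continuous_on_const]]
      using \<tau>(2) by (simp add: I_def tau.space_eq)
    then have "ereal ((1 - \<epsilon>) * I - \<epsilon> * \<Lambda>) = (\<Sum>k<m. ereal ((1 - \<epsilon>) * (\<integral>z. indicat_real (Sk k) z * ln (f z) \<partial>\<mu>) + \<epsilon> * (\<integral>z. indicat_real (Tk k) z * (- \<Lambda>) \<partial>\<tau>)))"
      by (simp only: sum_ereal)
    also have "\<dots> \<le> lhs_sum E w m \<nu>"
      unfolding lhs_sum_def
    proof (rule sum_mono)
      fix k assume "k \<in> {..<m}"
      then have k: "k < m" by simp
      show "ereal ((1 - \<epsilon>) * (\<integral>z. indicat_real (Sk k) z * ln (f z) \<partial>\<mu>) + \<epsilon> * (\<integral>z. indicat_real (Tk k) z * (- \<Lambda>) \<partial>\<tau>))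
        \<le> (SUP z\<in>E. ereal (measure (\<nu> k) UNIV) * elog (w z) + logpot (\<nu> k) z)"
        by (rule order_trans[OF term_ge[OF k]]) (rule SUP_upper[OF c[OF k]])
    qed
    finally show ?thesis .
  qed
  have "ereal x + sup_total E w m \<nu> \<le> ereal x + ereal (- F + h + \<epsilon> * C1)" using sup by (intro add_left_mono)
  also have "\<dots> < ereal ((1 - \<epsilon>) * I - \<epsilon> * \<Lambda>)"
  proof -
    have "x - F + h + \<epsilon> * C1 < (1 - \<epsilon>) * I - \<epsilon> * \<Lambda>"
    proof -
      have "3 * h = I + F - x" by (simp add: h_def)
      moreover have "(1 - \<epsilon>) * I = I - \<epsilon> * I" by (simp add: left_diff_distrib)
      ultimately show ?thesis using \<epsilon>(3)[unfolded distrib_left] h by linarith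
    qed
    then show ?thesis by simp
  qed
  also note lhs
  finally show ?thesis using fam by blast
qed

lemma eint_maxdist_real:
  assumes c: "\<And>k. k < m \<Longrightarrow> c k \<in> E"
    and ij: "i < m" "j < m" "c i \<noteq> c j" "0 < w (c i)" "0 < w (c j)"
  shows "eint \<mu> (\<lambda>z. elog (maxdist (\<lambda>k. w (c k)) c m z)) = ereal (\<integral>z. ln (maxdist (\<lambda>k. w (c k)) c m z) \<partial>\<mu>)"
proof -
  have m: "0 < m" using ij by auto
  define f where "f = maxdist (\<lambda>k. w (c k)) c m"
  have fpos: "0 < f z" for z
  proof -
    have "0 < min (w (c i)) (w (c j)) * (cmod (c i - c j) / 2)" using ij by simp
    also have "\<dots> \<le> f z" unfolding f_def by (rule maxdist_pos) (use ij in auto)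
    finally show ?thesis .
  qed
  have "continuous_on UNIV f" unfolding f_def by (rule continuous_on_maxdist[OF m]) (use w_nonneg c in auto)
  then have "integrable \<mu> (\<lambda>z. ln (f z))"
    using fpos by (intro mu.integrable_cont continuous_on_ln) (auto simp: less_le)
  then have "eint \<mu> (\<lambda>z. ereal (ln (f z))) = ereal (\<integral>z. ln (f z) \<partial>\<mu>)" by (rule eint_real)
  moreover have "elog (f z) = ereal (ln (f z))" for z using fpos[of z] by (simp add: elog_def)
  ultimately show ?thesis by (simp add: f_def)
qed

text \<open>If all weights vanish, the first two points are replaced by two support points. If only
  one point of positive weight occurs, every other index repeats it or has zero weight; such an
  index contributes nothing beyond \<open>c i\<close> and can be overwritten. Both cases need room
  for two indices.\<close>

lemma improve_points:
  assumes m: "2 \<le> m" and c: "\<And>k. k < m \<Longrightarrow> c k \<in> E"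
  obtains c' i j where "\<forall>k<m. c' k \<in> E" "i < m" "j < m" "c' i \<noteq> c' j" "0 < w (c' i)" "0 < w (c' j)"
    "\<forall>z. maxdist (\<lambda>k. w (c k)) c m z \<le> maxdist (\<lambda>k. w (c' k)) c' m z"
proof -
  obtain a b where ab: "a \<in> S" "b \<in> S" "a \<noteq> b" using two_support_points by blast
  have abE: "a \<in> E" "b \<in> E" "0 < w a" "0 < w b" using ab S_props support_pos by auto
  have m0: "0 < m" using m by simp
  show ?thesis
  proof (cases "\<exists>i<m. 0 < w (c i)")
    case False
    define c' where "c' = c(0 := a, 1 := b)"
    have z: "w (c k) = 0" if "k < m" for k using False that w_nonneg[OF c[OF that]] by force
    have c'E: "c' k \<in> E" if "k < m" for k using that abE c by (simp add: c'_def)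
    show ?thesis
    proof (rule that[of c' 0 1])
      show "\<forall>x. maxdist (\<lambda>k. w (c k)) c m x \<le> maxdist (\<lambda>k. w (c' k)) c' m x"
      proof (rule allI, rule maxdist_mono[OF m0])
        fix x k assume k: "k < m"
        show "\<exists>l<m. w (c k) * cmod (x - c k) \<le> w (c' l) * cmod (x - c' l)"
          using z[OF k] w_nonneg[OF c'E[OF m0]] m0 by (intro exI[of _ 0]) simp
      qed
    qed (use m abE ab c'E in \<open>auto simp: c'_def\<close>)
  next
    case True
    then obtain i where i: "i < m" "0 < w (c i)" by blast
    show ?thesis
    proof (cases "\<exists>j<m. 0 < w (c j) \<and> c j \<noteq> c i")
      case True
      then obtain j where "j < m" "0 < w (c j)" "c j \<noteq> c i" by blast
      then show ?thesis using i c by (intro that[of c i j]) auto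
    next
      case False
      define q where "q = (if a = c i then b else a)"
      have q: "q \<in> E" "0 < w q" "q \<noteq> c i" using ab abE by (auto simp: q_def)
      define j where "j = (if i = 0 then 1 else 0 :: nat)"
      have j: "j < m" "j \<noteq> i" using m by (auto simp: j_def)
      define c' where "c' = c(j := q)"
      have c'E: "c' k \<in> E" if "k < m" for k using that q c by (simp add: c'_def)
      have c'i: "c' i = c i" using j by (simp add: c'_def)
      show ?thesis
      proof (rule that[of c' i j])
        show "\<forall>x. maxdist (\<lambda>k. w (c k)) c m x \<le> maxdist (\<lambda>k. w (c' k)) c' m x"
        proof (rule allI, rule maxdist_mono[OF m0])
          fix x k assume k: "k < m"
          show "\<exists>l<m. w (c k) * cmod (x - c k) \<le> w (c' l) * cmod (x - c' l)"
          proof (intro exI[of _ i] conjI i(1))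
            show "w (c k) * cmod (x - c k) \<le> w (c' i) * cmod (x - c' i)"
            proof (cases "w (c k) = 0")
              case True
              then show ?thesis using i(2) c'i by simp
            next
              case nz: False
              then have "0 < w (c k)" using w_nonneg[OF c[OF k]] by simp
              then show ?thesis using False k c'i by auto
            qed
          qed
        qed
      qed (use i j q c'E c'i in \<open>auto simp: c'_def\<close>)
    qed
  qed
qed

lemma sharp_m:
  assumes m: "2 \<le> m" and x: "x < C_m E w \<mu> F m"
  shows "\<exists>\<nu>. measure_family m \<nu> \<and> x + sup_total E w m \<nu> < lhs_sum E w m \<nu>"
proof -
  define X where "X = {c :: nat \<Rightarrow> complex. \<forall>k<m. c k \<in> E}"
  have Xne: "X \<noteq> {}" using E_nonempty by (auto simp: X_def)
  have "C_m E w \<mu> F m = (SUP c\<in>X. eint \<mu> (\<lambda>z. elog (maxdist (\<lambda>k. w (c k)) c m z)) + ereal F)"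
    unfolding C_m_def X_def[symmetric] maxdist_def by (rule SUP_ereal_add_left[OF Xne, symmetric]) simp
  with x have "\<exists>c\<in>X. x < eint \<mu> (\<lambda>z. elog (maxdist (\<lambda>k. w (c k)) c m z)) + ereal F"
    by (simp only: less_SUP_iff)
  then obtain c where "c \<in> X" and cx: "x < eint \<mu> (\<lambda>z. elog (maxdist (\<lambda>k. w (c k)) c m z)) + ereal F" by blast
  then have c: "\<And>k. k < m \<Longrightarrow> c k \<in> E" by (simp add: X_def)
  obtain c' i j where c': "\<forall>k<m. c' k \<in> E" "i < m" "j < m" "c' i \<noteq> c' j" "0 < w (c' i)" "0 < w (c' j)"
    "\<forall>z. maxdist (\<lambda>k. w (c k)) c m z \<le> maxdist (\<lambda>k. w (c' k)) c' m z"
    by (rule improve_points[OF m c]) (assumption | rule that)+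
  define I where "I = (\<integral>z. ln (maxdist (\<lambda>k. w (c' k)) c' m z) \<partial>\<mu>)"
  have "eint \<mu> (\<lambda>z. elog (maxdist (\<lambda>k. w (c k)) c m z)) \<le> eint \<mu> (\<lambda>z. elog (maxdist (\<lambda>k. w (c' k)) c' m z))"
    by (intro eint_mono elog_mono c'(7)[rule_format])
  also have "\<dots> = ereal I" unfolding I_def by (rule eint_maxdist_real[OF c'(1)[rule_format] c'(2-6)])
  finally have "eint \<mu> (\<lambda>z. elog (maxdist (\<lambda>k. w (c k)) c m z)) \<le> ereal I" .
  then have "eint \<mu> (\<lambda>z. elog (maxdist (\<lambda>k. w (c k)) c m z)) + ereal F \<le> ereal (I + F)"
    by (metis add_right_mono plus_ereal.simps(1))
  then have "x < ereal (I + F)" using cx by (rule order_less_le_trans[rotated])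
  then obtain y where y: "x < ereal y" "y < I + F" using ereal_dense2[of x "ereal (I + F)"] by auto
  obtain \<nu> where \<nu>: "measure_family m \<nu>" "ereal y + sup_total E w m \<nu> < lhs_sum E w m \<nu>"
    using sharp_points[OF c'(1)[rule_format] c'(2-6) y(2)[unfolded I_def]] by blast
  have "x + sup_total E w m \<nu> \<le> ereal y + sup_total E w m \<nu>" using y(1) by (intro add_right_mono) simp
  then show ?thesis using \<nu> order_le_less_trans by blast
qed

section \<open>The farthest-point distance and the constant independent of \<open>m\<close>\<close>

lemma farthest_bdd: "bdd_above ((\<lambda>t. w t * cmod (z - t)) ` E)"
proof -
  obtain W where W: "1 \<le> W" "\<And>z. z \<in> E \<Longrightarrow> w z \<le> W" "\<And>z. z \<in> E \<Longrightarrow> cmod z * w z \<le> W" by (rule weight_bounds) blast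
  have "w t * cmod (z - t) \<le> W * cmod z + W" if t: "t \<in> E" for t
  proof -
    have "w t * cmod (z - t) \<le> w t * (cmod z + cmod t)"
      using w_nonneg[OF t] norm_triangle_ineq4[of z t] by (intro mult_left_mono) auto
    also have "\<dots> = w t * cmod z + cmod t * w t" by (simp add: algebra_simps)
    also have "\<dots> \<le> W * cmod z + W" using W(2,3)[OF t] by (intro add_mono mult_right_mono) auto
    finally show ?thesis .
  qed
  then show ?thesis by (rule bdd_aboveI2)
qed

lemma farthest_ge: "t \<in> E \<Longrightarrow> w t * cmod (z - t) \<le> farthest_dist E w z"
  unfolding farthest_dist_def by (rule cSUP_upper[OF _ farthest_bdd])

lemma maxdist_le_farthest:
  assumes "0 < m" "\<And>k. k < m \<Longrightarrow> c k \<in> E"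
  shows "maxdist (\<lambda>k. w (c k)) c m z \<le> farthest_dist E w z"
proof -
  obtain k where "k < m" "maxdist (\<lambda>k. w (c k)) c m z = w (c k) * cmod (z - c k)" by (rule maxdist_attained[OF assms(1)])
  then show ?thesis using farthest_ge[OF assms(2)] by simp
qed

lemma C_m_le_C_const:
  assumes "0 < m"
  shows "C_m E w \<mu> F m \<le> C_const E w \<mu> F"
  unfolding C_m_def C_const_def maxdist_def[symmetric]
  by (intro add_right_mono SUP_least eint_mono elog_mono maxdist_le_farthest assms) auto

text \<open>A supremum of functions that share the Lipschitz constant \<open>W\<close>, an upper
  bound of the weight.\<close>

lemma farthest_cont: "continuous_on UNIV (farthest_dist E w)"
proof -
  obtain W where W: "1 \<le> W" "\<And>z. z \<in> E \<Longrightarrow> w z \<le> W" "\<And>z. z \<in> E \<Longrightarrow> cmod z * w z \<le> W" by (rule weight_bounds) blast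
  have le: "farthest_dist E w x \<le> farthest_dist E w y + W * dist x y" for x y
    unfolding farthest_dist_def[of E w x]
  proof (rule cSUP_least[OF E_nonempty])
    fix t assume t: "t \<in> E"
    have "w t * cmod (x - t) \<le> w t * (cmod (y - t) + dist x y)"
      using w_nonneg[OF t] norm_triangle_ineq[of "x - y" "y - t"] by (intro mult_left_mono) (auto simp: dist_norm)
    also have "\<dots> = w t * cmod (y - t) + w t * dist x y" by (simp add: distrib_left)
    also have "\<dots> \<le> farthest_dist E w y + W * dist x y"
      by (intro add_mono farthest_ge mult_right_mono t W) auto
    finally show "w t * cmod (x - t) \<le> farthest_dist E w y + W * dist x y" .
  qed
  have "W-lipschitz_on UNIV (farthest_dist E w)"
  proof (rule lipschitz_onI)
    show "dist (farthest_dist E w x) (farthest_dist E w y) \<le> W * dist x y" for x y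
      using le[of x y] le[of y x] by (simp add: dist_real_def dist_commute abs_le_iff)
  qed (use W in simp)
  then show ?thesis by (rule lipschitz_on_continuous_on)
qed

lemma farthest_pos: "0 < farthest_dist E w z"
proof -
  obtain a b where ab: "a \<in> S" "b \<in> S" "a \<noteq> b" using two_support_points by blast
  then have t: "\<exists>t\<in>E. 0 < w t \<and> t \<noteq> z" using S_props support_pos by (metis subsetD)
  then obtain t where "t \<in> E" "0 < w t" "t \<noteq> z" by blast
  then show ?thesis using farthest_ge[of t z] by (metis mult_pos_pos order_less_le_trans right_minus_eq zero_less_norm_iff)
qed

text \<open>A point of \<open>E\<close> that almost attains the farthest distance at
  \<open>z\<close> does so near \<open>z\<close> as well. Compactness of the support leaves finitely
  many such points, and their maximum is within the factor exp(-\<eta>) of the farthest distance on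
  all of it.\<close>

lemma C_const_approx:
  assumes x: "x < C_const E w \<mu> F"
  shows "\<exists>m\<ge>2. x < C_m E w \<mu> F m"
proof -
  define dd where "dd = farthest_dist E w"
  have dpos: "0 < dd z" for z unfolding dd_def by (rule farthest_pos)
  have dc: "continuous_on UNIV dd" unfolding dd_def by (rule farthest_cont)
  have ldc: "continuous_on UNIV (\<lambda>z. ln (dd z))" using dc dpos by (intro continuous_on_ln) (auto simp: less_le)
  define I where "I = (\<integral>z. ln (dd z) \<partial>\<mu>)"
  have "elog (dd z) = ereal (ln (dd z))" for z using dpos[of z] by (simp add: elog_def)
  then have "C_const E w \<mu> F = ereal (I + F)"
    unfolding C_const_def dd_def[symmetric] I_def by (simp add: eint_real[OF mu.integrable_cont[OF ldc]])
  then obtain y where y: "x < ereal y" "y < I + F" using x ereal_dense2[of x "ereal (I + F)"] by auto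
  define \<eta> where "\<eta> = I + F - y"
  have \<eta>: "0 < \<eta>" using y by (simp add: \<eta>_def)
  have "\<exists>t\<in>E. exp (- \<eta>) * dd z < w t * cmod (z - t)" for z
  proof -
    have "exp (- \<eta>) * dd z < 1 * dd z" using \<eta> dpos[of z] by (intro mult_strict_right_mono) auto
    then show ?thesis
      unfolding dd_def by (simp add: farthest_dist_def less_cSUP_iff[OF E_nonempty farthest_bdd])
  qed
  then obtain t where t: "\<And>z. t z \<in> E" "\<And>z. exp (- \<eta>) * dd z < w (t z) * cmod (z - t z)" by metis
  define U where "U z = {y. exp (- \<eta>) * dd y < w (t z) * cmod (y - t z)}" for z
  have Uo: "open (U z)" for z unfolding U_def by (intro open_Collect_less continuous_intros dc)
  have "S \<subseteq> (\<Union>z\<in>S. U z)" using t(2) by (auto simp: U_def)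
  then obtain J where J: "J \<subseteq> S" "finite J" "S \<subseteq> (\<Union>z\<in>J. U z)"
    using compactE_image[OF S_props(1), of S U] Uo by metis
  obtain l where l: "set l = t ` J" using finite_list[OF finite_imageI[OF J(2), of t]] by blast
  obtain a where a: "a \<in> E" using E_nonempty by blast
  \<comment> \<open>The padding guarantees at least two points; adding points of \<open>E\<close>
    can only raise the maximum.\<close>
  define l' where "l' = l @ [a, a]"
  define m where "m = length l'"
  define c where "c k = l' ! k" for k
  have m: "2 \<le> m" by (simp add: m_def l'_def)
  have cE: "c k \<in> E" if "k < m" for k
  proof -
    have "c k \<in> set l'" using that by (simp add: c_def m_def)
    then show ?thesis using l t(1) a by (auto simp: l'_def)
  qed
  have m0: "0 < m" using m by simp
  define f where "f = maxdist (\<lambda>k. w (c k)) c m"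
  have f0: "0 \<le> f z" for z
    using maxdist_ge[OF m0, of "\<lambda>k. w (c k)" z c] w_nonneg[OF cE[OF m0]] unfolding f_def
    by (meson mult_nonneg_nonneg norm_ge_zero order_trans)
  have fl: "exp (- \<eta>) * dd z \<le> f z" if z: "z \<in> S" for z
  proof -
    obtain s where s: "s \<in> J" "z \<in> U s" using J(3) z by blast
    then have "t s \<in> set l'" using l by (auto simp: l'_def)
    then obtain k where k: "k < m" "c k = t s" by (auto simp: in_set_conv_nth m_def c_def)
    have "exp (- \<eta>) * dd z < w (t s) * cmod (z - t s)" using s by (simp add: U_def)
    also have "\<dots> \<le> f z" unfolding f_def using maxdist_ge[OF k(1), of "\<lambda>k. w (c k)" z c] k(2) by simp
    finally show ?thesis by simp
  qed
  have "eint \<mu> (\<lambda>z. elog (f z)) = (INF n. ereal (\<integral>z. ln (max (1 / Suc n) (f z)) \<partial>\<mu>))"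
    unfolding f_def by (rule mu.eint_elog[OF f0[unfolded f_def] continuous_on_ln_max_maxdist[OF m0]]) simp
  moreover have "I - \<eta> \<le> (\<integral>z. ln (max (1 / Suc n) (f z)) \<partial>\<mu>)" for n
  proof -
    have "I - \<eta> = (\<integral>z. ln (dd z) - \<eta> \<partial>\<mu>)"
      unfolding I_def using mu.integrable_cont[OF ldc] mu_mass by (simp add: mu.space_eq)
    also have "\<dots> \<le> (\<integral>z. ln (max (1 / Suc n) (f z)) \<partial>\<mu>)"
    proof (rule mu.integral_mono_C)
      show "continuous_on UNIV (\<lambda>z. ln (dd z) - \<eta>)" by (intro continuous_on_diff ldc continuous_on_const)
      show "continuous_on UNIV (\<lambda>z. ln (max (1 / Suc n) (f z)))"
        unfolding f_def by (rule continuous_on_ln_max_maxdist[OF m0]) simp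
      fix z assume z: "z \<in> S"
      have "ln (dd z) - \<eta> = ln (exp (- \<eta>) * dd z)" using dpos[of z] by (simp add: ln_mult)
      also have "\<dots> \<le> ln (max (1 / Suc n) (f z))" using fl[OF z] dpos[of z] by (intro ln_mono) auto
      finally show "ln (dd z) - \<eta> \<le> ln (max (1 / Suc n) (f z))" .
    qed
    finally show ?thesis .
  qed
  ultimately have "ereal (I - \<eta>) \<le> eint \<mu> (\<lambda>z. elog (f z))" by (simp add: INF_greatest)
  also have "\<dots> \<le> (SUP c\<in>{c. \<forall>k<m. c k \<in> E}. eint \<mu> (\<lambda>z. elog (maxdist (\<lambda>k. w (c k)) c m z)))"
    unfolding f_def by (rule SUP_upper) (use cE in simp)
  finally have "ereal (I - \<eta>) + ereal F \<le> C_m E w \<mu> F m"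
    unfolding C_m_def maxdist_def by (rule add_right_mono)
  then have "ereal y \<le> C_m E w \<mu> F m" by (simp add: \<eta>_def)
  then show ?thesis using y(1) m order_less_le_trans by blast
qed

end

theorem theorem3p2:
  fixes E :: "complex set" and w :: "complex \<Rightarrow> real"
    and \<mu> :: "complex measure" and F :: real
  assumes "closed E"
    and "admissible_weight E w"
    and "weighted_equilibrium E w \<mu> F"
  shows "(\<forall>m \<nu>. measure_family m \<nu> \<longrightarrow>
            lhs_sum E w m \<nu> \<le> C_m E w \<mu> F m + sup_total E w m \<nu> \<and>
            C_m E w \<mu> F m + sup_total E w m \<nu> \<le> C_const E w \<mu> F + sup_total E w m \<nu>)
       \<and> (\<forall>m\<ge>2. \<forall>c < C_m E w \<mu> F m. \<exists>\<nu>. measure_family m \<nu> \<and>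
            lhs_sum E w m \<nu> > c + sup_total E w m \<nu>)
       \<and> (\<forall>c < C_const E w \<mu> F. \<exists>m \<nu>. measure_family m \<nu> \<and>
            lhs_sum E w m \<nu> > c + sup_total E w m \<nu>)"
proof -
  interpret weighted_setting E w \<mu> F
    using assms by unfold_locales
  have "0 < m" if "measure_family m \<nu>" for m \<nu>
    using that by (cases m) (auto simp: measure_family_def)
  then have "lhs_sum E w m \<nu> \<le> C_m E w \<mu> F m + sup_total E w m \<nu>"
    "C_m E w \<mu> F m + sup_total E w m \<nu> \<le> C_const E w \<mu> F + sup_total E w m \<nu>"
    if "measure_family m \<nu>" for m \<nu>
    using that upper_bound[OF that] by (auto intro!: add_right_mono C_m_le_C_const)
  moreover have "\<exists>m \<nu>. measure_family m \<nu> \<and> lhs_sum E w m \<nu> > c + sup_total E w m \<nu>"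
    if "c < C_const E w \<mu> F" for c
    using C_const_approx[OF that] sharp_m by blast
  ultimately show ?thesis using sharp_m by blast
qed

end
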